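(* Let $\gamma/\!/\beta$ be a uniform skew composition shape. Then $\mathcal S_{\gamma/\!/\beta}$ is symmetric, and expands as a nonnegative integer linear combination of Schur functions.
   Context: A composition is a finite (possibly empty) sequence of positive integers; $\ell(\alpha)$ is its number of parts. Its diagram has $\alpha_i$ left-justified cells in row $i$, rows numbered from the top; cells are indexed (row, column). A skew composition shape $\gamma/\!/\beta$ is given by compositions $\beta,\gamma$ with $\ell(\beta)\le\ell(\gamma)$ and $\beta_{\ell(\beta)-i}\le\gamma_{\ell(\gamma)-i}$ for $0\le i<\ell(\beta)$; its diagram is the set of cells of $\gamma$ not in $\beta$ when $\beta$ is placed in the lower left of $\gamma$. It is uniform if all rows of the skew shape that have a cell in the first column are of the same length, that is, $\gamma_i=\gamma_j$ for all $1\le i<j\le\ell(\gamma)-\ell(\beta)$. A semistandard composition tableau (SSCT) of (straight) shape $\alpha$ is a filling $T$ of the diagram of $\alpha$ by positive integers with rows weakly decreasing left to right, first column strictly increasing top to bottom, and such that if $i<j$, $(i,k)$ and $(j,k+1)$ are cells of $\alpha$ and $T(j,k+1)\le T(i,k)$, then $(i,k+1)$ is a cell of $\alpha$ and $T(j,k+1)<T(i,k+1)$. The quasisymmetric Schur functions $\mathcal S_\alpha=\sum_T\prod_cx_{T(c)}$ (sum over SSCT of shape $\alpha$) form a basis of the Hopf algebra $QSym$ of quasisymmetric functions over $\mathbb Q$, with coproduct $\Delta M_\alpha=\sum_{\beta\gamma=\alpha}M_\beta\otimes M_\gamma$ (concatenation) on the monomial basis. The skew quasisymmetric Schur functions $\mathcal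 S_{\gamma/\!/\beta}$ are defined by $\Delta\mathcal S_\gamma=\sum_\beta\mathcal S_{\gamma/\!/\beta}\otimes\mathcal S_\beta$, $\beta$ ranging over all compositions. *)

theory Defs
  imports Complex_Main "HOL-Library.Multiset" "HOL-Library.FuncSet" "HOL-Combinatorics.Permutations"
begin

definition composition :: "nat list \<Rightarrow> bool" where
  "composition \<alpha> \<longleftrightarrow> (\<forall>a \<in> set \<alpha>. 0 < a)"

definition int_partition :: "nat list \<Rightarrow> bool" where
  "int_partition \<nu> \<longleftrightarrow> composition \<nu> \<and> sorted_wrt (\<ge>) \<nu>"

text \<open>Cells are pairs (row, column), rows counted from the top; both coordinates start at 0.\<close>

definition diagram :: "nat list \<Rightarrow> (nat \<times> nat) set" where
  "diagram \<alpha> = {(i, k). i < length \<alpha> \<and> k < \<alpha> ! i}"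

definition skew_shape :: "nat list \<Rightarrow> nat list \<Rightarrow> bool" where
  "skew_shape \<gamma> \<beta> \<longleftrightarrow> composition \<gamma> \<and> composition \<beta> \<and> length \<beta> \<le> length \<gamma> \<and>
     (\<forall>i < length \<beta>. \<beta> ! (length \<beta> - 1 - i) \<le> \<gamma> ! (length \<gamma> - 1 - i))"

text \<open>
  In a skew shape with \<^term>\<open>\<beta>\<close> placed in the lower left of \<^term>\<open>\<gamma>\<close>, the rows with a cell in
  the first column are the top \<^term>\<open>length \<gamma> - length \<beta>\<close> ones.
\<close>

definition uniform_skew_shape :: "nat list \<Rightarrow> nat list \<Rightarrow> bool" where
  "uniform_skew_shape \<gamma> \<beta> \<longleftrightarrow> skew_shape \<gamma> \<beta> \<and>
     (\<forall>i j. i < j \<and> j < length \<gamma> - length \<beta> \<longrightarrow> \<gamma> ! i = \<gamma> ! j)"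

text \<open>
  A formal power series over the rationals is given by its coefficients; a monomial is the
  multiset of the indices of its variables. The variables are \<open>x\<^sub>1, x\<^sub>2, \<dots>\<close>: series
  have coefficient 0 at monomials that contain the index 0.
\<close>

type_synonym series = "nat multiset \<Rightarrow> rat"

definition bounded_degree :: "series \<Rightarrow> bool" where
  "bounded_degree f \<longleftrightarrow> (\<forall>m. 0 \<in># m \<longrightarrow> f m = 0) \<and> (\<exists>d. \<forall>m. f m \<noteq> 0 \<longrightarrow> size m \<le> d)"

text \<open>The increasing index sequences \<open>0 < i\<^sub>1 < \<dots> < i\<^sub>k\<close>.\<close>

definition index_seqs :: "nat \<Rightarrow> nat list set" where
  "index_seqs k = {is. length is = k \<and> sorted_wrt (<) is \<and> 0 \<notin> set is}"

text \<open>The monomial \<open>x\<^bsub>i\<^sub>1\<^esub>^\<alpha>\<^sub>1 \<cdots> x\<^bsub>i\<^sub>k\<^esub>^\<alpha>\<^sub>k\<close>.\<close>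

definition monomial_at :: "nat list \<Rightarrow> nat list \<Rightarrow> nat multiset" where
  "monomial_at is \<alpha> = (\<Sum>(i, a) \<leftarrow> zip is \<alpha>. replicate_mset a i)"

definition QSym :: "series set" where
  "QSym = {f. bounded_degree f \<and>
     (\<forall>\<alpha>. composition \<alpha> \<longrightarrow>
        (\<forall>is \<in> index_seqs (length \<alpha>). \<forall>js \<in> index_seqs (length \<alpha>).
           f (monomial_at is \<alpha>) = f (monomial_at js \<alpha>)))}"

definition Sym :: "series set" where
  "Sym = {f. bounded_degree f \<and>
     (\<forall>\<pi> m. \<pi> permutes {0<..} \<longrightarrow> f (image_mset \<pi> m) = f m)}"

definition monomial_qsym :: "nat list \<Rightarrow> series" where
  "monomial_qsym \<alpha> = (\<lambda>m. of_nat (card {is \<in> index_seqs (length \<alpha>). monomial_at is \<alpha> = m}))"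

text \<open>
  The coefficient of \<^term>\<open>monomial_qsym \<alpha>\<close> in the expansion of a quasisymmetric function is its
  coefficient at \<open>x\<^sub>1^\<alpha>\<^sub>1 \<cdots> x\<^sub>k^\<alpha>\<^sub>k\<close>.
\<close>

definition monomial_coeff :: "series \<Rightarrow> nat list \<Rightarrow> rat" where
  "monomial_coeff f \<alpha> = f (monomial_at [1..<Suc (length \<alpha>)] \<alpha>)"

text \<open>
  The tensor square of \<^const>\<open>QSym\<close> is realized inside the power series in two sets of variables,
  with \<open>f \<otimes> g\<close> having coefficient \<open>f m * g n\<close> at the pair of monomials \<open>(m, n)\<close>.
  The coproduct is the linear extension of \<open>M\<^sub>\<alpha> \<mapsto> \<Sum> M\<^sub>\<beta> \<otimes> M\<^sub>\<delta>\<close>, summed over all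
  \<open>\<beta>\<close>, \<open>\<delta>\<close> whose concatenation is \<open>\<alpha>\<close>.
\<close>

type_synonym series2 = "nat multiset \<Rightarrow> nat multiset \<Rightarrow> rat"

definition tensor :: "series \<Rightarrow> series \<Rightarrow> series2" where
  "tensor f g = (\<lambda>m n. f m * g n)"

definition coproduct :: "series \<Rightarrow> series2" where
  "coproduct f = (\<lambda>m n. \<Sum>\<alpha> | composition \<alpha> \<and> monomial_coeff f \<alpha> \<noteq> 0.
     monomial_coeff f \<alpha> *
       (\<Sum>(\<beta>, \<delta>) | \<beta> @ \<delta> = \<alpha>. tensor (monomial_qsym \<beta>) (monomial_qsym \<delta>) m n))"

text \<open>Fillings are \<^const>\<open>undefined\<close> outside the diagram, so that they can be counted.\<close>

definition filling :: "nat list \<Rightarrow> (nat \<times> nat \<Rightarrow> nat) set" where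
  "filling \<alpha> = diagram \<alpha> \<rightarrow>\<^sub>E {0<..}"

definition tableau_content :: "nat list \<Rightarrow> (nat \<times> nat \<Rightarrow> nat) \<Rightarrow> nat multiset" where
  "tableau_content \<alpha> T = image_mset T (mset_set (diagram \<alpha>))"

definition SSCT :: "nat list \<Rightarrow> (nat \<times> nat \<Rightarrow> nat) set" where
  "SSCT \<alpha> = {T \<in> filling \<alpha>.
     (\<forall>i k. (i, Suc k) \<in> diagram \<alpha> \<longrightarrow> T (i, Suc k) \<le> T (i, k)) \<and>
     (\<forall>i j. i < j \<and> (i, 0) \<in> diagram \<alpha> \<and> (j, 0) \<in> diagram \<alpha> \<longrightarrow> T (i, 0) < T (j, 0)) \<and>
     (\<forall>i j k. i < j \<and> (i, k) \<in> diagram \<alpha> \<and> (j, Suc k) \<in> diagram \<alpha> \<and> T (j, Suc k) \<le> T (i, k)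
        \<longrightarrow> (i, Suc k) \<in> diagram \<alpha> \<and> T (j, Suc k) < T (i, Suc k))}"

definition qschur :: "nat list \<Rightarrow> series" where
  "qschur \<alpha> = (\<lambda>m. of_nat (card {T \<in> SSCT \<alpha>. tableau_content \<alpha> T = m}))"

definition SSYT :: "nat list \<Rightarrow> (nat \<times> nat \<Rightarrow> nat) set" where
  "SSYT \<nu> = {T \<in> filling \<nu>.
     (\<forall>i k. (i, Suc k) \<in> diagram \<nu> \<longrightarrow> T (i, k) \<le> T (i, Suc k)) \<and>
     (\<forall>i k. (Suc i, k) \<in> diagram \<nu> \<longrightarrow> T (i, k) < T (Suc i, k))}"

definition schur :: "nat list \<Rightarrow> series" where
  "schur \<nu> = (\<lambda>m. of_nat (card {T \<in> SSYT \<nu>. tableau_content \<nu> T = m}))"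

text \<open>
  \<^term>\<open>skew_family \<gamma> F\<close> says that the coproduct of \<^term>\<open>qschur \<gamma>\<close> is the sum of
  \<^term>\<open>tensor (F \<beta>) (qschur \<beta>)\<close> over all compositions \<^term>\<open>\<beta>\<close>, almost all \<^term>\<open>F \<beta>\<close>
  being zero. Since the \<^term>\<open>qschur \<beta>\<close> form a basis of \<^const>\<open>QSym\<close>, this determines
  \<^term>\<open>F\<close>; its values at lists that are not compositions are set to zero.
\<close>

definition skew_family :: "nat list \<Rightarrow> (nat list \<Rightarrow> series) \<Rightarrow> bool" where
  "skew_family \<gamma> F \<longleftrightarrow>
     (\<forall>\<beta>. F \<beta> \<in> QSym) \<and> (\<forall>\<beta>. \<not> composition \<beta> \<longrightarrow> F \<beta> = (\<lambda>_. 0)) \<and>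
     finite {\<beta>. F \<beta> \<noteq> (\<lambda>_. 0)} \<and>
     coproduct (qschur \<gamma>) =
       (\<lambda>m n. \<Sum>\<beta> | F \<beta> \<noteq> (\<lambda>_. 0). tensor (F \<beta>) (qschur \<beta>) m n)"

definition skew_qschur :: "nat list \<Rightarrow> nat list \<Rightarrow> series" where
  "skew_qschur \<gamma> = (THE F. skew_family \<gamma> F)"

end

theory Submission
  imports Defs
begin

text \<open>
  The coproduct cuts a composition tableau of shape \<open>\<gamma>\<close> at a threshold: the large entries form a
  tableau of some shape \<open>\<beta>\<close> in the lower left, the small ones fill the rest. Adding the small
  entries back one value at a time, from the largest to the smallest, is a chain of shapes from
  \<open>\<beta>\<close> (with empty rows on top) to \<open>\<gamma>\<close>, whose steps, called strips below, can be recognised from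
  two consecutive shapes alone. Hence the coefficients of \<open>S\<^bsub>\<gamma>//\<beta>\<^esub>\<close> count chains of strips
  (\<open>skew_qschur_eq\<close>). That this is what the coproduct determines needs the linear independence of
  the quasisymmetric Schur functions, which is a triangularity with respect to partial sums of the
  parts, taken from the last part on (\<open>qschur_independent\<close>).

  A strip has at most one cell in each column, and it is determined by its set of columns: going
  through the columns from left to right, the new cell of a column \<open>c\<close> beyond the first is put on
  the topmost row whose current length is \<open>c - 1\<close>, and a new cell in the first column opens the
  lowest empty row. So a chain of strips is a sequence of column sets acting on shapes
  (\<open>chain_count_col_ops_top\<close>).

  The rule for the first column is the exception. Suppose that it is replaced by the rule of the
  other columns, so that the topmost empty row is opened. The rows without cells of \<open>\<beta>\<close> are then
  opened in another order, but at each moment the same lengths occur among them, and the rows of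
  \<open>\<beta>\<close> do not notice the difference. If \<open>\<gamma>//\<beta>\<close> is uniform, then these rows all have the same length
  in \<open>\<gamma>\<close>, so that \<open>\<gamma>\<close> is reached under one rule if and only if it is reached under the other
  (\<open>col_ops_top_iff_col_ops\<close>).

  Under the modified rule the column operators satisfy the plactic relations, in the form of an
  exchange rule for two column sets (\<open>col_op_bump\<close>). Therefore the composite of a sequence of
  operators depends only on the tableau that column insertion, the dual form of the
  Robinson-Schensted-Knuth correspondence, assigns to the sequence; and for each tableau the
  sequences correspond to the Gelfand-Tsetlin patterns whose top row lists the lengths of its
  columns. These patterns are counted by the coefficients of a Schur function. So \<open>S\<^bsub>\<gamma>//\<beta>\<^esub>\<close> is the
  sum, over the tableaux that carry \<open>\<beta>\<close> to \<open>\<gamma>\<close>, of the Schur functions of their conjugate shapes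
  (\<open>card_col_ops\<close>, \<open>sum_tabs_by_shape\<close>), and it is symmetric because Schur functions are.
\<close>

section \<open>Strips and chains of shapes\<close>

text \<open>
  Let \<open>T\<close> be a composition tableau of shape \<open>x\<close> and \<open>z\<close> the shape of the cells of \<open>T\<close> with an
  entry greater than the smallest. The conditions on \<open>T\<close> that involve the smallest entry say
  exactly that \<open>z\<close> and \<open>x\<close> are in this relation: the second conjunct comes from the strict
  increase of the first column, the third from the triple condition applied at a cell \<open>(j, k + 1)\<close>
  with the smallest entry. Both shapes have the same number of rows, some of them empty.
\<close>

definition strip :: "nat list \<Rightarrow> nat list \<Rightarrow> bool" where
  "strip z x \<longleftrightarrow> list_all2 (\<le>) z x \<and>
     (\<forall>i j. i < j \<and> j < length x \<and> 0 < x ! i \<and> 0 < x ! j \<longrightarrow> 0 < z ! j) \<and>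
     (\<forall>i j k. i < j \<and> j < length x \<and> k < x ! i \<and> z ! j \<le> Suc k \<and> Suc k < x ! j \<longrightarrow> Suc k < z ! i)"

text \<open>
  The head of the list is the size of the last strip of the chain, the one that ends in \<open>x\<close>,
  because tableaux are peeled from their smallest entry on.
\<close>

fun chain_count :: "nat list \<Rightarrow> nat list \<Rightarrow> nat list \<Rightarrow> nat" where
  "chain_count y [] x = of_bool (x = y)"
| "chain_count y (k # ks) x = (\<Sum>z | strip z x \<and> sum_list x = sum_list z + k. chain_count y ks z)"

abbreviation below :: "nat list \<Rightarrow> nat list set" where
  "below x \<equiv> {z. list_all2 (\<le>) z x}"

lemma finite_below: "finite (below x)"
proof (induction x)
  case (Cons a x)
  have "below (a # x) = (\<lambda>(b, z). b # z) ` ({..a} \<times> below x)"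
    by (auto simp: list_all2_Cons2)
  then show ?case
    using Cons by simp
qed simp

lemma strip_below: "strip z x \<Longrightarrow> z \<in> below x"
  by (simp add: strip_def)

lemma finite_strip: "finite {z. strip z x \<and> Q z}"
  by (rule finite_subset[OF _ finite_below[of x]]) (auto simp: strip_def)

lemma strip_length: "strip z x \<Longrightarrow> length z = length x"
  by (auto simp: strip_def list_all2_lengthD)

lemma below_trans: "z \<in> below y \<Longrightarrow> y \<in> below x \<Longrightarrow> z \<in> below x"
  by (auto intro: list_all2_trans[rotated])

lemma below_sum_le: "z \<in> below x \<Longrightarrow> sum_list z \<le> sum_list x"
  by (simp add: sum_list_mono2 list_all2_conv_all_nth)

lemma below_sum_eq: "z \<in> below x \<Longrightarrow> sum_list z = sum_list x \<Longrightarrow> z = x"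
proof (induction x arbitrary: z)
  case (Cons a x)
  then obtain b z' where z: "z = b # z'" "b \<le> a" "z' \<in> below x"
    by (auto simp: list_all2_Cons2)
  with below_sum_le[of z' x] Cons.prems(2) have "b = a" "sum_list z' = sum_list x"
    by auto
  with Cons.IH z show ?case by simp
qed simp

lemma strip_refl: "strip x x"
  by (auto simp: strip_def intro: list.rel_refl)

lemma chain_count_below: "chain_count y ks x \<noteq> 0 \<Longrightarrow> y \<in> below x"
proof (induction ks arbitrary: x)
  case (Cons k ks)
  then obtain z where "strip z x" "chain_count y ks z \<noteq> 0"
    by (auto simp: finite_strip)
  with Cons.IH show ?case
    using below_trans strip_below by blast
qed (auto intro: list.rel_refl split: if_splits)

lemma chain_count_sum: "chain_count y ks x \<noteq> 0 \<Longrightarrow> sum_list x = sum_list y + sum_list ks"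
proof (induction ks arbitrary: x)
  case (Cons k ks)
  then obtain z where "sum_list x = sum_list z + k" "chain_count y ks z \<noteq> 0"
    by (auto simp: finite_strip)
  with Cons.IH show ?case by fastforce
qed (auto split: if_splits)

lemma chain_count_append:
  "chain_count y (ks @ ls) x = (\<Sum>z\<in>below x. chain_count z ks x * chain_count y ls z)"
proof (induction ks arbitrary: x)
  case Nil
  have "(\<Sum>z\<in>below x. chain_count z [] x * chain_count y ls z) = (\<Sum>z\<in>{x}. chain_count z [] x * chain_count y ls z)"
    by (rule sum.mono_neutral_right) (auto simp: finite_below intro: list.rel_refl)
  then show ?case by simp
next
  case (Cons k ks)
  let ?Z = "{z. strip z x \<and> sum_list x = sum_list z + k}"
  have "chain_count y ((k # ks) @ ls) x = (\<Sum>w\<in>?Z. \<Sum>z\<in>below w. chain_count z ks w * chain_count y ls z)"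
    using Cons by simp
  also have "\<dots> = (\<Sum>w\<in>?Z. \<Sum>z\<in>below x. chain_count z ks w * chain_count y ls z)"
  proof (rule sum.cong[OF refl], rule sum.mono_neutral_left)
    fix w assume "w \<in> ?Z"
    then show "below w \<subseteq> below x"
      using below_trans strip_below by blast
    show "\<forall>z\<in>below x - below w. chain_count z ks w * chain_count y ls z = 0"
      using chain_count_below by fastforce
  qed (rule finite_below)
  also have "\<dots> = (\<Sum>z\<in>below x. chain_count z (k # ks) x * chain_count y ls z)"
    by (subst sum.swap) (simp add: sum_distrib_right)
  finally show ?case .
qed

text \<open>
  A strip without cells is trivial. This is what makes the count a quasisymmetric function of the
  variables.
\<close>

lemma chain_count_0: "chain_count y (0 # ks) x = chain_count y ks x"
proof -
  have "{z. strip z x \<and> sum_list x = sum_list z + 0} = {x}"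
    using below_sum_eq strip_below strip_refl by fastforce
  then show ?thesis by simp
qed

lemma chain_count_filter: "chain_count y (filter (\<lambda>k. k \<noteq> 0) ks) x = chain_count y ks x"
proof (induction ks arbitrary: x)
  case (Cons k ks)
  then show ?case by (cases "k = 0") (use chain_count_0 in auto)
qed simp

lemma strip_Cons0: "strip (0 # z) (0 # x) \<longleftrightarrow> strip z x"
proof
  assume s: "strip z x"
  show "strip (0 # z) (0 # x)"
    unfolding strip_def
  proof (intro conjI allI impI)
    show "list_all2 (\<le>) (0 # z) (0 # x)" using s by (simp add: strip_def)
  next
    fix i j assume "i < j \<and> j < length (0 # x) \<and> 0 < (0 # x) ! i \<and> 0 < (0 # x) ! j"
    with s show "0 < (0 # z) ! j"
      unfolding strip_def by (cases i; cases j) auto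
  next
    fix i j k
    assume "i < j \<and> j < length (0 # x) \<and> k < (0 # x) ! i \<and> (0 # z) ! j \<le> Suc k \<and> Suc k < (0 # x) ! j"
    with s show "Suc k < (0 # z) ! i"
      unfolding strip_def by (cases i; cases j) auto
  qed
next
  assume "strip (0 # z) (0 # x)"
  then have *: "list_all2 (\<le>) z x"
     "\<And>i j. i < j \<and> j < length (0 # x) \<and> 0 < (0 # x) ! i \<and> 0 < (0 # x) ! j \<Longrightarrow> 0 < (0 # z) ! j"
     "\<And>i j k. i < j \<and> j < length (0 # x) \<and> k < (0 # x) ! i \<and> (0 # z) ! j \<le> Suc k \<and> Suc k < (0 # x) ! j \<Longrightarrow> Suc k < (0 # z) ! i"
    unfolding strip_def list_all2_Cons by blast+
  show "strip z x"
    unfolding strip_def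
    using *(1) *(2)[of "Suc _" "Suc _"] *(3)[of "Suc _" "Suc _"]
    by (simp, blast)
qed

lemma chain_count_Cons0: "chain_count (0 # y) ks (0 # x) = chain_count y ks x"
proof (induction ks arbitrary: x)
  case (Cons k ks)
  have "{z. strip z (0 # x) \<and> sum_list (0 # x) = sum_list z + k} =
        (#) 0 ` {z. strip z x \<and> sum_list x = sum_list z + k}" (is "?L = ?R")
  proof
    show "?L \<subseteq> ?R"
    proof
      fix z assume z: "z \<in> ?L"
      then obtain z' where "z = 0 # z'"
        by (auto simp: strip_def list_all2_Cons2)
      with z show "z \<in> ?R" by (auto simp: strip_Cons0)
    qed
  qed (auto simp: strip_Cons0)
  with Cons show ?case by (simp add: sum.reindex)
qed simp

lemma chain_count_replicate0:
  "chain_count (replicate d 0 @ y) ks (replicate d 0 @ x) = chain_count y ks x"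
  by (induction d) (auto simp: chain_count_Cons0)

text \<open>
  The shapes of the chains below: compositions with empty rows on top.
\<close>

definition zeros_first :: "nat list \<Rightarrow> bool" where
  "zeros_first x \<longleftrightarrow> (\<forall>i j. i < j \<and> j < length x \<and> 0 < x ! i \<longrightarrow> 0 < x ! j)"

lemma strip_zeros_first:
  assumes "strip z x" "zeros_first x"
  shows "zeros_first z"
  unfolding zeros_first_def
proof (intro allI impI)
  fix i j assume *: "i < j \<and> j < length z \<and> 0 < z ! i"
  have len: "length z = length x" using assms(1) strip_length by blast
  have "z ! i \<le> x ! i"
    using assms(1) * len by (auto simp: strip_def list_all2_conv_all_nth)
  with * len have xi: "i < j \<and> j < length x \<and> 0 < x ! i" by simp
  with assms(2) have "0 < x ! j" unfolding zeros_first_def by blast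
  with xi assms(1) show "0 < z ! j" unfolding strip_def by blast
qed

lemma chain_count_zeros_first: "chain_count y ks x \<noteq> 0 \<Longrightarrow> zeros_first x \<Longrightarrow> zeros_first y"
proof (induction ks arbitrary: x)
  case (Cons k ks)
  then obtain z where "strip z x" "chain_count y ks z \<noteq> 0"
    by (auto simp: finite_strip)
  with Cons show ?case
    using strip_zeros_first by blast
qed (auto split: if_splits)

definition pad :: "nat \<Rightarrow> nat list \<Rightarrow> nat list" where
  "pad n \<beta> = replicate (n - length \<beta>) 0 @ \<beta>"

lemma zeros_first_pad: "composition \<beta> \<Longrightarrow> zeros_first (pad n \<beta>)"
  by (auto simp: zeros_first_def pad_def composition_def nth_append)

lemma zeros_first_imp_pad:
  assumes "zeros_first x"
  shows "\<exists>\<beta>. composition \<beta> \<and> length \<beta> \<le> length x \<and> x = pad (length x) \<beta>"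
  using assms
proof (induction x)
  case (Cons a x)
  have "zeros_first x"
    unfolding zeros_first_def
  proof (intro allI impI)
    fix i j assume "i < j \<and> j < length x \<and> 0 < x ! i"
    with Cons.prems[unfolded zeros_first_def, rule_format, of "Suc i" "Suc j"] show "0 < x ! j"
      by simp
  qed
  then obtain \<beta> where b: "composition \<beta>" "length \<beta> \<le> length x" "x = pad (length x) \<beta>"
    using Cons.IH by blast
  show ?case
  proof (cases "a = 0")
    case True
    with b show ?thesis by (intro exI[of _ \<beta>]) (simp add: pad_def Suc_diff_le)
  next
    case False
    have "composition (a # x)"
      unfolding composition_def
    proof
      fix c assume "c \<in> set (a # x)"
      then obtain j where j: "j < length (a # x)" "c = (a # x) ! j"
        by (metis in_set_conv_nth)
      then show "0 < c"
        using Cons.prems[unfolded zeros_first_def, rule_format, of 0 j] False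
        by (cases j) auto
    qed
    then show ?thesis by (intro exI[of _ "a # x"]) (simp add: pad_def)
  qed
qed (simp add: composition_def pad_def)

lemma pad_inject:
  assumes "composition \<beta>" "composition \<delta>" "pad n \<beta> = pad n \<delta>"
  shows "\<beta> = \<delta>"
proof -
  have "filter (\<lambda>a. 0 < a) (pad n \<beta>) = \<beta>" if "composition \<beta>" for \<beta>
    using that by (auto simp: pad_def composition_def filter_id_conv)
  with assms show ?thesis by metis
qed

section \<open>Composition tableaux as chains\<close>

lemma diagram_finite: "finite (diagram x)"
proof -
  have "diagram x = Sigma {..<length x} (\<lambda>i. {..<x ! i})"
    by (auto simp: diagram_def)
  then show ?thesis by simp
qed

lemma card_diagram: "card (diagram x) = sum_list x"
proof -
  have "diagram x = Sigma {..<length x} (\<lambda>i. {..<x ! i})"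
    by (auto simp: diagram_def)
  then show ?thesis by (simp add: sum_list_sum_nth atLeast0LessThan)
qed

lemma diagram_mono: "z \<in> below x \<Longrightarrow> diagram z \<subseteq> diagram x"
  by (auto simp: diagram_def list_all2_conv_all_nth dest: order_less_le_trans)

lemma content_mem: "c \<in> diagram x \<Longrightarrow> T c \<in># tableau_content x T"
  by (simp add: tableau_content_def diagram_finite)

lemma content_size: "size (tableau_content x T) = sum_list x"
  by (simp add: tableau_content_def card_diagram)

lemma finite_fillings_content: "finite {T \<in> filling x. tableau_content x T = m}"
proof (rule finite_subset)
  show "{T \<in> filling x. tableau_content x T = m} \<subseteq> diagram x \<rightarrow>\<^sub>E set_mset m"
    by (force simp: filling_def PiE_iff content_mem)
  show "finite (diagram x \<rightarrow>\<^sub>E set_mset m)"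
    by (intro finite_PiE diagram_finite) auto
qed

text \<open>
  Used to compare the content of a tableau with that of the part that remains after all cells with
  the entry \<open>s\<close> are removed.
\<close>

lemma content_split:
  assumes sub: "D \<subseteq> diagram x"
    and T: "\<And>c. c \<in> D \<Longrightarrow> T c = T' c" "\<And>c. c \<in> diagram x - D \<Longrightarrow> T c = s"
  shows "image_mset T (mset_set (diagram x)) =
     image_mset T' (mset_set D) + replicate_mset (card (diagram x) - card D) s"
proof -
  have fin: "finite D" using sub diagram_finite finite_subset by blast
  have "mset_set (diagram x) = mset_set D + mset_set (diagram x - D)"
    using mset_set_Union[of D "diagram x - D"] fin sub
    by (simp add: diagram_finite Un_absorb1)
  moreover have "image_mset T (mset_set D) = image_mset T' (mset_set D)"
    using T(1) fin by (intro image_mset_cong) simp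
  moreover have "image_mset T (mset_set (diagram x - D)) = image_mset (\<lambda>_. s) (mset_set (diagram x - D))"
    using T(2) diagram_finite by (intro image_mset_cong) simp
  ultimately show ?thesis
    by (simp add: image_mset_const_eq card_Diff_subset fin sub)
qed

lemma diagram_inject:
  assumes "length x = length y" "diagram x = diagram y"
  shows "x = y"
proof (rule nth_equalityI[OF assms(1)])
  fix i assume i: "i < length x"
  have "k < x ! i \<longleftrightarrow> k < y ! i" for k
    using assms(2)[THEN eqset_imp_iff, of "(i, k)"] i assms(1) by (simp add: diagram_def)
  then show "x ! i = y ! i" by (meson linorder_neqE_nat order_less_irrefl)
qed

text \<open>
  The cells of a row whose entries lie above a bound form an initial segment; this turns their
  number into the length of the row that remains.
\<close>

lemma downset_eq_lessThan:
  fixes S :: "nat set"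
  assumes "finite S" "\<And>a b. a \<in> S \<Longrightarrow> b \<le> a \<Longrightarrow> b \<in> S"
  shows "S = {..<card S}"
proof (cases "S = {}")
  case False
  have "S = {..Max S}"
    using assms(2)[OF Max_in[OF assms(1) False]] Max_ge[OF assms(1)] by blast
  then have S: "S = {..<Suc (Max S)}" by (simp only: lessThan_Suc_atMost)
  have "card S = Suc (Max S)" by (subst S) simp
  with S show ?thesis by simp
qed simp

text \<open>
  Composition tableaux and semistandard tableaux are both peeled in this way: removing all cells
  with the entry \<open>s\<close> is a bijection onto the pairs of a shape related to \<open>x\<close> by \<open>R\<close> and a tableau
  of this shape. What is specific to the kind of tableau is that the removal leads to such a pair
  and that the cells can be put back. The common length \<open>l\<close> makes a shape determined by its
  diagram.
\<close>

lemma card_peel: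
  fixes Adm :: "nat list \<Rightarrow> (nat \<times> nat \<Rightarrow> nat) set"
  assumes Adm: "\<And>z. Adm z \<subseteq> filling z"
    and R: "\<And>z. R z \<Longrightarrow> diagram z \<subseteq> diagram x \<and> length z = l"
    and finR: "finite {z. R z \<and> sum_list x = sum_list z + count m s}"
    and down: "\<And>T. T \<in> Adm x \<Longrightarrow> tableau_content x T = m \<Longrightarrow>
      \<exists>z. R z \<and> diagram z = {c \<in> diagram x. T c \<noteq> s} \<and> restrict T (diagram z) \<in> Adm z"
    and up: "\<And>z T'. R z \<Longrightarrow> T' \<in> Adm z \<Longrightarrow> (\<And>c. c \<in> diagram z \<Longrightarrow> T' c \<in># m \<and> T' c \<noteq> s) \<Longrightarrow>
      (\<lambda>c. if c \<in> diagram z then T' c else if c \<in> diagram x then s else undefined) \<in> Adm x"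
  shows "card {T \<in> Adm x. tableau_content x T = m} =
    (\<Sum>z | R z \<and> sum_list x = sum_list z + count m s.
       card {T \<in> Adm z. tableau_content z T = filter_mset (\<lambda>i. i \<noteq> s) m})"
proof -
  let ?A = "{T \<in> Adm x. tableau_content x T = m}"
  let ?Z = "{z. R z \<and> sum_list x = sum_list z + count m s}"
  let ?B = "\<lambda>z. {T \<in> Adm z. tableau_content z T = filter_mset (\<lambda>i. i \<noteq> s) m}"
  let ?g = "\<lambda>(z, T'). \<lambda>c. if c \<in> diagram z then T' c else if c \<in> diagram x then s else undefined"
  have outside: "T c = undefined" if "T \<in> Adm z" "c \<notin> diagram z" for T z c
    using subsetD[OF Adm that(1)] that(2) by (auto simp: filling_def)
  have entry: "T' c \<in># m \<and> T' c \<noteq> s" if "T' \<in> ?B z" "c \<in> diagram z" for z T' c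
    using content_mem[OF that(2), of T'] that(1) by auto
  have inj: "inj_on ?g (Sigma ?Z ?B)"
  proof (rule inj_onI)
    fix p q assume pq: "p \<in> Sigma ?Z ?B" "q \<in> Sigma ?Z ?B" "?g p = ?g q"
    obtain z T w U where p: "p = (z, T)" and q: "q = (w, U)" by (cases p, cases q)
    have eq: "?g (z, T) c = ?g (w, U) c" for c using pq(3) p q by metis
    have cells: "diagram v = {c \<in> diagram x. ?g (v, V) c \<noteq> s}" if "v \<in> ?Z" "V \<in> ?B v" for v V
      using R[of v] entry[OF that(2)] that(1) by auto
    have "diagram z = diagram w"
      using cells[of z T] cells[of w U] pq(1,2) unfolding p q eq by blast
    then have zw: "z = w" using R pq(1,2) p q by (intro diagram_inject) auto
    have "T c = U c" for c
      using eq[of c] outside[of T z c] outside[of U w c] pq(1,2) p q zw by (cases "c \<in> diagram z") auto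
    with p q zw show "p = q" by auto
  qed
  have "?g ` Sigma ?Z ?B = ?A"
  proof (intro equalityI subsetI)
    fix T assume "T \<in> ?g ` Sigma ?Z ?B"
    then obtain z T' where T: "T = ?g (z, T')" and z: "z \<in> ?Z" and T': "T' \<in> ?B z" by auto
    have "image_mset T (mset_set (diagram x)) =
        image_mset T' (mset_set (diagram z)) + replicate_mset (card (diagram x) - card (diagram z)) s"
      by (rule content_split) (use R[of z] z in \<open>auto simp: T\<close>)
    then have "tableau_content x T = filter_mset (\<lambda>i. i \<noteq> s) m + replicate_mset (count m s) s"
      using z T' by (simp add: tableau_content_def card_diagram)
    also have "\<dots> = m" by (intro multiset_eqI) auto
    finally show "T \<in> ?A" using up[of z T'] entry[OF T'] z T' by (simp add: T)
  next
    fix T assume T: "T \<in> ?A"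
    then obtain z where z: "R z" "diagram z = {c \<in> diagram x. T c \<noteq> s}" "restrict T (diagram z) \<in> Adm z"
      using down by blast
    let ?T' = "restrict T (diagram z)"
    have "image_mset T (mset_set (diagram x)) =
        image_mset ?T' (mset_set (diagram z)) + replicate_mset (card (diagram x) - card (diagram z)) s"
      by (rule content_split) (use z(2) in auto)
    then have split: "m = tableau_content z ?T' + replicate_mset (sum_list x - sum_list z) s"
      using T by (simp add: tableau_content_def card_diagram)
    have no: "s \<notin># tableau_content z ?T'"
      using z(2) by (auto simp: tableau_content_def diagram_finite)
    have m: "count m s = sum_list x - sum_list z"
      unfolding split using no by (simp add: not_in_iff)
    have m': "filter_mset (\<lambda>i. i \<noteq> s) m = tableau_content z ?T'"
      unfolding split using no by (intro multiset_eqI) (simp add: not_in_iff)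
    have "sum_list z \<le> sum_list x"
      unfolding card_diagram[symmetric] using R[OF z(1)] by (intro card_mono diagram_finite) simp
    with m m' z(1,3) have "(z, ?T') \<in> Sigma ?Z ?B" by simp
    moreover have "T = ?g (z, ?T')"
    proof
      fix c show "T c = ?g (z, ?T') c"
        using outside[of T x c] T z(2) by (cases "c \<in> diagram z") auto
    qed
    ultimately show "T \<in> ?g ` Sigma ?Z ?B" by (rule rev_image_eqI)
  qed
  then have "card ?A = card (Sigma ?Z ?B)" using card_image[OF inj] by simp
  also have "\<dots> = (\<Sum>z\<in>?Z. card (?B z))"
  proof (rule card_SigmaI[OF finR], rule ballI)
    show "finite (?B z)" for z
      by (rule finite_subset[OF _ finite_fillings_content[of z]]) (use Adm in blast)
  qed
  finally show ?thesis .
qed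

definition shape_above :: "nat list \<Rightarrow> nat \<Rightarrow> (nat \<times> nat \<Rightarrow> nat) \<Rightarrow> nat list" where
  "shape_above x s T = map (\<lambda>i. card {k. k < x ! i \<and> s < T (i, k)}) [0..<length x]"

lemma SSCT_tripleD:
  assumes "T \<in> SSCT x" "i < j" "(i, k) \<in> diagram x" "(j, Suc k) \<in> diagram x" "T (j, Suc k) \<le> T (i, k)"
  shows "(i, Suc k) \<in> diagram x" "T (j, Suc k) < T (i, Suc k)"
  using assms unfolding SSCT_def by blast+

lemma SSCT_colD:
  "T \<in> SSCT x \<Longrightarrow> i < j \<Longrightarrow> (i, 0) \<in> diagram x \<Longrightarrow> (j, 0) \<in> diagram x \<Longrightarrow> T (i, 0) < T (j, 0)"
  unfolding SSCT_def by blast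

lemma SSCT_rowD: "T \<in> SSCT x \<Longrightarrow> (i, Suc k) \<in> diagram x \<Longrightarrow> T (i, Suc k) \<le> T (i, k)"
  unfolding SSCT_def by blast

lemma SSCT_row:
  assumes "T \<in> SSCT x" "i < length x" "k' < x ! i" "k \<le> k'"
  shows "T (i, k') \<le> T (i, k)"
  using assms(4,3)
proof (induction k' rule: dec_induct)
  case (step n)
  have "T (i, Suc n) \<le> T (i, n)"
    using assms(1,2) step.prems by (auto simp: SSCT_def diagram_def)
  with step show ?case by fastforce
qed simp

lemma diagram_shape_above:
  assumes "T \<in> SSCT x"
  shows "(i, k) \<in> diagram (shape_above x s T) \<longleftrightarrow> (i, k) \<in> diagram x \<and> s < T (i, k)"
proof (cases "i < length x")
  case True
  have "{k. k < x ! i \<and> s < T (i, k)} = {..<card {k. k < x ! i \<and> s < T (i, k)}}"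
    using SSCT_row[OF assms True] by (intro downset_eq_lessThan) (auto dest: order_less_le_trans)
  then have "k < card {k. k < x ! i \<and> s < T (i, k)} \<longleftrightarrow> k < x ! i \<and> s < T (i, k)"
    by blast
  with True show ?thesis by (simp add: shape_above_def diagram_def)
qed (simp add: shape_above_def diagram_def)

lemma diagram_left: "(i, Suc k) \<in> diagram x \<Longrightarrow> (i, k) \<in> diagram x"
  by (simp add: diagram_def)

text \<open>
  The rows of a composition tableau weakly decrease, so the entries greater than the smallest
  entry \<open>s\<close> form a shape \<open>z\<close>. Every condition on a tableau either compares two entries greater
  than \<open>s\<close>, and then concerns the restriction to \<open>z\<close> only, or involves an entry \<open>s\<close>, and then
  depends only on the position of \<open>z\<close> in \<open>x\<close>.
\<close>

lemma SSCT_peel: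
  assumes m: "\<And>i. i \<in># m \<Longrightarrow> s \<le> i" and s: "0 < s"
  shows "card {T \<in> SSCT x. tableau_content x T = m} =
    (\<Sum>z | strip z x \<and> sum_list x = sum_list z + count m s.
       card {T \<in> SSCT z. tableau_content z T = filter_mset (\<lambda>i. i \<noteq> s) m})"
proof (rule card_peel[where l = "length x"])
  show "SSCT z \<subseteq> filling z" for z by (auto simp: SSCT_def)
  show "diagram z \<subseteq> diagram x \<and> length z = length x" if "strip z x" for z
    using diagram_mono[OF strip_below[OF that]] strip_length[OF that] by simp
  show "finite {z. strip z x \<and> sum_list x = sum_list z + count m s}" by (rule finite_strip)
next
  fix T assume TS: "T \<in> SSCT x" and c: "tableau_content x T = m"
  define z where "z = shape_above x s T"
  define T' where "T' = restrict T (diagram z)"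
  have ge: "s \<le> T c" if "c \<in> diagram x" for c
    using content_mem[OF that, of T] m c by simp
  have D: "(i, k) \<in> diagram z \<longleftrightarrow> (i, k) \<in> diagram x \<and> s < T (i, k)" for i k
    unfolding z_def by (rule diagram_shape_above[OF TS])
  then have Dsub: "diagram z \<subseteq> diagram x" by auto
  have len: "length z = length x" by (simp add: z_def shape_above_def)
  have all2: "list_all2 (\<le>) z x"
    unfolding list_all2_conv_all_nth
  proof (intro conjI allI impI)
    fix i assume "i < length z"
    then have "z ! i = card {k. k < x ! i \<and> s < T (i, k)}" by (simp add: z_def shape_above_def)
    also have "\<dots> \<le> card {..<x ! i}" by (intro card_mono) auto
    finally show "z ! i \<le> x ! i" by simp
  qed (rule len)
  have strip: "strip z x"
    unfolding strip_def
  proof (intro conjI allI impI)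
    fix i j assume *: "i < j \<and> j < length x \<and> 0 < x ! i \<and> 0 < x ! j"
    then have d: "(i, 0) \<in> diagram x" "(j, 0) \<in> diagram x" by (auto simp: diagram_def)
    with * have "T (i, 0) < T (j, 0)" using SSCT_colD[OF TS] by blast
    with ge[OF d(1)] d(2) D[of j 0] show "0 < z ! j" by (simp add: diagram_def)
  next
    fix i j k assume *: "i < j \<and> j < length x \<and> k < x ! i \<and> z ! j \<le> Suc k \<and> Suc k < x ! j"
    then have d: "(i, k) \<in> diagram x" "(j, Suc k) \<in> diagram x" "(j, Suc k) \<notin> diagram z"
      by (auto simp: diagram_def)
    with D[of j "Suc k"] ge have e: "T (j, Suc k) = s" by fastforce
    moreover have "T (j, Suc k) \<le> T (i, k)" using e ge[OF d(1)] by simp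
    ultimately have "(i, Suc k) \<in> diagram x" "s < T (i, Suc k)"
      using SSCT_tripleD[OF TS _ d(1,2)] * by auto
    with D[of i "Suc k"] show "Suc k < z ! i" by (simp add: diagram_def)
  qed (rule all2)
  have T': "T' \<in> SSCT z"
    unfolding SSCT_def
  proof (intro CollectI conjI allI impI)
    show "T' \<in> filling z"
      using TS Dsub by (auto simp: SSCT_def filling_def T'_def)
  next
    fix i k assume "(i, Suc k) \<in> diagram z"
    then have "(i, Suc k) \<in> diagram x" "(i, Suc k) \<in> diagram z" "(i, k) \<in> diagram z"
      using Dsub diagram_left by auto
    then show "T' (i, Suc k) \<le> T' (i, k)" using SSCT_rowD[OF TS] by (simp add: T'_def)
  next
    fix i j assume "i < j \<and> (i, 0) \<in> diagram z \<and> (j, 0) \<in> diagram z"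
    then show "T' (i, 0) < T' (j, 0)"
      using SSCT_colD[OF TS, of i j] subsetD[OF Dsub] by (simp add: T'_def)
  next
    fix i j k
    assume *: "i < j \<and> (i, k) \<in> diagram z \<and> (j, Suc k) \<in> diagram z \<and> T' (j, Suc k) \<le> T' (i, k)"
    then have "i < j" "(i, k) \<in> diagram x" "(j, Suc k) \<in> diagram x" "T (j, Suc k) \<le> T (i, k)"
      and gt: "s < T (j, Suc k)"
      using Dsub D by (auto simp: T'_def)
    then have *: "(i, Suc k) \<in> diagram x" "T (j, Suc k) < T (i, Suc k)"
      using SSCT_tripleD[OF TS] by blast+
    with gt have "(i, Suc k) \<in> diagram z" by (simp add: D)
    with * show "(i, Suc k) \<in> diagram z" "T' (j, Suc k) < T' (i, Suc k)"
      using \<open>i < j \<and> _\<close> by (auto simp: T'_def)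
  qed
  have "diagram z = {c \<in> diagram x. T c \<noteq> s}"
    using D ge by (auto simp: order.strict_iff_order)
  with strip T' show "\<exists>z. strip z x \<and> diagram z = {c \<in> diagram x. T c \<noteq> s} \<and> restrict T (diagram z) \<in> SSCT z"
    unfolding T'_def by blast
next
  fix z T'
  assume strip: "strip z x" and T': "T' \<in> SSCT z"
    and T'm: "\<And>c. c \<in> diagram z \<Longrightarrow> T' c \<in># m \<and> T' c \<noteq> s"
  define T where "T = (\<lambda>c. if c \<in> diagram z then T' c else if c \<in> diagram x then s else undefined)"
  have len: "length z = length x" using strip strip_length by blast
  have Dsub: "diagram z \<subseteq> diagram x" using strip strip_below diagram_mono by blast
  have gt: "s < T' c" if "c \<in> diagram z" for c
    using T'm[OF that] m[of "T' c"] by simp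
  have T1: "T c = T' c" if "c \<in> diagram z" for c using that by (simp add: T_def)
  have T2: "T c = s" if "c \<in> diagram x" "c \<notin> diagram z" for c using that by (simp add: T_def)
  have ge: "s \<le> T c" if "c \<in> diagram x" for c
    using gt[of c] that T1[of c] T2[of c] by (cases "c \<in> diagram z") auto
  have "T \<in> SSCT x"
    unfolding SSCT_def
  proof (intro CollectI conjI allI impI)
    show "T \<in> filling x"
      unfolding filling_def
    proof (rule PiE_I)
      fix c assume "c \<in> diagram x"
      with ge[of c] s show "T c \<in> {0<..}" by simp
    qed (use Dsub in \<open>auto simp: T_def\<close>)
  next
    fix i k assume *: "(i, Suc k) \<in> diagram x"
    show "T (i, Suc k) \<le> T (i, k)"
    proof (cases "(i, Suc k) \<in> diagram z")
      case True
      then show ?thesis using SSCT_rowD[OF T' True] T1 diagram_left by simp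
    next
      case False
      with * show ?thesis using T2 ge diagram_left by metis
    qed
  next
    fix i j assume *: "i < j \<and> (i, 0) \<in> diagram x \<and> (j, 0) \<in> diagram x"
    then have "0 < z ! j" using strip unfolding strip_def diagram_def by blast
    with * have j: "(j, 0) \<in> diagram z" using len by (simp add: diagram_def)
    show "T (i, 0) < T (j, 0)"
    proof (cases "(i, 0) \<in> diagram z")
      case True
      with j * SSCT_colD[OF T', of i j] show ?thesis by (simp add: T1)
    next
      case False
      with j * show ?thesis by (simp add: T1 T2 gt)
    qed
  next
    fix i j k
    assume *: "i < j \<and> (i, k) \<in> diagram x \<and> (j, Suc k) \<in> diagram x \<and> T (j, Suc k) \<le> T (i, k)"
    have "(i, Suc k) \<in> diagram z \<and> T (j, Suc k) < T' (i, Suc k)"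
    proof (cases "(j, Suc k) \<in> diagram z")
      case True
      with * gt T1 have "s < T (i, k)" by fastforce
      with * T2 have "(i, k) \<in> diagram z" by fastforce
      with * True SSCT_tripleD[OF T', of i j k] show ?thesis by (simp add: T1)
    next
      case False
      with * len have "i < j \<and> j < length x \<and> k < x ! i \<and> z ! j \<le> Suc k \<and> Suc k < x ! j"
        by (auto simp: diagram_def)
      then have "Suc k < z ! i" using strip unfolding strip_def by blast
      with * len have "(i, Suc k) \<in> diagram z" by (simp add: diagram_def)
      with False * show ?thesis by (simp add: T2 gt)
    qed
    then show "(i, Suc k) \<in> diagram x" "T (j, Suc k) < T (i, Suc k)"
      using Dsub T1 by auto
  qed
  then show "(\<lambda>c. if c \<in> diagram z then T' c else if c \<in> diagram x then s else undefined) \<in> SSCT x"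
    by (simp only: T_def)
qed

lemma SSCT_zeros: "SSCT (replicate n 0) = {\<lambda>_. undefined}"
proof -
  have "diagram (replicate n 0) = {}" by (auto simp: diagram_def)
  then show ?thesis by (simp add: SSCT_def filling_def)
qed

text \<open>
  Iterated peeling, the smallest value of the range first.
\<close>

lemma card_SSCT_range:
  assumes "0 < s" "\<And>i. i \<in># m \<Longrightarrow> s \<le> i \<and> i < s + l"
  shows "card {T \<in> SSCT x. tableau_content x T = m} =
     chain_count (replicate (length x) 0) (map (count m) [s..<s + l]) x"
  using assms
proof (induction l arbitrary: s m x)
  case 0
  then have m: "m = {#}" by (metis add.right_neutral multiset_nonemptyE not_less)
  show ?case
  proof (cases "x = replicate (length x) 0")
    case True
    then have "SSCT x = {\<lambda>_. undefined}" using SSCT_zeros by metis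
    moreover have "diagram x = {}"
      by (subst True) (auto simp: diagram_def)
    ultimately have "{T \<in> SSCT x. tableau_content x T = m} = {\<lambda>_. undefined}"
      by (auto simp: m tableau_content_def)
    with True show ?thesis by simp
  next
    case False
    then have "sum_list x \<noteq> 0"
      by (metis replicate_length_same sum_list_eq_0_iff)
    then have "tableau_content x T \<noteq> m" for T
      using content_size[of x T] m by auto
    with False show ?thesis by simp
  qed
next
  case (Suc l)
  let ?m = "filter_mset (\<lambda>i. i \<noteq> s) m"
  have range: "[s..<s + Suc l] = s # [Suc s..<Suc s + l]"
    by (simp add: upt_rec)
  have IH: "card {T \<in> SSCT z. tableau_content z T = ?m} =
     chain_count (replicate (length x) 0) (map (count m) [Suc s..<Suc s + l]) z" if "strip z x" for z
  proof -
    have "card {T \<in> SSCT z. tableau_content z T = ?m} =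
     chain_count (replicate (length z) 0) (map (count ?m) [Suc s..<Suc s + l]) z"
    proof (rule Suc.IH)
      fix i assume "i \<in># ?m"
      then have "i \<in># m" "i \<noteq> s" by auto
      with Suc.prems(2)[of i] show "Suc s \<le> i \<and> i < Suc s + l" by simp
    qed simp
    moreover have "map (count ?m) [Suc s..<Suc s + l] = map (count m) [Suc s..<Suc s + l]"
      by (intro map_cong) auto
    ultimately show ?thesis using strip_length[OF that] by (simp only:)
  qed
  have "card {T \<in> SSCT x. tableau_content x T = m} =
    (\<Sum>z | strip z x \<and> sum_list x = sum_list z + count m s. card {T \<in> SSCT z. tableau_content z T = ?m})"
    by (rule SSCT_peel) (use Suc.prems in auto)
  also have "\<dots> = chain_count (replicate (length x) 0) (map (count m) [s..<s + Suc l]) x"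
    unfolding range by (simp add: IH)
  finally show ?case .
qed

section \<open>Multiplicity sequences and the coproduct\<close>

text \<open>
  The exponents of a monomial in the order of its variables. A quasisymmetric function takes the
  same value at all monomials with the same exponent sequence.
\<close>

definition mults :: "nat multiset \<Rightarrow> nat list" where
  "mults m = map (count m) (sorted_list_of_set (set_mset m))"

lemma composition_mults: "composition (mults m)"
  by (auto simp: composition_def mults_def)

lemma sum_list_mults: "sum_list (mults m) = size m"
  by (simp add: mults_def size_multiset_overloaded_eq sum_list_distinct_conv_sum_set)

lemma mults_filter:
  assumes "\<And>i. i \<in># m \<Longrightarrow> s \<le> i \<and> i < s + l"
  shows "filter (\<lambda>k. k \<noteq> 0) (map (count m) [s..<s + l]) = mults m"
proof -
  have "filter (\<lambda>i. count m i \<noteq> 0) [s..<s + l] = sorted_list_of_set (set_mset m)"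
    by (rule sorted_distinct_set_unique) (use assms in \<open>auto simp: sorted_wrt_filter\<close>)
  then show ?thesis by (simp add: mults_def filter_map comp_def)
qed

text \<open>
  Strips of size zero may be inserted or dropped, so the counts over a range of variables and over
  the variables that occur agree.
\<close>

lemma chain_count_mults:
  assumes "\<And>i. i \<in># m \<Longrightarrow> s \<le> i \<and> i < s + l"
  shows "chain_count y (map (count m) [s..<s + l]) x = chain_count y (mults m) x"
  using chain_count_filter mults_filter[OF assms] by metis

lemma qschur_eq:
  assumes "0 \<notin># m"
  shows "qschur x m = of_nat (chain_count (replicate (length x) 0) (mults m) x)"
proof -
  define l where "l = Max (insert 0 (set_mset m))"
  have r: "1 \<le> i \<and> i < 1 + l" if "i \<in># m" for i
  proof -
    have "i \<le> l" unfolding l_def using that by (intro Max_ge) auto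
    moreover have "i \<noteq> 0" using assms that by metis
    ultimately show ?thesis by simp
  qed
  have "card {T \<in> SSCT x. tableau_content x T = m} =
     chain_count (replicate (length x) 0) (map (count m) [1..<1 + l]) x"
    by (rule card_SSCT_range) (use r in auto)
  also have "\<dots> = chain_count (replicate (length x) 0) (mults m) x"
    by (rule chain_count_mults[OF r])
  finally show ?thesis by (simp add: qschur_def)
qed

lemma qschur_0: "0 \<in># m \<Longrightarrow> qschur x m = 0"
proof -
  assume "0 \<in># m"
  then have "tableau_content x T \<noteq> m" if "T \<in> SSCT x" for T
    using that by (force simp: SSCT_def filling_def tableau_content_def diagram_finite PiE_iff)
  then have "{T \<in> SSCT x. tableau_content x T = m} = {}" by blast
  then show ?thesis by (simp only: qschur_def card.empty of_nat_0)
qed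

lemma monomial_at_Nil [simp]: "monomial_at [] \<alpha> = {#}"
  by (simp add: monomial_at_def)

lemma monomial_at_Cons [simp]:
  "monomial_at (i # is) (a # \<alpha>) = replicate_mset a i + monomial_at is \<alpha>"
  by (simp add: monomial_at_def)

lemma set_monomial_at:
  "length is = length \<alpha> \<Longrightarrow> composition \<alpha> \<Longrightarrow> set_mset (monomial_at is \<alpha>) = set is"
  by (induction "is" \<alpha> rule: list_induct2) (auto simp: composition_def)

lemma count_monomial_at:
  "length is = length \<alpha> \<Longrightarrow> distinct is \<Longrightarrow> map (count (monomial_at is \<alpha>)) is = \<alpha>"
proof (induction "is" \<alpha> rule: list_induct2)
  case (Cons i "is" a \<alpha>)
  have "count (monomial_at js bs) i = 0" if "i \<notin> set js" "length js = length bs" for js bs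
    using that(2,1) by (induction js bs rule: list_induct2) auto
  moreover have "map (count (monomial_at (i # is) (a # \<alpha>))) is = map (count (monomial_at is \<alpha>)) is"
    using Cons.prems by (intro map_cong) auto
  moreover have "count (monomial_at is \<alpha>) i = 0" using calculation(1) Cons by simp
  ultimately show ?case using Cons by (simp only: list.map) simp
qed simp

lemma index_seqs_sorted: "is \<in> index_seqs k \<Longrightarrow> sorted_list_of_set (set is) = is"
  by (auto simp: index_seqs_def strict_sorted_iff intro: sorted_list_of_set.idem_if_sorted_distinct)

lemma mults_monomial_at:
  assumes "composition \<alpha>" "is \<in> index_seqs (length \<alpha>)"
  shows "mults (monomial_at is \<alpha>) = \<alpha>" "0 \<notin># monomial_at is \<alpha>"
proof -
  have l: "length is = length \<alpha>" "distinct is" "0 \<notin> set is"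
    using assms(2) by (auto simp: index_seqs_def strict_sorted_iff)
  show "mults (monomial_at is \<alpha>) = \<alpha>"
    by (simp add: mults_def set_monomial_at l assms index_seqs_sorted[OF assms(2)] count_monomial_at)
  show "0 \<notin># monomial_at is \<alpha>"
    by (simp add: set_monomial_at l assms)
qed

lemma monomial_at_mults:
  assumes "0 \<notin># m"
  defines "is \<equiv> sorted_list_of_set (set_mset m)"
  shows "is \<in> index_seqs (length (mults m))" "monomial_at is (mults m) = m"
proof -
  have "count (monomial_at js (map f js)) j = (if j \<in> set js then f j else 0)"
    if "distinct js" for js and f :: "nat \<Rightarrow> nat" and j
    using that by (induction js) auto
  then show "monomial_at is (mults m) = m"
    by (intro multiset_eqI) (simp add: mults_def is_def not_in_iff)
  show "is \<in> index_seqs (length (mults m))"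
    using assms(1) by (simp add: index_seqs_def is_def mults_def)
qed

text \<open>
  The only increasing index sequence that can produce \<open>m\<close> is its support.
\<close>

lemma monomial_qsym_eq:
  assumes "composition \<alpha>"
  shows "monomial_qsym \<alpha> m = of_bool (0 \<notin># m \<and> mults m = \<alpha>)"
proof (cases "0 \<notin># m \<and> mults m = \<alpha>")
  case True
  have "{is \<in> index_seqs (length \<alpha>). monomial_at is \<alpha> = m} = {sorted_list_of_set (set_mset m)}"
  proof (intro equalityI subsetI)
    fix js assume js: "js \<in> {is \<in> index_seqs (length \<alpha>). monomial_at is \<alpha> = m}"
    then have "set_mset m = set js"
      using set_monomial_at[OF _ assms, of js] by (auto simp: index_seqs_def)
    with js show "js \<in> {sorted_list_of_set (set_mset m)}"
      using index_seqs_sorted by auto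
  qed (use True monomial_at_mults[of m] in auto)
  then show ?thesis using True by (simp add: monomial_qsym_def)
next
  case False
  then have "{is \<in> index_seqs (length \<alpha>). monomial_at is \<alpha> = m} = {}"
    using mults_monomial_at[OF assms] by auto
  with False show ?thesis by (simp only: monomial_qsym_def card.empty of_nat_0 of_bool_def if_False)
qed

lemma length_composition_le: "composition \<alpha> \<Longrightarrow> length \<alpha> \<le> sum_list \<alpha>"
  by (induction \<alpha>) (auto simp: composition_def)

lemma finite_compositions: "finite {\<alpha>. composition \<alpha> \<and> sum_list \<alpha> \<le> d}"
proof (rule finite_subset)
  show "{\<alpha>. composition \<alpha> \<and> sum_list \<alpha> \<le> d} \<subseteq> {\<alpha>. set \<alpha> \<subseteq> {..d} \<and> length \<alpha> \<le> d}"
    using length_composition_le member_le_sum_list by (fastforce intro: order_trans)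
qed (rule finite_lists_length_le, simp)

lemma first_index_seq: "[1..<Suc k] \<in> index_seqs k"
  using sorted_wrt_upt by (simp add: index_seqs_def del: upt_Suc)

text \<open>
  For given \<open>m\<close> and \<open>n\<close> only one pair of monomial quasisymmetric functions does not vanish, that
  of their exponent sequences. So the coproduct amounts to placing the variables of \<open>n\<close> after
  those of \<open>m\<close>.
\<close>

lemma coproduct_eq:
  assumes "bounded_degree f"
  shows "coproduct f m n =
    (if 0 \<notin># m \<and> 0 \<notin># n then monomial_coeff f (mults m @ mults n) else 0)"
proof -
  let ?A = "{\<alpha>. composition \<alpha> \<and> monomial_coeff f \<alpha> \<noteq> 0}"
  let ?\<alpha> = "mults m @ mults n"
  let ?ok = "0 \<notin># m \<and> 0 \<notin># n"
  obtain d where d: "\<And>m. f m \<noteq> 0 \<Longrightarrow> size m \<le> d"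
    using assms by (auto simp: bounded_degree_def)
  have "sum_list \<alpha> \<le> d" if "\<alpha> \<in> ?A" for \<alpha>
    using that d[of "monomial_at [1..<Suc (length \<alpha>)] \<alpha>"] mults_monomial_at(1)[of \<alpha>, OF _ first_index_seq]
      sum_list_mults[of "monomial_at [1..<Suc (length \<alpha>)] \<alpha>"]
    by (simp add: monomial_coeff_def del: upt_Suc)
  then have "finite ?A"
    by (intro finite_subset[OF _ finite_compositions[of d]]) auto
  have inner: "(\<Sum>(\<beta>, \<delta>) | \<beta> @ \<delta> = \<alpha>. tensor (monomial_qsym \<beta>) (monomial_qsym \<delta>) m n) =
      of_bool (?ok \<and> ?\<alpha> = \<alpha>)" if "\<alpha> \<in> ?A" for \<alpha>
  proof -
    let ?S = "{(\<beta>, \<delta>). \<beta> @ \<delta> = \<alpha>}"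
    have "?S \<subseteq> (\<lambda>i. (take i \<alpha>, drop i \<alpha>)) ` {..length \<alpha>}"
    proof
      fix p assume "p \<in> ?S"
      then obtain \<beta> \<delta> where "p = (\<beta>, \<delta>)" "\<beta> @ \<delta> = \<alpha>" by blast
      then show "p \<in> (\<lambda>i. (take i \<alpha>, drop i \<alpha>)) ` {..length \<alpha>}"
        by (intro image_eqI[of _ _ "length \<beta>"]) auto
    qed
    then have fin: "finite ?S" by (rule finite_subset) simp
    have "(\<Sum>(\<beta>, \<delta>)\<in>?S. tensor (monomial_qsym \<beta>) (monomial_qsym \<delta>) m n) =
        (\<Sum>p\<in>?S. if p = (mults m, mults n) then of_bool ?ok else 0)"
    proof (rule sum.cong[OF refl])
      fix p assume "p \<in> ?S"
      then obtain \<beta> \<delta> where p: "p = (\<beta>, \<delta>)" "\<beta> @ \<delta> = \<alpha>" by blast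
      with that have "composition \<beta>" "composition \<delta>" by (auto simp: composition_def)
      then show "(case p of (\<beta>, \<delta>) \<Rightarrow> tensor (monomial_qsym \<beta>) (monomial_qsym \<delta>) m n) =
         (if p = (mults m, mults n) then of_bool ?ok else 0)"
        by (auto simp: p tensor_def monomial_qsym_eq)
    qed
    also have "\<dots> = of_bool (?ok \<and> ?\<alpha> = \<alpha>)"
      using fin by (simp add: sum.delta)
    finally show ?thesis .
  qed
  have "coproduct f m n = (\<Sum>\<alpha>\<in>?A. if \<alpha> = ?\<alpha> then monomial_coeff f \<alpha> * of_bool ?ok else 0)"
    unfolding coproduct_def by (rule sum.cong[OF refl]) (simp add: inner)
  also have "\<dots> = (if ?ok then monomial_coeff f ?\<alpha> else 0)"
    using \<open>finite ?A\<close> composition_mults[of m] composition_mults[of n]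
    by (auto simp: sum.delta composition_def)
  finally show ?thesis .
qed

lemma bounded_degree_qschur: "bounded_degree (qschur x)"
proof -
  have "size m \<le> sum_list x" if "qschur x m \<noteq> 0" for m
  proof -
    from that have "{T \<in> SSCT x. tableau_content x T = m} \<noteq> {}"
      unfolding qschur_def by (metis card.empty of_nat_0)
    then show ?thesis using content_size by auto
  qed
  then show ?thesis using qschur_0 by (auto simp: bounded_degree_def)
qed

lemma monomial_coeff_qschur:
  assumes "composition \<alpha>"
  shows "monomial_coeff (qschur x) \<alpha> = of_nat (chain_count (replicate (length x) 0) \<alpha> x)"
  using qschur_eq[OF mults_monomial_at(2)[OF assms first_index_seq], of x]
  by (simp add: monomial_coeff_def mults_monomial_at(1)[OF assms first_index_seq] del: upt_Suc One_nat_def)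

section \<open>Independence of the quasisymmetric Schur functions\<close>

text \<open>
  Each strip opens at most one new row, so the topmost rows stay empty in a short chain.
\<close>

lemma chain_count_rows:
  "chain_count (replicate n 0) ks z \<noteq> 0 \<Longrightarrow> zeros_first z \<Longrightarrow> i < n - length ks \<Longrightarrow> z ! i = 0"
proof (induction ks arbitrary: z i)
  case (Cons k ks)
  then obtain w where w: "strip w z" "chain_count (replicate n 0) ks w \<noteq> 0"
    by (auto simp: finite_strip)
  have len: "length z = n"
    using chain_count_below[OF w(2)] strip_length[OF w(1)] by (auto dest: list_all2_lengthD)
  have "w ! Suc i = 0"
    using Cons.IH[OF w(2) strip_zeros_first[OF w(1)]] Cons.prems by simp
  moreover have "Suc i < length z" using Cons.prems(3) len by simp
  ultimately have "\<not> (0 < z ! i \<and> 0 < z ! Suc i)"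
    using w(1) unfolding strip_def by (metis lessI less_irrefl)
  moreover have "0 < z ! i \<longrightarrow> 0 < z ! Suc i"
    using Cons.prems(2)[unfolded zeros_first_def, rule_format, of i "Suc i"] Cons.prems(3) len by auto
  ultimately show ?case by (meson gr0I)
qed (auto split: if_splits)

lemma sum_list_take_mono: "j \<le> k \<Longrightarrow> sum_list (take j xs) \<le> sum_list (take k (xs :: nat list))"
  by (metis le_add1 le_iff_add sum_list_append take_add)

text \<open>
  The last \<open>j\<close> parts of \<open>\<alpha>\<close> are the sizes of the first \<open>j\<close> strips. These open at most \<open>j\<close> rows, so
  all their cells lie in the last \<open>j\<close> rows of \<open>x\<close>.
\<close>

lemma chain_count_tail_sums:
  assumes c: "chain_count (replicate (length x) 0) \<alpha> x \<noteq> 0" and z: "zeros_first x"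
  shows "sum_list (take j (rev \<alpha>)) \<le> sum_list (take j (rev x))"
proof -
  \<comment> \<open>for \<open>j\<close> beyond the length of \<open>\<alpha>\<close> truncated subtraction makes the tail all of \<open>\<alpha>\<close>\<close>
  define a where "a = length \<alpha> - j"
  let ?\<alpha> = "drop a \<alpha>" and ?n = "length x"
  have "chain_count (replicate ?n 0) (take a \<alpha> @ ?\<alpha>) x \<noteq> 0" using c by simp
  then obtain z where z: "z \<in> below x" "chain_count z (take a \<alpha>) x \<noteq> 0"
      "chain_count (replicate ?n 0) ?\<alpha> z \<noteq> 0"
    unfolding chain_count_append using finite_below by (auto simp: sum_eq_0_iff)
  have len: "length z = ?n" using z(1) by (auto dest: list_all2_lengthD)
  have zf: "zeros_first z" using z(2) assms(2) chain_count_zeros_first by blast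
  let ?l = "length ?\<alpha>"
  have "sum_list (take j (rev \<alpha>)) = sum_list ?\<alpha>"
    by (simp add: take_rev a_def)
  also have "\<dots> = sum_list z" using chain_count_sum[OF z(3)] by (simp add: sum_list_replicate)
  also have "\<dots> = sum_list (take (?n - ?l) z) + sum_list (drop (?n - ?l) z)"
    by (metis append_take_drop_id sum_list_append)
  also have "sum_list (take (?n - ?l) z) = 0"
    using chain_count_rows[OF z(3) zf] by (auto simp: sum_list_eq_0_iff in_set_conv_nth)
  also have "0 + sum_list (drop (?n - ?l) z) \<le> sum_list (drop (?n - ?l) x)"
    using z(1) by (auto intro!: below_sum_le list_all2_dropI)
  also have "\<dots> = sum_list (take ?l (rev x))" by (simp add: take_rev)
  also have "\<dots> \<le> sum_list (take j (rev x))"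
    by (rule sum_list_take_mono) (simp add: a_def)
  finally show ?thesis .
qed

lemma partial_sums_inject:
  "composition a \<Longrightarrow> composition b \<Longrightarrow> (\<And>j. sum_list (take j a) = sum_list (take j b)) \<Longrightarrow> a = b"
proof (induction a arbitrary: b)
  case Nil
  then show ?case using Nil.prems(3)[of 1] by (cases b) (auto simp: composition_def)
next
  case (Cons x a)
  then obtain y b' where b: "b = y # b'"
    using Cons.prems(3)[of 1] by (cases b) (auto simp: composition_def)
  have xy: "x = y" using Cons.prems(3)[of 1] b by simp
  have "sum_list (take j a) = sum_list (take j b')" for j
    using Cons.prems(3)[of "Suc j"] b xy by simp
  with Cons b have "a = b'" by (auto simp: composition_def)
  with b xy show ?case by simp
qed

text \<open>
  The chain that adds the rows of \<open>\<beta>\<close> one at a time from the bottom.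
\<close>

lemma chain_count_diagonal:
  "composition \<beta> \<Longrightarrow> chain_count (replicate (length \<beta>) 0) \<beta> \<beta> \<noteq> 0"
proof (induction \<beta>)
  case (Cons b \<beta>)
  have "0 < \<beta> ! i" if "i < length \<beta>" for i
    using Cons.prems that by (auto simp: composition_def)
  then have "strip (0 # \<beta>) (b # \<beta>)"
    unfolding strip_def by (auto simp: nth_Cons' intro: list.rel_refl)
  moreover have "chain_count (replicate (length (b # \<beta>)) 0) \<beta> (0 # \<beta>) \<noteq> 0"
    using Cons chain_count_Cons0 by (simp add: composition_def)
  ultimately show ?case
    using finite_strip by (auto simp: sum_eq_0_iff)
qed simp

text \<open>
  By \<open>chain_count_tail_sums\<close> the monomial \<open>b\<close> occurs only in those \<open>qschur \<beta>\<close> for which \<open>\<beta>\<close>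
  dominates \<open>b\<close> from the end, and it occurs in \<open>qschur b\<close>. So for a maximal \<open>b\<close> with nonzero
  coefficient no other term can cancel it. The sum \<open>h\<close> of all tail sums serves as a strictly
  monotone measure for this order.
\<close>

lemma qschur_independent:
  assumes fin: "finite B" and comp: "\<And>\<beta>. \<beta> \<in> B \<Longrightarrow> composition \<beta>"
    and eq: "\<And>n. (\<Sum>\<beta>\<in>B. g \<beta> * qschur \<beta> n) = 0"
  shows "\<forall>\<beta>\<in>B. g \<beta> = 0"
proof (rule ccontr)
  define S where "S = {\<beta> \<in> B. g \<beta> \<noteq> 0}"
  \<comment> \<open>any bound on the lengths in \<open>B\<close> serves\<close>
  define J where "J = (\<Sum>\<beta>\<in>B. length \<beta>)"
  define h where "h \<beta> = (\<Sum>j\<le>J. sum_list (take j (rev \<beta>)))" for \<beta> :: "nat list"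
  assume "\<not> ?thesis"
  then have "S \<noteq> {}" "finite S" using fin by (auto simp: S_def)
  then obtain b where b: "b \<in> S" "\<And>\<beta>. \<beta> \<in> S \<Longrightarrow> h \<beta> \<le> h b"
    using obtains_MAX[of S h] by (metis Max_ge finite_imageI imageI)
  have bc: "composition b" using b(1) comp by (auto simp: S_def)
  let ?n = "monomial_at [1..<Suc (length b)] b"
  have q: "qschur \<beta> ?n = of_nat (chain_count (replicate (length \<beta>) 0) b \<beta>)" for \<beta>
    using monomial_coeff_qschur[OF bc, of \<beta>] by (simp only: monomial_coeff_def)
  have other: "qschur \<beta> ?n = 0" if \<beta>: "\<beta> \<in> S" "\<beta> \<noteq> b" for \<beta>
  proof (rule ccontr)
    assume "qschur \<beta> ?n \<noteq> 0"
    then have c: "chain_count (replicate (length \<beta>) 0) b \<beta> \<noteq> 0" by (simp only: q of_nat_eq_0_iff not_False_eq_True)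
    have \<beta>c: "composition \<beta>" using \<beta>(1) comp by (auto simp: S_def)
    have le: "sum_list (take j (rev b)) \<le> sum_list (take j (rev \<beta>))" for j
      using chain_count_tail_sums[OF c] zeros_first_pad[OF \<beta>c, of 0] by (simp add: pad_def)
    have J: "length \<delta> \<le> J" if "\<delta> \<in> S" for \<delta>
      using that fin unfolding J_def S_def by (intro member_le_sum) auto
    have "sum_list (take j (rev b)) = sum_list (take j (rev \<beta>))" if "j \<le> J" for j
    proof (rule ccontr)
      assume "sum_list (take j (rev b)) \<noteq> sum_list (take j (rev \<beta>))"
      with le[of j] have "h b < h \<beta>"
        unfolding h_def using le that by (intro sum_strict_mono_ex1) (auto intro!: bexI[of _ j] simp: order.strict_iff_order)
      with b(2)[OF \<beta>(1)] show False by simp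
    qed
    moreover have "take j (rev \<delta>) = take (min j J) (rev \<delta>)" if "\<delta> \<in> S" for j \<delta>
      using J[OF that] by (simp add: min_def)
    ultimately have "sum_list (take j (rev b)) = sum_list (take j (rev \<beta>))" for j
      using b(1) \<beta>(1) by (metis min.cobounded2)
    then have "rev b = rev \<beta>"
      using bc \<beta>c by (intro partial_sums_inject) (auto simp: composition_def)
    with \<beta>(2) show False by simp
  qed
  have "0 = (\<Sum>\<beta>\<in>B. g \<beta> * qschur \<beta> ?n)" using eq by simp
  also have "\<dots> = (\<Sum>\<beta>\<in>{b}. g \<beta> * qschur \<beta> ?n)"
    using other b(1) by (intro sum.mono_neutral_right fin) (auto simp: S_def simp del: upt_Suc)
  also have "\<dots> \<noteq> 0"
    using b(1) chain_count_diagonal[OF bc] by (simp only: q) (simp add: S_def)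
  finally show False by simp
qed

section \<open>Skew quasisymmetric Schur functions count chains\<close>

text \<open>
  The candidate for the skew function: \<open>\<beta>\<close> is extended by empty rows on top until it has as many
  rows as \<open>\<gamma>\<close>.
\<close>

definition skew_series :: "nat list \<Rightarrow> nat list \<Rightarrow> series" where
  "skew_series \<gamma> \<beta> = (\<lambda>m. if composition \<beta> \<and> length \<beta> \<le> length \<gamma> \<and> 0 \<notin># m
     then of_nat (chain_count (pad (length \<gamma>) \<beta>) (mults m) \<gamma>) else 0)"

lemma skew_series_QSym: "skew_series \<gamma> \<beta> \<in> QSym"
proof -
  have "size m \<le> sum_list \<gamma>" if "skew_series \<gamma> \<beta> m \<noteq> 0" for m
  proof -
    have "chain_count (pad (length \<gamma>) \<beta>) (mults m) \<gamma> \<noteq> 0"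
      using that by (auto simp: skew_series_def split: if_splits)
    then show ?thesis
      using chain_count_sum sum_list_mults[of m] by fastforce
  qed
  then have "bounded_degree (skew_series \<gamma> \<beta>)"
    by (auto simp: bounded_degree_def) (simp add: skew_series_def)
  then show ?thesis
    by (auto simp: QSym_def skew_series_def mults_monomial_at)
qed

lemma skew_series_nonzero:
  assumes "skew_series \<gamma> \<beta> \<noteq> (\<lambda>_. 0)"
  shows "composition \<beta>" "length \<beta> \<le> length \<gamma>" "pad (length \<gamma>) \<beta> \<in> below \<gamma>"
proof -
  obtain m where "skew_series \<gamma> \<beta> m \<noteq> 0" using assms by auto
  then have "composition \<beta> \<and> length \<beta> \<le> length \<gamma> \<and> chain_count (pad (length \<gamma>) \<beta>) (mults m) \<gamma> \<noteq> 0"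
    by (auto simp: skew_series_def split: if_splits)
  then show "composition \<beta>" "length \<beta> \<le> length \<gamma>" "pad (length \<gamma>) \<beta> \<in> below \<gamma>"
    using chain_count_below by blast+
qed

text \<open>
  Cutting a chain from the empty shape to \<open>\<gamma>\<close> at an intermediate shape factors its count; the
  intermediate shapes are the compositions with empty rows on top.
\<close>

lemma skew_family_skew_series:
  assumes \<gamma>: "composition \<gamma>"
  shows "skew_family \<gamma> (skew_series \<gamma>)"
proof -
  let ?n = "length \<gamma>" and ?F = "skew_series \<gamma>"
  let ?B = "{\<beta>. ?F \<beta> \<noteq> (\<lambda>_. 0)}"
  let ?B' = "{\<beta>. composition \<beta> \<and> length \<beta> \<le> ?n \<and> pad ?n \<beta> \<in> below \<gamma>}"
  have sub: "?B \<subseteq> ?B'" using skew_series_nonzero by blast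
  have finB': "finite ?B'"
  proof (rule finite_subset)
    show "?B' \<subseteq> {\<alpha>. composition \<alpha> \<and> sum_list \<alpha> \<le> sum_list \<gamma>}"
    proof
      fix \<beta> assume b: "\<beta> \<in> ?B'"
      then have "sum_list (pad ?n \<beta>) \<le> sum_list \<gamma>" using below_sum_le by blast
      with b show "\<beta> \<in> {\<alpha>. composition \<alpha> \<and> sum_list \<alpha> \<le> sum_list \<gamma>}"
        by (simp add: pad_def sum_list_replicate)
    qed
  qed (rule finite_compositions)
  have eq: "coproduct (qschur \<gamma>) m n = (\<Sum>\<beta>\<in>?B. tensor (?F \<beta>) (qschur \<beta>) m n)" for m n
  proof (cases "0 \<notin># m \<and> 0 \<notin># n")
    case True
    have zf: "zeros_first \<gamma>" using zeros_first_pad[OF \<gamma>, of 0] by (simp add: pad_def)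
    let ?Z = "pad ?n ` ?B'"
    have inj: "inj_on (pad ?n) ?B'"
      by (rule inj_onI) (use pad_inject in blast)
    have comp: "composition (mults m @ mults n)"
      using composition_mults by (auto simp: composition_def)
    have "coproduct (qschur \<gamma>) m n = of_nat (chain_count (replicate ?n 0) (mults m @ mults n) \<gamma>)"
      by (simp add: coproduct_eq bounded_degree_qschur True monomial_coeff_qschur comp)
    also have "chain_count (replicate ?n 0) (mults m @ mults n) \<gamma> =
       (\<Sum>z\<in>below \<gamma>. chain_count z (mults m) \<gamma> * chain_count (replicate ?n 0) (mults n) z)"
      by (rule chain_count_append)
    also have "\<dots> = (\<Sum>z\<in>?Z. chain_count z (mults m) \<gamma> * chain_count (replicate ?n 0) (mults n) z)"
    proof (rule sum.mono_neutral_right)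
      show "\<forall>z\<in>below \<gamma> - ?Z. chain_count z (mults m) \<gamma> * chain_count (replicate ?n 0) (mults n) z = 0"
      proof
        fix z assume z: "z \<in> below \<gamma> - ?Z"
        then have len: "length z = ?n" by (auto dest: list_all2_lengthD)
        have "chain_count z (mults m) \<gamma> = 0"
        proof (rule ccontr)
          assume "chain_count z (mults m) \<gamma> \<noteq> 0"
          then have "zeros_first z" using zf chain_count_zeros_first by blast
          from zeros_first_imp_pad[OF this] z len show False by auto
        qed
        then show "chain_count z (mults m) \<gamma> * chain_count (replicate ?n 0) (mults n) z = 0" by simp
      qed
    qed (auto simp: finite_below)
    also have "\<dots> = (\<Sum>\<beta>\<in>?B'. chain_count (pad ?n \<beta>) (mults m) \<gamma> * chain_count (replicate ?n 0) (mults n) (pad ?n \<beta>))"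
      by (subst sum.reindex[OF inj]) (simp only: comp_def)
    also have "rat_of_nat \<dots> = (\<Sum>\<beta>\<in>?B'. tensor (?F \<beta>) (qschur \<beta>) m n)"
      unfolding of_nat_sum
    proof (rule sum.cong[OF refl])
      fix \<beta> assume b: "\<beta> \<in> ?B'"
      have "replicate ?n 0 = replicate (?n - length \<beta>) (0::nat) @ replicate (length \<beta>) 0"
        using b by (simp flip: replicate_add)
      then have "chain_count (replicate ?n 0) (mults n) (pad ?n \<beta>) = chain_count (replicate (length \<beta>) 0) (mults n) \<beta>"
        using chain_count_replicate0 by (simp only: pad_def)
      with b True show "rat_of_nat (chain_count (pad ?n \<beta>) (mults m) \<gamma> * chain_count (replicate ?n 0) (mults n) (pad ?n \<beta>)) =
          tensor (?F \<beta>) (qschur \<beta>) m n"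
        by (simp add: tensor_def skew_series_def qschur_eq)
    qed
    also have "\<dots> = (\<Sum>\<beta>\<in>?B. tensor (?F \<beta>) (qschur \<beta>) m n)"
      by (rule sum.mono_neutral_right[OF finB' sub]) (auto simp: tensor_def)
    finally show ?thesis .
  next
    case False
    then have "tensor (?F \<beta>) (qschur \<beta>) m n = 0" for \<beta>
      by (auto simp: tensor_def skew_series_def qschur_0)
    with False show ?thesis by (auto simp: coproduct_eq bounded_degree_qschur)
  qed
  show ?thesis
    unfolding skew_family_def
  proof (intro conjI allI impI)
    show "finite ?B" using finite_subset[OF sub finB'] .
    show "coproduct (qschur \<gamma>) = (\<lambda>m n. \<Sum>\<beta>\<in>?B. tensor (?F \<beta>) (qschur \<beta>) m n)"
      using eq by blast
  qed (simp add: skew_series_QSym, simp add: skew_series_def)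
qed

lemma skew_family_unique:
  assumes F: "skew_family \<gamma> F" and G: "skew_family \<gamma> G"
  shows "F = G"
proof (intro ext)
  fix \<beta> m
  let ?supp = "\<lambda>F. {\<beta>. F \<beta> \<noteq> (\<lambda>_. 0 :: rat)}"
  let ?B = "?supp F \<union> ?supp G"
  have fin: "finite ?B" using F G by (auto simp: skew_family_def)
  have ext: "(\<Sum>\<beta>\<in>?supp H. tensor (H \<beta>) (qschur \<beta>) m n) = (\<Sum>\<beta>\<in>?B. H \<beta> m * qschur \<beta> n)"
    if "H = F \<or> H = G" for H n
    unfolding tensor_def by (rule sum.mono_neutral_left) (use fin that in auto)
  have "(\<Sum>\<beta>\<in>?B. F \<beta> m * qschur \<beta> n) = (\<Sum>\<beta>\<in>?B. G \<beta> m * qschur \<beta> n)" for n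
    using F G ext[of F n] ext[of G n] unfolding skew_family_def by metis
  then have "(\<Sum>\<beta>\<in>?B. (F \<beta> m - G \<beta> m) * qschur \<beta> n) = 0" for n
    by (simp add: left_diff_distrib sum_subtractf)
  moreover have "composition \<beta>" if "\<beta> \<in> ?B" for \<beta>
    using that F G unfolding skew_family_def by blast
  ultimately have "\<forall>\<beta>\<in>?B. F \<beta> m - G \<beta> m = 0"
    by (intro qschur_independent fin)
  then show "F \<beta> m = G \<beta> m" by (cases "\<beta> \<in> ?B") auto
qed

lemma skew_qschur_eq:
  assumes "composition \<gamma>"
  shows "skew_qschur \<gamma> = skew_series \<gamma>"
  unfolding skew_qschur_def
  using skew_family_skew_series[OF assms] skew_family_unique by (intro the_equality) blast+

section \<open>Column operators and the exchange rule\<close>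

text \<open>
  A constant of its own, so that the simplifier does not rewrite minima of sums of multisets.
\<close>

definition least :: "nat multiset \<Rightarrow> nat" where
  "least A = Min (set_mset A)"

lemma least_in: "A \<noteq> {#} \<Longrightarrow> least A \<in># A"
  unfolding least_def by (rule Min_in) auto

lemma least_le: "a \<in># A \<Longrightarrow> least A \<le> a"
  unfolding least_def by simp

lemma least_eqI: "a \<in># A \<Longrightarrow> (\<And>b. b \<in># A \<Longrightarrow> a \<le> b) \<Longrightarrow> least A = a"
  unfolding least_def by (rule Min_eqI) auto

text \<open>
  A shape is represented by its levels: the list whose entry \<open>c\<close> is the multiset of the rows of
  length \<open>c\<close>. A set of columns is a list of booleans, whose entry \<open>c\<close> tells whether a cell is
  added in column \<open>c + 1\<close>. The operator moves up the levels and carries along, in \<open>E\<close>, the row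
  that has just been lengthened (at most one). This row joins the next level and may be lengthened
  again there. The operator is undefined where there is no row to lengthen.
\<close>

fun col_op :: "nat multiset \<Rightarrow> bool list \<Rightarrow> nat multiset list \<Rightarrow> nat multiset list option" where
  "col_op E [] [] = None"
| "col_op E [] (S # Ss) = Some ((S + E) # Ss)"
| "col_op E (c # cs) [] = None"
| "col_op E (c # cs) (S # Ss) =
    (let A = S + E; D = (if c then {#least A#} else {#})
     in if c \<and> A = {#} then None else map_option ((#) (A - D)) (col_op D cs Ss))"

text \<open>
  One column of the exchange of two column sets \<open>C\<close> and \<open>p\<close>, read as a queue in which \<open>C\<close> gives
  the arrivals and \<open>p\<close> the offered services. The first component is the length of the queue; the
  second result tells whether a service is used, the third collects the arrivals and the services
  not used. Up to the direction of time this step is its own inverse.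
\<close>

definition bump1 :: "nat \<Rightarrow> bool \<Rightarrow> bool \<Rightarrow> nat \<times> bool \<times> bool" where
  "bump1 z c p = (let w = z + of_bool c; hit = (p \<and> 0 < w)
     in (w - of_bool hit, hit, c \<or> p \<and> \<not> hit))"

text \<open>
  Bumping a whole set \<open>C\<close> into a column \<open>p\<close>. In the result \<open>(w, C', p')\<close>, the set \<open>C'\<close> of used
  services consists of the elements bumped out by \<open>C\<close>, and \<open>p'\<close> is the new column.
\<close>

fun bump :: "nat \<Rightarrow> bool list \<Rightarrow> bool list \<Rightarrow> nat \<times> bool list \<times> bool list" where
  "bump z (c # C) (p # P) =
    (let (z', c', p') = bump1 z c p; (w, C', P') = bump z' C P in (w, c' # C', p' # P'))"
| "bump z _ _ = (z, [], [])"

text \<open>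
  Two operators can be followed simultaneously, one level at a time, because each of them carries
  only the row it has lengthened last.
\<close>

lemma col_op_twice_Cons:
  "Option.bind (col_op E1 (p # ps) (S # Ss)) (col_op E2 (c # cs)) =
    (let A = S + E1; D1 = (if p then {#least A#} else {#});
         B = A - D1 + E2; D2 = (if c then {#least B#} else {#})
     in if p \<and> A = {#} \<or> c \<and> B = {#} then None
        else map_option ((#) (B - D2)) (Option.bind (col_op D1 ps Ss) (col_op D2 cs)))"
proof -
  have *: "Option.bind (map_option ((#) X) r) f = Option.bind r (\<lambda>Xs. f (X # Xs))" for X r and f :: "_ \<Rightarrow> 'b option"
    by (cases r) auto
  have **: "Option.bind r (\<lambda>Xs. map_option g (h Xs)) = map_option g (Option.bind r h)" for r h and g :: "_ \<Rightarrow> 'b"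
    by (cases r) auto
  have ***: "Option.bind r (\<lambda>Xs. None) = None" for r :: "'c option"
    by (cases r) auto
  show ?thesis
    by (cases c; cases p; cases "E2 = {#} \<and> S + E1 - (if p then {#least (S + E1)#} else {#}) = {#}")
      (auto simp: Let_def * ** ***)
qed

text \<open>
  If \<open>e\<close> is smaller than all elements of \<open>X\<close>, it is taken second instead of first; otherwise its
  late arrival does not affect the first choice.
\<close>

lemma two_smallest:
  fixes X :: "nat multiset" and e :: nat
  assumes "X \<noteq> {#}"
  defines "g1 \<equiv> least (X + {#e#})"
  defines "g2 \<equiv> least (X + {#e#} - {#g1#})"
  defines "h1 \<equiv> least X"
  defines "h2 \<equiv> least (X - {#h1#} + {#e#})"
  shows "X - {#h1#} + {#e#} - {#h2#} = X + {#e#} - {#g1#} - {#g2#}"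
    "(h1 = g1 \<and> h2 = g2) \<or> (h1 = g2 \<and> h2 = g1)" "h1 \<le> e \<Longrightarrow> h1 = g1 \<and> h2 = g2"
    "g1 \<le> g2"
proof -
  have h1: "h1 \<in># X" "\<And>b. b \<in># X \<Longrightarrow> h1 \<le> b"
    unfolding h1_def using assms(1) least_in least_le by auto
  then obtain Y where Y: "X = add_mset h1 Y" by (meson multi_member_split)
  have le: "h1 \<le> b" if "b \<in># Y" for b using h1(2) that Y by simp
  have "(X - {#h1#} + {#e#} - {#h2#} = X + {#e#} - {#g1#} - {#g2#}) \<and>
    ((h1 = g1 \<and> h2 = g2) \<or> (h1 = g2 \<and> h2 = g1)) \<and> (h1 \<le> e \<longrightarrow> h1 = g1 \<and> h2 = g2) \<and> g1 \<le> g2"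
  proof (cases "h1 \<le> e")
    case True
    then have g1: "g1 = h1"
      unfolding g1_def using le by (intro least_eqI) (auto simp: Y)
    have g2: "g2 = h2" by (simp add: g2_def h2_def g1 Y)
    have "h2 \<in># Y + {#e#}" using least_in[of "Y + {#e#}"] by (simp add: h2_def Y)
    then have "h1 \<le> h2" using le True by auto
    with g1 g2 show ?thesis by (simp add: Y)
  next
    case False
    then have g1: "g1 = e"
      unfolding g1_def by (intro least_eqI) (auto simp: Y dest: le)
    then have g2: "g2 = h1" by (simp add: g2_def h1_def)
    have h2: "h2 = e"
      unfolding h2_def using False by (intro least_eqI) (auto simp: Y dest: le)
    from g1 g2 h2 False show ?thesis by (simp add: Y)
  qed
  then show "X - {#h1#} + {#e#} - {#h2#} = X + {#e#} - {#g1#} - {#g2#}"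
    "(h1 = g1 \<and> h2 = g2) \<or> (h1 = g2 \<and> h2 = g1)" "h1 \<le> e \<Longrightarrow> h1 = g1 \<and> h2 = g2" "g1 \<le> g2"
    by blast+
qed

text \<open>
  The relation between the rows carried by the two operators before (\<open>E1\<close>, \<open>E2\<close>) and after (\<open>F1\<close>,
  \<open>F2\<close>) the exchange. The two computations can differ only while the queue is empty, and then only
  in the order of the two carried rows. If the queue is empty and the second operator has just
  acted, then so has the first, which had the first choice; hence \<open>e1 \<le> e2\<close>.
\<close>

definition queue_inv ::
  "nat \<Rightarrow> nat multiset \<Rightarrow> nat multiset \<Rightarrow> nat multiset \<Rightarrow> nat multiset \<Rightarrow> bool" where
  "queue_inv z E1 E2 F1 F2 \<longleftrightarrow>
    (if 0 < z then F1 = E1 \<and> F2 = E2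
     else (F1 = E1 \<and> F2 = E2 \<or> F1 = E2 \<and> F2 = E1) \<and>
       (E1 = {#} \<and> E2 = {#} \<or> (\<exists>e. E1 = {#e#} \<and> E2 = {#}) \<or>
        (\<exists>e1 e2. E1 = {#e1#} \<and> E2 = {#e2#} \<and> e1 \<le> e2)))"

text \<open>
  While the queue is not empty, both computations do the same. Otherwise the exchange has an
  effect only if \<open>p\<close> lengthens a row and \<open>C\<close> does not: it then delays this step to the second
  operator. By then another carried row \<open>E2\<close> may have joined the level, but it lies below the row
  \<open>E1\<close>, which was there already, and so the same row is chosen. If both lengthen a row,
  \<open>two_smallest\<close> applies.
\<close>

lemma bump1_step:
  fixes S E1 E2 F1 F2 :: "nat multiset" and c p :: bool
  assumes inv: "queue_inv z E1 E2 F1 F2" and b: "bump1 z c p = (z', c', p')"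
  defines "A \<equiv> S + E1" and "A' \<equiv> S + F1"
  defines "D1 \<equiv> if p then {#least A#} else {#}" and "D1' \<equiv> if c' then {#least A'#} else {#}"
  defines "B \<equiv> A - D1 + E2" and "B' \<equiv> A' - D1' + F2"
  defines "D2 \<equiv> if c then {#least B#} else {#}" and "D2' \<equiv> if p' then {#least B'#} else {#}"
  shows "(p \<and> A = {#} \<or> c \<and> B = {#}) = (c' \<and> A' = {#} \<or> p' \<and> B' = {#}) \<and>
    (\<not> (p \<and> A = {#} \<or> c \<and> B = {#}) \<longrightarrow> B - D2 = B' - D2' \<and> queue_inv z' D1 D2 D1' D2')"
proof (cases "0 < z")
  case True
  then have eq: "F1 = E1" "F2 = E2" using inv by (auto simp: queue_inv_def)
  have l: "c' = p" "p' = c" "z' = z + of_bool c - of_bool p"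
    using b True by (auto simp: bump1_def Let_def)
  show ?thesis
    using True
    by (auto simp: eq l A_def A'_def D1_def D1'_def B_def B'_def D2_def D2'_def queue_inv_def)
next
  case False
  then have z: "z = 0" by simp
  have sum: "E1 + E2 = F1 + F2"
    using inv z by (auto simp: queue_inv_def)
  consider "\<not> c" "\<not> p" | "c" "\<not> p" | "\<not> c" "p" | "c" "p" by blast
  then show ?thesis
  proof cases
    case 1
    then have l: "\<not> c'" "\<not> p'" "z' = 0" using b z by (auto simp: bump1_def Let_def)
    show ?thesis
      using 1 l sum
      by (simp add: A_def A'_def D1_def D1'_def B_def B'_def D2_def D2'_def queue_inv_def ac_simps)
  next
    case 2
    then have l: "\<not> c'" "p'" "z' = 1" using b z by (auto simp: bump1_def Let_def)
    have "B = B'"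
      using 2 l sum by (simp add: A_def A'_def D1_def D1'_def B_def B'_def ac_simps)
    then show ?thesis
      using 2 l by (simp add: D1_def D1'_def D2_def D2'_def queue_inv_def)
  next
    case 3
    then have l: "\<not> c'" "p'" "z' = 0" using b z by (auto simp: bump1_def Let_def)
    \<comment> \<open>the only case in which the exchange has an effect: the second operator performs the step of the first\<close>
    have B': "B' = A + E2" using l sum by (simp add: B'_def A'_def D1'_def A_def ac_simps)
    have A0: "A = {#} \<longleftrightarrow> A + E2 = {#}"
      using inv z by (auto simp: queue_inv_def A_def)
    have m: "least (A + E2) = least A" if "A \<noteq> {#}"
    proof (rule least_eqI)
      have Min: "least A \<in># A" "\<And>b. b \<in># A \<Longrightarrow> least A \<le> b" using that least_in least_le by auto
      then show "least A \<in># A + E2" by simp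
      fix b assume "b \<in># A + E2"
      then consider "b \<in># A" | "b \<in># E2" by auto
      then show "least A \<le> b"
      proof cases
        case 2
        then obtain e1 where "E1 = {#e1#}" "e1 \<le> b" using inv z by (auto simp: queue_inv_def)
        with Min(2)[of e1] show ?thesis by (simp add: A_def)
      qed (rule Min)
    qed
    show ?thesis
    proof (cases "A = {#}")
      case True
      with 3 l A0 B' show ?thesis by simp
    next
      case False
      then have D2': "D2' = D1" using l B' m 3 by (simp add: D2'_def D1_def)
      have "D1 \<subseteq># A" using False 3 least_in by (simp add: D1_def)
      then have "B = B' - D1" by (simp add: B_def B' subset_mset.add_diff_assoc2)
      moreover have "D2 = {#}" "D1' = {#}" using 3 l by (simp_all add: D2_def D1'_def)
      moreover have "queue_inv 0 D1 {#} {#} D1" using 3 by (simp add: queue_inv_def D1_def)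
      moreover have "B' \<noteq> {#}" using False A0 B' by (simp only: not_False_eq_True)
      ultimately show ?thesis using D2' 3 l False by (simp only: diff_zero simp_thms)
    qed
  next
    case 4
    then have l: "c'" "p'" "z' = 0" using b z by (auto simp: bump1_def Let_def)
    have sw: "?thesis" if "F1 = E1" "F2 = E2" "A \<noteq> {#} \<Longrightarrow> B \<noteq> {#} \<Longrightarrow> least A \<le> least B"
      using 4 l that by (auto simp: A_def A'_def D1_def D1'_def B_def B'_def D2_def D2'_def queue_inv_def)
    have dup: "least X \<le> least (X - {#least X#})" if "X - {#least X#} \<noteq> {#}" for X :: "nat multiset"
    proof -
      have "least (X - {#least X#}) \<in># X - {#least X#}" using that by (rule least_in)
      then show ?thesis by (auto dest: in_diffD intro: least_le)
    qed
    consider (none) "E1 = {#}" "E2 = {#}" | (one) e where "E1 = {#e#}" "E2 = {#}"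
      | (two) e1 e2 where "E1 = {#e1#}" "E2 = {#e2#}" "e1 \<le> e2"
      using inv z by (auto simp: queue_inv_def)
    then show ?thesis
    proof cases
      case none
      have F: "F1 = E1" "F2 = E2" using inv z none by (auto simp: queue_inv_def)
      show ?thesis
        by (rule sw[OF F]) (use none dup 4 in \<open>simp add: B_def D1_def A_def\<close>)
    next
      case (one e)
      have le: "least A \<le> least B" if "A \<noteq> {#}" "B \<noteq> {#}"
        using one dup[of A] that 4 by (simp add: B_def D1_def)
      show ?thesis
      proof (cases "F1 = E1 \<and> F2 = E2")
        case True
        then show ?thesis by (intro sw le) auto
      next
        case False
        then have F: "F1 = {#}" "F2 = {#e#}" using inv z one by (auto simp: queue_inv_def)
        show ?thesis
        proof (cases "S = {#}")
          case True
          then show ?thesis using 4 l by (simp add: A_def A'_def B_def D1_def one F least_def)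
        next
          case S: False
          note t = two_smallest[OF S, of e]
          have ne: "add_mset e S - {#x#} \<noteq> {#}" for x
          proof
            assume "add_mset e S - {#x#} = {#}"
            then have "size (add_mset e S) - size {#x#} \<le> 0"
              using diff_size_le_size_Diff[of "add_mset e S" "{#x#}"] by simp
            with S show False by simp
          qed
          show ?thesis
            using 4 l S t(1,2,4) ne
            by (auto simp: A_def A'_def D1_def D1'_def B_def B'_def D2_def D2'_def queue_inv_def one F)
        qed
      qed
    next
      case (two e1 e2)
      have A: "A \<noteq> {#}" by (simp add: A_def two)
      have "least A \<le> e1" by (simp add: A_def two least_le)
      then have le: "least A \<le> e2" using two by simp
      note t = two_smallest[OF A, of e2]
      have B: "B = A - {#least A#} + {#e2#}" using 4 by (simp add: B_def D1_def two)
      show ?thesis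
      proof (cases "F1 = E1 \<and> F2 = E2")
        case True
        have "least A \<le> least B"
          using t(3)[OF le] t(4) unfolding B by linarith
        with True show ?thesis by (intro sw) auto
      next
        case False
        then have F: "F1 = {#e2#}" "F2 = {#e1#}" using inv z two by (auto simp: queue_inv_def)
        have A': "A' \<noteq> {#}" by (simp add: A'_def F)
        note t' = two_smallest[OF A', of e1]
        have B': "B' = A' - {#least A'#} + {#e1#}" using l by (simp add: B'_def D1'_def F)
        have AA: "A' + {#e1#} = A + {#e2#}" by (simp add: A_def A'_def two F)
        have 1: "B - D2 = B' - D2'"
          using 4 l t(1) t'(1) by (simp only: D2_def D2'_def B B' AA if_True)
        have g: "least A = least (A + {#e2#}) \<and> least B = least (A + {#e2#} - {#least (A + {#e2#})#})"
          unfolding B by (rule t(3)[OF le])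
        have h: "least A' = least A \<and> least B' = least B \<or> least A' = least B \<and> least B' = least A"
          using t'(2) g unfolding B'[symmetric] AA by metis
        have 2: "least A \<le> least B" using t(4) g by metis
        have 3: "B \<noteq> {#}" "B' \<noteq> {#}" by (simp_all add: B B')
        have "queue_inv z' D1 D2 D1' D2'"
          using h 2 4 l by (auto simp: queue_inv_def D1_def D2_def D1'_def D2'_def)
        with 1 3 A A' show ?thesis by simp
      qed
    qed
  qed
qed

text \<open>
  For \<open>z = 0\<close> and no rows carried this is the exchange rule for the operators of \<open>p\<close> and \<open>C\<close>, a
  form of the plactic relations; the invariant is for the induction along the levels.
\<close>

lemma col_op_bump:
  assumes "length C = length p" "bump z C p = (w, C', p')" "queue_inv z E1 E2 F1 F2"
  shows "Option.bind (col_op E1 p Ss) (col_op E2 C) = Option.bind (col_op F1 C' Ss) (col_op F2 p')"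
  using assms
proof (induction C p arbitrary: z w C' p' E1 E2 F1 F2 Ss rule: list_induct2)
  case Nil
  have "E1 + E2 = F1 + F2" using Nil.prems by (auto simp: queue_inv_def split: if_splits)
  then show ?case using Nil by (cases Ss) (auto simp: add.assoc)
next
  case step: (Cons c C p P)
  obtain z' c1 p1 where b1: "bump1 z c p = (z', c1, p1)" by (metis prod_cases3)
  obtain w' C1 P1 where b2: "bump z' C P = (w', C1, P1)" by (metis prod_cases3)
  have C': "C' = c1 # C1" "p' = p1 # P1" using step.prems(1) b1 b2 by auto
  show ?case
  proof (cases Ss)
    case (Cons S Ts)
    note st = bump1_step[OF step.prems(2) b1, of S]
    show ?thesis
      unfolding C' Cons col_op_twice_Cons Let_def
      using st step.IH[OF b2] by (smt (verit))
  qed (simp add: C')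
qed

section \<open>Column insertion\<close>

lemma bump1_involution: "bump1 z c p = (z', c', p') \<Longrightarrow> bump1 z' c' p' = (z, c, p)"
  by (cases c; cases p) (auto simp: bump1_def Let_def split: if_splits)

text \<open>
  The queue run backwards: it starts at the last column with the final length of the queue.
\<close>

fun unbump :: "nat \<Rightarrow> bool list \<Rightarrow> bool list \<Rightarrow> nat \<times> bool list \<times> bool list" where
  "unbump w (c' # C') (p' # P') =
    (let (z', C, P) = unbump w C' P'; (z, c, p) = bump1 z' c' p' in (z, c # C, p # P))"
| "unbump w _ _ = (w, [], [])"

lemma bump_Cons_E:
  assumes "bump z (c # C) (p # P) = (w, C', P')"
  obtains z1 c1 p1 C1 P1 where "bump1 z c p = (z1, c1, p1)" "bump z1 C P = (w, C1, P1)"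
    "C' = c1 # C1" "P' = p1 # P1"
  using assms by (auto split: prod.splits)

lemma unbump_Cons_E:
  assumes "unbump w (c' # C') (p' # P') = (z, C, P)"
  obtains z1 c1 p1 C1 P1 where "unbump w C' P' = (z1, C1, P1)" "bump1 z1 c' p' = (z, c1, p1)"
    "C = c1 # C1" "P = p1 # P1"
  using assms by (auto split: prod.splits)

lemma unbump_bump:
  "length C = length P \<Longrightarrow> bump z C P = (w, C', P') \<Longrightarrow> unbump w C' P' = (z, C, P)"
  by (induction C P arbitrary: z w C' P' rule: list_induct2)
    (fastforce split: prod.splits dest: bump1_involution)+

lemma bump_unbump:
  "length C' = length P' \<Longrightarrow> unbump w C' P' = (z, C, P) \<Longrightarrow> bump z C P = (w, C', P')"
  by (induction C' P' arbitrary: z w C P rule: list_induct2)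
    (fastforce split: prod.splits dest: bump1_involution)+

lemma bump_length:
  "length C = length P \<Longrightarrow> bump z C P = (w, C', P') \<Longrightarrow> length C' = length P \<and> length P' = length P"
  by (induction C P arbitrary: z w C' P' rule: list_induct2) (fastforce split: prod.splits)+

lemma unbump_length:
  "length C' = length P' \<Longrightarrow> unbump w C' P' = (z, C, P) \<Longrightarrow> length C = length P' \<and> length P = length P'"
  by (induction C' P' arbitrary: z w C P rule: list_induct2) (fastforce split: prod.splits)+

definition ones :: "bool list \<Rightarrow> nat" where
  "ones p = length (filter id p)"

lemma ones_simps [simp]: "ones [] = 0" "ones (b # p) = of_bool b + ones p"
  by (simp_all add: ones_def)

abbreviation subcol :: "bool list \<Rightarrow> bool list \<Rightarrow> bool" where
  "subcol \<equiv> list_all2 (\<longrightarrow>)"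

text \<open>
  In each initial segment of the columns, \<open>q\<close> has at most \<open>d\<close> elements more than \<open>p\<close>. For \<open>d = 0\<close>
  this says that \<open>p\<close> and \<open>q\<close> are adjacent columns of a semistandard tableau; the offset is for the
  recursion.
\<close>

fun dominates :: "nat \<Rightarrow> bool list \<Rightarrow> bool list \<Rightarrow> bool" where
  "dominates d [] [] = True"
| "dominates d (p # P) (q # Q) =
    (of_bool q \<le> d + of_bool p \<and> dominates (d + of_bool p - of_bool q) P Q)"
| "dominates d _ _ = False"

lemma bump1_facts:
  assumes "bump1 z c p = (z', c', p')"
  shows "of_bool p' + of_bool c' = of_bool p + (of_bool c :: nat)" "z + of_bool p' = z' + of_bool p"
    "z + of_bool c = z' + of_bool c'"
    "c \<longrightarrow> p'" "c' \<longrightarrow> p" "z' = z + of_bool c - of_bool p"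
  using assms by (auto simp: bump1_def Let_def split: if_splits)

lemma bump_ones:
  "length C = length P \<Longrightarrow> bump z C P = (w, C', P') \<Longrightarrow>
    ones P' + ones C' = ones P + ones C \<and> z + ones P' = w + ones P"
proof (induction C P arbitrary: z w C' P' rule: list_induct2)
  case (Cons c C p P)
  from Cons.prems obtain z1 c1 p1 C1 P1 where *: "bump1 z c p = (z1, c1, p1)" "bump z1 C P = (w, C1, P1)"
    "C' = c1 # C1" "P' = p1 # P1" by (rule bump_Cons_E)
  show ?case
    using bump1_facts(1,2)[OF *(1)] Cons.IH[OF *(2)] unfolding *(3,4) ones_simps by linarith
qed simp

lemma bump_subcol:
  "length C = length P \<Longrightarrow> bump z C P = (w, C', P') \<Longrightarrow> subcol C P' \<and> subcol C' P"
  by (induction C P arbitrary: z w C' P' rule: list_induct2)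
    (fastforce split: prod.splits dest: bump1_facts)+

lemma dominates_ones: "dominates d p q \<Longrightarrow> ones q \<le> d + ones p"
  by (induction d p q rule: dominates.induct) auto

lemma dominates_trans: "dominates d p q \<Longrightarrow> dominates e q r \<Longrightarrow> dominates (d + e) p r"
proof (induction d p q arbitrary: e r rule: dominates.induct)
  case (2 d p P q Q)
  then obtain s R where r: "r = s # R" by (cases r) auto
  have a: "of_bool q \<le> d + of_bool p" "dominates (d + of_bool p - of_bool q) P Q"
    and b: "of_bool s \<le> e + of_bool q" "dominates (e + of_bool q - of_bool s) Q R"
    using "2.prems" r by auto
  have "dominates ((d + of_bool p - of_bool q) + (e + of_bool q - of_bool s)) P R"
    by (rule "2.IH"[OF a(2) b(2)])
  moreover have "(d + of_bool p - of_bool q) + (e + of_bool q - of_bool s) = d + e + of_bool p - of_bool s"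
    using a(1) b(1) by linarith
  moreover have "of_bool s \<le> d + e + of_bool p" using a(1) b(1) by linarith
  ultimately show ?case by (simp only: r dominates.simps simp_thms)
qed (case_tac r; simp)+

lemma subcol_dominates: "subcol q p \<Longrightarrow> dominates d p q"
proof (induction q p arbitrary: d rule: list_all2_induct)
  case (Cons q Q p P)
  then show ?case by (cases p; cases q) auto
qed simp

lemma bump_dominates: "length C = length P \<Longrightarrow> bump z C P = (w, C', P') \<Longrightarrow> dominates z P' P"
proof (induction C P arbitrary: z w C' P' rule: list_induct2)
  case (Cons c C p P)
  from Cons.prems obtain z1 c1 p1 C1 P1 where *: "bump1 z c p = (z1, c1, p1)" "bump z1 C P = (w, C1, P1)"
    "C' = c1 # C1" "P' = p1 # P1" by (rule bump_Cons_E)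
  have "z1 = z + of_bool p1 - of_bool p" "of_bool p \<le> z + of_bool p1"
    using bump1_facts(2)[OF *(1)] by linarith+
  then show ?case using Cons.IH[OF *(2)] by (simp only: *(4) dominates.simps simp_thms)
qed simp

text \<open>
  With \<open>z = 0\<close>: if \<open>C\<close> has been bumped out of the column \<open>Q\<close> to the left of \<open>P\<close>, then the column
  that results from \<open>P\<close> may stand next to the old column \<open>Q\<close>. Relative to \<open>P\<close> it has gained as
  many elements up to a point as the queue is long there, and the queue is never longer than the
  excess of \<open>Q\<close> over \<open>P\<close>, because its arrivals are elements of \<open>Q\<close>.
\<close>

lemma bump_dominates_right:
  "length C = length P \<Longrightarrow> bump z C P = (w, C', P') \<Longrightarrow> dominates d Q P \<Longrightarrow> subcol C Q \<Longrightarrow> z \<le> d \<Longrightarrow>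
    dominates (d - z) Q P'"
proof (induction C P arbitrary: z w C' P' d Q rule: list_induct2)
  case (Cons c C p P)
  from Cons.prems(1) obtain z1 c1 p1 C1 P1 where *: "bump1 z c p = (z1, c1, p1)" "bump z1 C P = (w, C1, P1)"
    "C' = c1 # C1" "P' = p1 # P1" by (rule bump_Cons_E)
  obtain q Q' where Q: "Q = q # Q'" using Cons.prems(3) by (auto simp: list_all2_Cons1)
  let ?d = "d + of_bool q - of_bool p"
  have d: "dominates ?d Q' P" "of_bool p \<le> d + of_bool q" "subcol C Q'" "c \<longrightarrow> q"
    using Cons.prems(2,3) Q by auto
  have z1: "z1 \<le> ?d" using bump1_facts(6)[OF *(1)] d(2,4) Cons.prems(4) by (cases c; cases q; cases p) auto
  have "dominates (?d - z1) Q' P1" by (rule Cons.IH[OF *(2) d(1,3) z1])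
  moreover have "of_bool p1 \<le> d - z + of_bool q" "d - z + of_bool q - of_bool p1 = ?d - z1"
    using bump1_facts(2)[OF *(1)] d(2) z1 Cons.prems(4) by linarith+
  ultimately show ?case by (simp only: *(4) Q dominates.simps simp_thms)
qed simp

text \<open>
  The counterpart for the queue run backwards. With \<open>d = 0\<close> it shows that the queue is empty in
  the end, that is, the new columns do come from an insertion.
\<close>

lemma unbump_dominates_right:
  "length C' = length P' \<Longrightarrow> unbump w C' P' = (z, C, P) \<Longrightarrow> dominates d P' Q \<Longrightarrow> subcol C' Q \<Longrightarrow>
    w + ones Q \<le> d + ones P' \<Longrightarrow> z \<le> d \<and> dominates (d - z) P Q"
proof (induction C' P' arbitrary: z C P d Q rule: list_induct2)
  case Nil
  then show ?case by (cases Q) auto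
next
  case (Cons c' C' p' P')
  from Cons.prems(1) obtain z1 c p C1 P1 where *: "unbump w C' P' = (z1, C1, P1)"
    "bump1 z1 c' p' = (z, c, p)" "C = c # C1" "P = p # P1" by (rule unbump_Cons_E)
  obtain q Q' where Q: "Q = q # Q'" using Cons.prems(3) by (auto simp: list_all2_Cons1)
  let ?d = "d + of_bool p' - of_bool q"
  have d: "dominates ?d P' Q'" "of_bool q \<le> d + of_bool p'" "subcol C' Q'" "c' \<longrightarrow> q"
    using Cons.prems(2,3) Q by auto
  have IH: "z1 \<le> ?d" "dominates (?d - z1) P1 Q'"
    using Cons.IH[OF *(1) d(1,3)] Cons.prems(4) d(2) Q by auto
  have f: "z = z1 + of_bool c' - of_bool p'" "z1 + of_bool p = z + of_bool p'"
    using bump1_facts(2,6)[OF *(2)] by blast+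
  have z: "z \<le> d" using IH(1) d(2,4) f(1) by (cases c'; cases q; cases p') auto
  have "of_bool q \<le> d - z + of_bool p" "d - z + of_bool p - of_bool q = ?d - z1"
    using f(2) z IH(1) d(2) by linarith+
  with IH(2) z show ?case by (simp only: *(4) Q dominates.simps simp_thms)
qed

text \<open>
  Column insertion of a whole set into a tableau given by its list of columns. A last column is
  always appended, even if it is empty, so that the lists of column lengths before and after are
  two consecutive rows of a Gelfand-Tsetlin pattern.
\<close>

fun col_insert :: "bool list \<Rightarrow> bool list list \<Rightarrow> bool list list" where
  "col_insert C [] = [C]"
| "col_insert C (p # P) = (let (w, C', p') = bump 0 C p in p' # col_insert C' P)"

fun col_tableau :: "bool list list \<Rightarrow> bool" where
  "col_tableau (p # q # P) = (dominates 0 p q \<and> col_tableau (q # P))"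
| "col_tableau _ = True"

fun interlacing :: "nat list \<Rightarrow> nat list \<Rightarrow> bool" where
  "interlacing [] [a] = True"
| "interlacing (m # ms) (a # b # ls) = (b \<le> m \<and> m \<le> a \<and> interlacing ms (b # ls))"
| "interlacing _ _ = False"

text \<open>
  The inverse of column insertion, given the lengths \<open>\<mu>\<close> of the columns before the insertion.
\<close>

fun col_extract :: "nat list \<Rightarrow> bool list list \<Rightarrow> bool list \<times> bool list list" where
  "col_extract [] [p] = (p, [])"
| "col_extract (b # \<mu>) (p' # P') =
    (let (C', P) = col_extract \<mu> P'; (z, C, p) = unbump (ones p' - b) C' p' in (C, p # P))"
| "col_extract _ _ = ([], [])"

abbreviation of_height :: "nat \<Rightarrow> bool list list \<Rightarrow> bool" where
  "of_height M P \<equiv> \<forall>p\<in>set P. length p = M"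

lemma col_insert_not_Nil [simp]: "col_insert C P \<noteq> []"
  by (cases P) (auto split: prod.splits)

lemma length_col_insert: "length (col_insert C P) = Suc (length P)"
  by (induction P arbitrary: C) (auto split: prod.splits)

text \<open>
  The last conjunct is what the induction needs: the first column of the result fits next to any
  column that fitted there before and contains the inserted set.
\<close>

lemma col_insert_correct:
  assumes "length C = M" "of_height M P" "col_tableau P"
  shows "of_height M (col_insert C P) \<and> col_tableau (col_insert C P) \<and> interlacing (map ones P) (map ones (col_insert C P)) \<and>
    sum_list (map ones (col_insert C P)) = sum_list (map ones P) + ones C \<and>
    col_extract (map ones P) (col_insert C P) = (C, P) \<and>
    (\<forall>q. subcol C q \<and> (P = [] \<or> dominates 0 q (hd P)) \<longrightarrow> dominates 0 q (hd (col_insert C P)))"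
  using assms
proof (induction P arbitrary: C)
  case Nil
  then show ?case by (simp add: subcol_dominates)
next
  case (Cons p P)
  obtain w C' p' where b: "bump 0 C p = (w, C', p')" by (metis prod_cases3)
  have l: "length C = length p" "length p = M" using Cons.prems by auto
  note len = bump_length[OF l(1) b] and o = bump_ones[OF l(1) b] and sub = bump_subcol[OF l(1) b]
  have tP: "col_tableau P" using Cons.prems(3) by (cases P) auto
  have IH: "of_height M (col_insert C' P)" "col_tableau (col_insert C' P)" "interlacing (map ones P) (map ones (col_insert C' P))"
    "sum_list (map ones (col_insert C' P)) = sum_list (map ones P) + ones C'"
    "col_extract (map ones P) (col_insert C' P) = (C', P)"
    "\<And>q. subcol C' q \<Longrightarrow> P = [] \<or> dominates 0 q (hd P) \<Longrightarrow> dominates 0 q (hd (col_insert C' P))"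
    using Cons.IH[OF _ _ tP] len l Cons.prems(2) by auto
  obtain q R where qR: "col_insert C' P = q # R" by (cases "col_insert C' P") auto
  have "P = [] \<or> dominates 0 p (hd P)" using Cons.prems(3) by (cases P) auto
  with IH(6)[of p] sub qR have pq: "dominates 0 p q" by simp
  with dominates_trans[OF bump_dominates[OF l(1) b]] have "dominates 0 p' q" by fastforce
  moreover have "ones q \<le> ones p" using dominates_ones[OF pq] by simp
  moreover have "dominates 0 x p'" if "subcol C x" "dominates 0 x p" for x
    using bump_dominates_right[OF l(1) b that(2,1)] by simp
  moreover have "unbump (ones p' - ones p) C' p' = (0, C, p)"
    using unbump_bump[OF l(1) b] o by simp
  ultimately show ?case
    using IH(1-5) qR len l o b Cons.prems(2) by (auto simp: b)
qed

lemma col_extract_correct: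
  assumes "of_height M P'" "col_tableau P'" "interlacing \<mu> (map ones P')" "col_extract \<mu> P' = (C, P)"
  shows "length C = M \<and> of_height M P \<and> col_tableau P \<and> map ones P = \<mu> \<and> col_insert C P = P' \<and>
    subcol C (hd P') \<and> (P \<noteq> [] \<longrightarrow> dominates 0 (hd P') (hd P))"
  using assms
proof (induction \<mu> P' arbitrary: C P rule: col_extract.induct)
  case (1 p)
  then show ?case by (auto intro: list.rel_refl)
next
  case (2 b \<mu> p' P')
  obtain C' R where u: "col_extract \<mu> P' = (C', R)" by fastforce
  obtain z C0 p where ub: "unbump (ones p' - b) C' p' = (z, C0, p)" by (metis prod_cases3)
  have CP: "C = C0" "P = p # R" using 2(5) u ub by auto
  obtain q Q where P': "P' = q # Q" using 2(4) by (cases P') auto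
  have tP: "col_tableau P'" "dominates 0 p' q" using 2(3) P' by auto
  have il: "interlacing \<mu> (map ones P')" "ones q \<le> b" "b \<le> ones p'" using 2(4) P' by auto
  have IH: "length C' = M" "of_height M R" "col_tableau R" "map ones R = \<mu>" "col_insert C' R = P'" "subcol C' q"
     "R \<noteq> [] \<Longrightarrow> dominates 0 q (hd R)"
    using 2(1)[OF _ tP(1) il(1) u] 2(2) P' by auto
  have l: "length C' = length p'" using IH(1) 2(2) by simp
  have zz: "z = 0" "dominates 0 p q"
    using unbump_dominates_right[OF l ub tP(2) IH(6)] il by auto
  note len = unbump_length[OF l ub]
  have b: "bump 0 C0 p = (ones p' - b, C', p')" using bump_unbump[OF l ub] zz by simp
  have l2: "length C0 = length p" using len by simp
  have o: "ones p = b" using bump_ones[OF l2 b] il(3) by linarith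
  have t: "col_tableau (p # R)"
  proof (cases R)
    case (Cons r R')
    with IH(7) dominates_trans[OF zz(2), of 0] have "dominates 0 p r" by simp
    with Cons IH(3) show ?thesis by simp
  qed simp
  show ?case
    using t o IH b len bump_subcol[OF l2 b] bump_dominates[OF l2 b] 2(2) by (simp add: CP)
qed auto

fun col_ops :: "bool list list \<Rightarrow> nat multiset list \<Rightarrow> nat multiset list option" where
  "col_ops [] X = Some X"
| "col_ops (C # Cs) X = Option.bind (col_ops Cs X) (col_op {#} C)"

text \<open>
  The exchange rule at each column: the operator of a tableau, composed with one more column set,
  is the operator of the tableau after insertion.
\<close>

lemma col_ops_col_insert: "length C = M \<Longrightarrow> of_height M P \<Longrightarrow> col_ops (col_insert C P) X = col_ops (C # P) X"
proof (induction P arbitrary: C)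
  case (Cons p P)
  obtain w C' p' where b: "bump 0 C p = (w, C', p')" by (metis prod_cases3)
  have l: "length C = length p" using Cons.prems by auto
  have "Option.bind (col_op {#} p Y) (col_op {#} C) = Option.bind (col_op {#} C' Y) (col_op {#} p')" for Y
    by (rule col_op_bump[OF l b]) (simp add: queue_inv_def)
  moreover have "col_ops (col_insert C' P) X = col_ops (C' # P) X"
    using Cons bump_length[OF l b] by auto
  ultimately show ?case by (simp add: b)
qed simp

text \<open>
  The number of Gelfand-Tsetlin patterns with top row \<open>\<nu>\<close> and the given differences of consecutive
  row sums, from the top row down.
\<close>

fun gt_count :: "nat list \<Rightarrow> nat list \<Rightarrow> nat" where
  "gt_count [] \<nu> = of_bool (\<nu> = [])"
| "gt_count (k # ks) \<nu> = (\<Sum>\<mu> | interlacing \<mu> \<nu> \<and> sum_list \<nu> = sum_list \<mu> + k. gt_count ks \<mu>)"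

lemma interlacing_length: "interlacing \<mu> \<nu> \<Longrightarrow> length \<nu> = Suc (length \<mu>)"
  by (induction \<mu> \<nu> rule: interlacing.induct) auto

lemma interlacing_bound: "interlacing \<mu> \<nu> \<Longrightarrow> set \<mu> \<subseteq> {..sum_list \<nu>}"
  by (induction \<mu> \<nu> rule: interlacing.induct) auto

lemma finite_interlacing: "finite {\<mu>. interlacing \<mu> \<nu> \<and> Q \<mu>}"
proof (rule finite_subset)
  show "{\<mu>. interlacing \<mu> \<nu> \<and> Q \<mu>} \<subseteq> {\<mu>. set \<mu> \<subseteq> {..sum_list \<nu>} \<and> length \<mu> \<le> length \<nu>}"
    using interlacing_bound interlacing_length by fastforce
qed (rule finite_lists_length_le, simp)

lemma finite_of_height: "finite {P. of_height M P \<and> length P = n \<and> Q P}"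
proof (rule finite_subset)
  show "{P. of_height M P \<and> length P = n \<and> Q P} \<subseteq> {P. set P \<subseteq> {p. set p \<subseteq> UNIV \<and> length p = M} \<and> length P = n}"
    by auto
qed (intro finite_lists_length_eq, simp)

text \<open>
  The Robinson-Schensted-Knuth correspondence, in its dual form: a sequence of column sets is a
  tableau with the same action together with a Gelfand-Tsetlin pattern, which records the column
  lengths during the insertion.
\<close>

theorem card_col_ops:
  "card {Cs. of_height M Cs \<and> map ones Cs = ks \<and> \<phi> (col_ops Cs X)} =
    (\<Sum>P | of_height M P \<and> length P = length ks \<and> col_tableau P \<and> \<phi> (col_ops P X). gt_count ks (map ones P))"
proof (induction ks arbitrary: \<phi>)
  case Nil
  have "{Cs. of_height M Cs \<and> map ones Cs = [] \<and> \<phi> (col_ops Cs X)} = (if \<phi> (Some X) then {[]} else {})"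
    "{P. of_height M P \<and> length P = length [] \<and> col_tableau P \<and> \<phi> (col_ops P X)} = (if \<phi> (Some X) then {[]} else {})"
    by auto
  then show ?case by simp
next
  case (Cons k ks)
  let ?C = "{C. length C = M \<and> ones C = k}"
  let ?S = "\<lambda>C. {Cs. of_height M Cs \<and> map ones Cs = ks \<and> \<phi> (Option.bind (col_ops Cs X) (col_op {#} C))}"
  let ?T = "\<lambda>C. {P. of_height M P \<and> length P = length ks \<and> col_tableau P \<and> \<phi> (Option.bind (col_ops P X) (col_op {#} C))}"
  let ?T' = "{P. of_height M P \<and> length P = length (k # ks) \<and> col_tableau P \<and> \<phi> (col_ops P X)}"
  let ?U = "\<lambda>P. {\<mu>. interlacing \<mu> (map ones P) \<and> sum_list (map ones P) = sum_list \<mu> + k}"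
  have "finite {C :: bool list. set C \<subseteq> UNIV \<and> length C = M}" by (rule finite_lists_length_eq) simp
  then have finC: "finite ?C" by (rule rev_finite_subset) auto
  have finS: "finite (?S C)" for C
    by (rule finite_subset[OF _ finite_of_height[of M "length ks" "\<lambda>_. True"]]) auto
  have "{Cs. of_height M Cs \<and> map ones Cs = k # ks \<and> \<phi> (col_ops Cs X)} = (\<lambda>(C, Cs). C # Cs) ` Sigma ?C ?S"
    by (auto simp: image_iff map_eq_Cons_conv)
  moreover have "inj_on (\<lambda>(C, Cs). C # Cs) (Sigma ?C ?S)" by (auto simp: inj_on_def)
  ultimately have "card {Cs. of_height M Cs \<and> map ones Cs = k # ks \<and> \<phi> (col_ops Cs X)} = card (Sigma ?C ?S)"
    by (simp add: card_image)
  also have "\<dots> = (\<Sum>C\<in>?C. card (?S C))"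
    using finC finS by (intro card_SigmaI) auto
  also have "\<dots> = (\<Sum>C\<in>?C. \<Sum>P\<in>?T C. gt_count ks (map ones P))"
    by (intro sum.cong refl Cons.IH)
  also have "\<dots> = (\<Sum>(C, P)\<in>Sigma ?C ?T. gt_count ks (map ones P))"
    using finC finite_of_height by (intro sum.Sigma) auto
  also have "\<dots> = (\<Sum>(P, \<mu>)\<in>Sigma ?T' ?U. gt_count ks \<mu>)"
  proof (rule sum.reindex_bij_witness[where i = "\<lambda>(P, \<mu>). col_extract \<mu> P" and j = "\<lambda>(C, P). (col_insert C P, map ones P)"])
    fix a assume "a \<in> Sigma ?C ?T"
    then obtain C P where a: "a = (C, P)" "length C = M" "ones C = k" "of_height M P" "length P = length ks"
      "col_tableau P" "\<phi> (Option.bind (col_ops P X) (col_op {#} C))" by auto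
    note i = col_insert_correct[OF a(2,4,6)]
    show "(case (case a of (C, P) \<Rightarrow> (col_insert C P, map ones P)) of (P, \<mu>) \<Rightarrow> col_extract \<mu> P) = a"
      using i by (simp add: a(1))
    show "(case a of (C, P) \<Rightarrow> (col_insert C P, map ones P)) \<in> Sigma ?T' ?U"
      using i a col_ops_col_insert[OF a(2,4), of X] by (simp add: length_col_insert)
    show "(case case a of (C, P) \<Rightarrow> (col_insert C P, map ones P) of (P, \<mu>) \<Rightarrow> gt_count ks \<mu>) = (case a of (C, P) \<Rightarrow> gt_count ks (map ones P))"
      by (simp add: a(1))
  next
    fix b assume "b \<in> Sigma ?T' ?U"
    then obtain P' \<mu> where b: "b = (P', \<mu>)" "of_height M P'" "length P' = length (k # ks)" "col_tableau P'" "\<phi> (col_ops P' X)"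
      "interlacing \<mu> (map ones P')" "sum_list (map ones P') = sum_list \<mu> + k" by auto
    obtain C P where u: "col_extract \<mu> P' = (C, P)" by fastforce
    from col_extract_correct[OF b(2,4,6) u] have c: "length C = M" "of_height M P" "col_tableau P" "map ones P = \<mu>" "col_insert C P = P'"
      by auto
    have "length P = length ks" using b(3) c(5) length_col_insert[of C P] by simp
    moreover have "ones C = k" using col_insert_correct[OF c(1-3)] b(7) c by simp
    ultimately show "(case b of (P, \<mu>) \<Rightarrow> col_extract \<mu> P) \<in> Sigma ?C ?T"
      using b c u col_ops_col_insert[OF c(1,2), of X] by simp
    show "(case case b of (P, \<mu>) \<Rightarrow> col_extract \<mu> P of (C, P) \<Rightarrow> (col_insert C P, map ones P)) = b"
      using b c u by simp
  qed
  also have "\<dots> = (\<Sum>P\<in>?T'. \<Sum>\<mu>\<in>?U P. gt_count ks \<mu>)"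
    using finite_of_height finite_interlacing by (intro sum.Sigma[symmetric]) auto
  also have "\<dots> = (\<Sum>P\<in>?T'. gt_count (k # ks) (map ones P))" by simp
  finally show ?case .
qed

section \<open>Symmetry of the number of Gelfand-Tsetlin patterns\<close>

text \<open>
  For fixed outer rows \<open>u # ls\<close> and \<open>ms\<close> of a pattern, each entry of the middle row ranges over an
  interval; the first argument is the upper end of the first interval.
\<close>

fun between :: "nat \<Rightarrow> nat list \<Rightarrow> nat list \<Rightarrow> nat list \<Rightarrow> bool" where
  "between u [l] [] [k] = (l \<le> k \<and> k \<le> u)"
| "between u (l # ls) (m # ms) (k # ks) = (max l m \<le> k \<and> k \<le> u \<and> between (min l m) ls ms ks)"
| "between _ _ _ _ = False"

text \<open>
  Reflects each entry of the middle row in its interval.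
\<close>

fun reflect :: "nat \<Rightarrow> nat list \<Rightarrow> nat list \<Rightarrow> nat list \<Rightarrow> nat list" where
  "reflect u [l] [] [k] = [u + l - k]"
| "reflect u (l # ls) (m # ms) (k # ks) = (u + max l m - k) # reflect (min l m) ls ms ks"
| "reflect _ _ _ _ = []"

lemma between_reflect:
  "between u ls ms ks \<Longrightarrow> between u ls ms (reflect u ls ms ks) \<and>
     reflect u ls ms (reflect u ls ms ks) = ks \<and>
     sum_list (reflect u ls ms ks) + sum_list ks = u + sum_list ls + sum_list ms"
  by (induction u ls ms ks rule: between.induct) (auto simp: max_def min_def split: if_splits)

text \<open>
  The bound \<open>v\<close> is the entry of the lower row that the preceding step of the recursion has split
  off.
\<close>

lemma interlacing_iff_between:
  "interlacing (k # ks) (l # ls) \<and> interlacing ms (k # ks) \<and> k \<le> v \<longleftrightarrow> between (min l v) ls ms (k # ks)"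
proof (induction ks arbitrary: k l ls ms v)
  case Nil
  show ?case
  proof (cases ls)
    case (Cons a as)
    then show ?thesis by (cases as; cases ms) auto
  qed simp
next
  case (Cons k' ks)
  show ?case
  proof (cases ls)
    case ls: (Cons a as)
    show ?thesis
    proof (cases ms)
      case ms: (Cons m ms')
      have "interlacing (k # k' # ks) (l # ls) \<and> interlacing ms (k # k' # ks) \<and> k \<le> v \<longleftrightarrow>
         max a m \<le> k \<and> k \<le> min l v \<and> (interlacing (k' # ks) (a # as) \<and> interlacing ms' (k' # ks) \<and> k' \<le> m)"
        unfolding ls ms by auto
      also have "\<dots> \<longleftrightarrow> between (min l v) ls ms (k # k' # ks)"
        unfolding Cons.IH ls ms by simp
      finally show ?thesis .
    qed simp
  qed simp
qed

lemma interlacing2_iff_between: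
  "interlacing \<kappa> (l # \<nu>) \<and> interlacing \<mu> \<kappa> \<longleftrightarrow> between l \<nu> \<mu> \<kappa>"
proof (cases \<kappa>)
  case (Cons k ks)
  have "interlacing (k # ks) (l # \<nu>) \<Longrightarrow> k \<le> l" by (cases \<nu>) auto
  then show ?thesis using interlacing_iff_between[of k ks l \<nu> \<mu> l] Cons by auto
qed (cases \<mu>; cases \<nu>; simp)

text \<open>
  For fixed outer rows, the reflection exchanges the two differences of row sums, because the ends
  of all intervals add up to the sum of the two outer rows. This is the involution of Bender and
  Knuth.
\<close>

lemma gt_count_swap: "gt_count (a # b # ks) \<nu> = gt_count (b # a # ks) \<nu>"
proof (cases \<nu>)
  case Nil
  have "\<not> interlacing \<mu> []" for \<mu> by (cases \<mu>) auto
  then show ?thesis using Nil by simp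
next
  case (Cons l \<nu>')
  let ?K = "\<lambda>a b. {\<kappa>. interlacing \<kappa> \<nu> \<and> sum_list \<nu> = sum_list \<kappa> + a}"
  let ?M = "\<lambda>b \<kappa>. {\<mu>. interlacing \<mu> \<kappa> \<and> sum_list \<kappa> = sum_list \<mu> + b}"
  have eq: "gt_count (a # b # ks) \<nu> = (\<Sum>(\<kappa>, \<mu>)\<in>Sigma (?K a b) (?M b). gt_count ks \<mu>)" for a b
    using finite_interlacing by (simp add: sum.Sigma)
  let ?r = "\<lambda>(\<kappa>, \<mu>). (reflect l \<nu>' \<mu> \<kappa>, \<mu>)"
  have inv: "?r p \<in> Sigma (?K b a) (?M a) \<and> ?r (?r p) = p" if p: "p \<in> Sigma (?K a b) (?M b)" for a b p
  proof -
    obtain \<kappa> \<mu> where p': "p = (\<kappa>, \<mu>)" "interlacing \<kappa> \<nu>" "interlacing \<mu> \<kappa>"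
      "sum_list \<nu> = sum_list \<kappa> + a" "sum_list \<kappa> = sum_list \<mu> + b"
      using p by auto
    have "between l \<nu>' \<mu> \<kappa>"
      using p' Cons interlacing2_iff_between by blast
    from between_reflect[OF this] have r: "between l \<nu>' \<mu> (reflect l \<nu>' \<mu> \<kappa>)"
      "reflect l \<nu>' \<mu> (reflect l \<nu>' \<mu> \<kappa>) = \<kappa>"
      "sum_list (reflect l \<nu>' \<mu> \<kappa>) + sum_list \<kappa> = sum_list \<nu> + sum_list \<mu>"
      using Cons by auto
    have "interlacing (reflect l \<nu>' \<mu> \<kappa>) \<nu>" "interlacing \<mu> (reflect l \<nu>' \<mu> \<kappa>)"
      using r(1) interlacing2_iff_between Cons by blast+
    with r p' show ?thesis by simp
  qed
  show ?thesis
    unfolding eq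
    by (rule sum.reindex_bij_witness[where i = ?r and j = ?r]) (use inv[of _ a b] inv[of _ b a] in \<open>auto split: prod.splits\<close>)
qed

lemma gt_count_mset: "mset ks = mset ls \<Longrightarrow> gt_count ks = gt_count ls"
proof (induction ks arbitrary: ls)
  case (Cons k ks)
  have move: "gt_count (as @ k # bs) = gt_count (k # as @ bs)" for as bs
  proof (induction as)
    case (Cons a as)
    have "gt_count ((a # as) @ k # bs) = gt_count (a # k # as @ bs)"
      using Cons by (intro ext) simp
    also have "\<dots> = gt_count (k # a # as @ bs)" using gt_count_swap by blast
    finally show ?case by simp
  qed simp
  obtain as bs where ls: "ls = as @ k # bs"
    using Cons.prems by (metis list.set_intros(1) set_mset_mset split_list)
  then have "gt_count ks = gt_count (as @ bs)" using Cons by simp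
  then have "gt_count (k # ks) = gt_count (k # as @ bs)" by (intro ext) simp
  then show ?case using move ls by simp
qed simp

lemma gt_count_sum: "gt_count ks \<nu> \<noteq> 0 \<Longrightarrow> sum_list \<nu> = sum_list ks"
proof (induction ks arbitrary: \<nu>)
  case (Cons k ks)
  then obtain \<mu> where "sum_list \<nu> = sum_list \<mu> + k" "gt_count ks \<mu> \<noteq> 0"
    by (auto simp: finite_interlacing)
  with Cons.IH show ?case by fastforce
qed (auto split: if_splits)

section \<open>Schur functions count Gelfand-Tsetlin patterns\<close>

definition decreasing :: "nat list \<Rightarrow> bool" where
  "decreasing \<nu> \<longleftrightarrow> sorted_wrt (\<ge>) \<nu>"

lemma interlacing_nth: "interlacing \<mu> \<nu> \<longleftrightarrow> length \<nu> = Suc (length \<mu>) \<and> (\<forall>i<length \<mu>. \<nu> ! Suc i \<le> \<mu> ! i \<and> \<mu> ! i \<le> \<nu> ! i)"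
proof (induction \<mu> \<nu> rule: interlacing.induct)
  case (2 m ms a b ls)
  have "(\<forall>i<length (m # ms). (a # b # ls) ! Suc i \<le> (m # ms) ! i \<and> (m # ms) ! i \<le> (a # b # ls) ! i) \<longleftrightarrow>
    b \<le> m \<and> m \<le> a \<and> (\<forall>i<length ms. (b # ls) ! Suc i \<le> ms ! i \<and> ms ! i \<le> (b # ls) ! i)"
    by (simp add: All_less_Suc2)
  with 2 show ?case by auto
qed auto

lemma interlacing_decreasing: "interlacing \<mu> \<nu> \<Longrightarrow> decreasing \<mu> \<and> decreasing \<nu>"
proof -
  assume *: "interlacing \<mu> \<nu>"
  have "sorted_wrt (\<ge>) \<mu> \<and> sorted_wrt (\<ge>) \<nu>"
    using * unfolding interlacing_nth sorted_wrt_iff_nth_Suc_transp[OF transp_on_ge]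
    by (auto intro: order_trans) 
  then show ?thesis by (simp add: decreasing_def)
qed

lemma SSYT_rowD: "T \<in> SSYT \<nu> \<Longrightarrow> (i, Suc k) \<in> diagram \<nu> \<Longrightarrow> T (i, k) \<le> T (i, Suc k)"
  unfolding SSYT_def by blast

lemma SSYT_colD: "T \<in> SSYT \<nu> \<Longrightarrow> (Suc i, k) \<in> diagram \<nu> \<Longrightarrow> T (i, k) < T (Suc i, k)"
  unfolding SSYT_def by blast

lemma SSYT_row:
  assumes "T \<in> SSYT \<nu>" "i < length \<nu>" "k' < \<nu> ! i" "k \<le> k'"
  shows "T (i, k) \<le> T (i, k')"
  using assms(4,3)
proof (induction k' rule: dec_induct)
  case (step n)
  have "T (i, n) \<le> T (i, Suc n)"
    using assms(1,2) step.prems by (intro SSYT_rowD) (auto simp: diagram_def)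
  with step show ?case by fastforce
qed simp

lemma diagram_up: "decreasing \<nu> \<Longrightarrow> (Suc i, k) \<in> diagram \<nu> \<Longrightarrow> (i, k) \<in> diagram \<nu>"
  by (auto simp: diagram_def decreasing_def sorted_wrt_iff_nth_less dest: order_less_le_trans)

text \<open>
  Columns strictly increase from an entry of at least one. Hence the last of \<open>n\<close> rows can only
  contain entries of at least \<open>n\<close>.
\<close>

lemma SSYT_entry: "T \<in> SSYT \<nu> \<Longrightarrow> decreasing \<nu> \<Longrightarrow> (i, k) \<in> diagram \<nu> \<Longrightarrow> i < T (i, k)"
proof (induction i)
  case 0
  then show ?case by (force simp: SSYT_def filling_def PiE_iff)
next
  case (Suc i)
  with diagram_up SSYT_colD show ?case by (metis Suc_lessI less_trans_Suc not_less_eq)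
qed

definition shape_below :: "nat list \<Rightarrow> nat \<Rightarrow> (nat \<times> nat \<Rightarrow> nat) \<Rightarrow> nat list" where
  "shape_below \<nu> s T = map (\<lambda>i. card {k. k < \<nu> ! i \<and> T (i, k) < s}) [0..<length \<nu> - 1]"

text \<open>
  With entries up to \<open>n + 1\<close> in \<open>n + 1\<close> rows, the cells with an entry up to \<open>n\<close> leave the last row
  empty, and strictness of the columns says that their shape interlaces with \<open>\<nu>\<close>.
\<close>

lemma SSYT_peel:
  assumes \<nu>: "decreasing \<nu>" "length \<nu> = Suc n" and m: "\<And>i. i \<in># m \<Longrightarrow> i \<le> Suc n"
  shows "card {T \<in> SSYT \<nu>. tableau_content \<nu> T = m} =
    (\<Sum>\<mu> | interlacing \<mu> \<nu> \<and> sum_list \<nu> = sum_list \<mu> + count m (Suc n).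
       card {T \<in> SSYT \<mu>. tableau_content \<mu> T = filter_mset (\<lambda>i. i \<noteq> Suc n) m})"
proof -
  have diag: "(i, k) \<in> diagram (shape_below \<nu> (Suc n) T) \<longleftrightarrow> (i, k) \<in> diagram \<nu> \<and> T (i, k) < Suc n"
    if T: "T \<in> SSYT \<nu>" for T i k
  proof (cases "i < n")
    case True
    then have i: "i < length \<nu>" using \<nu> by simp
    have "{k. k < \<nu> ! i \<and> T (i, k) < Suc n} = {..<card {k. k < \<nu> ! i \<and> T (i, k) < Suc n}}"
      using SSYT_row[OF T i] by (intro downset_eq_lessThan) (auto dest: order_le_less_trans)
    then have "k < card {k. k < \<nu> ! i \<and> T (i, k) < Suc n} \<longleftrightarrow> k < \<nu> ! i \<and> T (i, k) < Suc n"
      by blast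
    with True \<nu> show ?thesis by (simp add: shape_below_def diagram_def)
  next
    case False
    have "\<not> ((i, k) \<in> diagram \<nu> \<and> T (i, k) < Suc n)"
      using SSYT_entry[OF T \<nu>(1), of i k] False by auto
    with False \<nu> show ?thesis by (simp add: shape_below_def diagram_def)
  qed
  have sub: "diagram \<mu> \<subseteq> diagram \<nu>" if "interlacing \<mu> \<nu>" for \<mu>
    using that unfolding interlacing_nth diagram_def by (auto dest: order_less_le_trans)
  show ?thesis
  proof (rule card_peel[where l = n])
    show "SSYT \<mu> \<subseteq> filling \<mu>" for \<mu> by (auto simp: SSYT_def)
    show "diagram \<mu> \<subseteq> diagram \<nu> \<and> length \<mu> = n" if "interlacing \<mu> \<nu>" for \<mu>
      using sub[OF that] interlacing_length[OF that] \<nu>(2) by simp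
    show "finite {\<mu>. interlacing \<mu> \<nu> \<and> sum_list \<nu> = sum_list \<mu> + count m (Suc n)}" by (rule finite_interlacing)
  next
    fix T assume TS: "T \<in> SSYT \<nu>" and c: "tableau_content \<nu> T = m"
    define \<mu> where "\<mu> = shape_below \<nu> (Suc n) T"
    define T' where "T' = restrict T (diagram \<mu>)"
    have le: "T c \<le> Suc n" if "c \<in> diagram \<nu>" for c
      using content_mem[OF that, of T] m c by simp
    have D: "(i, k) \<in> diagram \<mu> \<longleftrightarrow> (i, k) \<in> diagram \<nu> \<and> T (i, k) < Suc n" for i k
      unfolding \<mu>_def by (rule diag[OF TS])
    have len: "length \<mu> = n" by (simp add: \<mu>_def shape_below_def \<nu>)
    have il: "interlacing \<mu> \<nu>"
      unfolding interlacing_nth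
    proof (intro conjI allI impI)
      fix i assume i: "i < length \<mu>"
      show "\<mu> ! i \<le> \<nu> ! i"
      proof (rule ccontr)
        assume "\<not> \<mu> ! i \<le> \<nu> ! i"
        with i have "(i, \<nu> ! i) \<in> diagram \<mu>" by (simp add: diagram_def)
        with D show False by (simp add: diagram_def)
      qed
      show "\<nu> ! Suc i \<le> \<mu> ! i"
      proof (rule ccontr)
        assume "\<not> \<nu> ! Suc i \<le> \<mu> ! i"
        with i len \<nu> have d: "(Suc i, \<mu> ! i) \<in> diagram \<nu>" by (simp add: diagram_def)
        then have "(i, \<mu> ! i) \<in> diagram \<nu>" "T (i, \<mu> ! i) < Suc n"
          using diagram_up[OF \<nu>(1)] SSYT_colD[OF TS d] le[OF d] by auto
        with D[of i "\<mu> ! i"] i show False by (simp add: diagram_def)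
      qed
    qed (simp add: len \<nu>)
    note Dsub = sub[OF il]
    have T': "T' \<in> SSYT \<mu>"
      unfolding SSYT_def
    proof (intro CollectI conjI allI impI)
      show "T' \<in> filling \<mu>"
        using TS Dsub by (auto simp: SSYT_def filling_def T'_def)
    next
      fix i k assume "(i, Suc k) \<in> diagram \<mu>"
      then have "(i, Suc k) \<in> diagram \<nu>" "(i, Suc k) \<in> diagram \<mu>" "(i, k) \<in> diagram \<mu>"
        using Dsub diagram_left by auto
      then show "T' (i, k) \<le> T' (i, Suc k)" using SSYT_rowD[OF TS] by (simp add: T'_def)
    next
      fix i k assume "(Suc i, k) \<in> diagram \<mu>"
      then have "(Suc i, k) \<in> diagram \<nu>" "(Suc i, k) \<in> diagram \<mu>" "(i, k) \<in> diagram \<mu>"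
        using Dsub diagram_up interlacing_decreasing[OF il] by auto
      then show "T' (i, k) < T' (Suc i, k)" using SSYT_colD[OF TS] by (simp add: T'_def)
    qed
    have "diagram \<mu> = {c \<in> diagram \<nu>. T c \<noteq> Suc n}"
    proof (rule set_eqI)
      fix c show "c \<in> diagram \<mu> \<longleftrightarrow> c \<in> {c \<in> diagram \<nu>. T c \<noteq> Suc n}"
        using D[of "fst c" "snd c"] le[of c] by (auto simp: order.strict_iff_order)
    qed
    with il T' show "\<exists>\<mu>. interlacing \<mu> \<nu> \<and> diagram \<mu> = {c \<in> diagram \<nu>. T c \<noteq> Suc n} \<and> restrict T (diagram \<mu>) \<in> SSYT \<mu>"
      unfolding T'_def by blast
  next
    fix \<mu> T'
    assume il: "interlacing \<mu> \<nu>" and T': "T' \<in> SSYT \<mu>"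
      and T'm: "\<And>c. c \<in> diagram \<mu> \<Longrightarrow> T' c \<in># m \<and> T' c \<noteq> Suc n"
    define T where "T = (\<lambda>c. if c \<in> diagram \<mu> then T' c else if c \<in> diagram \<nu> then Suc n else undefined)"
    note Dsub = sub[OF il]
    have lt: "T' c < Suc n" if "c \<in> diagram \<mu>" for c
      using T'm[OF that] m[of "T' c"] by simp
    have T1: "T c = T' c" if "c \<in> diagram \<mu>" for c using that by (simp add: T_def)
    have T2: "T c = Suc n" if "c \<in> diagram \<nu>" "c \<notin> diagram \<mu>" for c using that by (simp add: T_def)
    have le: "T c \<le> Suc n" if "c \<in> diagram \<nu>" for c
      using lt[of c] that T1[of c] T2[of c] by (cases "c \<in> diagram \<mu>") auto
    have "T \<in> SSYT \<nu>"
      unfolding SSYT_def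
    proof (intro CollectI conjI allI impI)
      show "T \<in> filling \<nu>"
        unfolding filling_def
      proof (rule PiE_I)
        fix c assume c: "c \<in> diagram \<nu>"
        show "T c \<in> {0<..}"
        proof (cases "c \<in> diagram \<mu>")
          case True
          then show ?thesis using T' T1 by (auto simp: SSYT_def filling_def)
        qed (simp add: T2 c)
      qed (use Dsub in \<open>auto simp: T_def\<close>)
    next
      fix i k assume *: "(i, Suc k) \<in> diagram \<nu>"
      show "T (i, k) \<le> T (i, Suc k)"
      proof (cases "(i, Suc k) \<in> diagram \<mu>")
        case True
        then show ?thesis using SSYT_rowD[OF T' True] T1 diagram_left by simp
      next
        case False
        with * show ?thesis using T2 le diagram_left by metis
      qed
    next
      fix i k assume *: "(Suc i, k) \<in> diagram \<nu>"
      then have "Suc i < length \<nu>" "k < \<nu> ! Suc i" by (auto simp: diagram_def)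
      then have up: "(i, k) \<in> diagram \<mu>"
        using il unfolding interlacing_nth diagram_def by (auto dest: order_less_le_trans)
      show "T (i, k) < T (Suc i, k)"
      proof (cases "(Suc i, k) \<in> diagram \<mu>")
        case True
        then show ?thesis using SSYT_colD[OF T' True] T1 up by simp
      next
        case False
        show ?thesis using T2[OF * False] T1[OF up] lt[OF up] by simp
      qed
    qed
    then show "(\<lambda>c. if c \<in> diagram \<mu> then T' c else if c \<in> diagram \<nu> then Suc n else undefined) \<in> SSYT \<nu>"
      by (simp only: T_def)
  qed
qed

text \<open>
  The list is reversed because the largest entry is peeled first.
\<close>

lemma card_SSYT:
  assumes "decreasing \<nu>" "length \<nu> = n" "\<And>i. i \<in># m \<Longrightarrow> 1 \<le> i \<and> i \<le> n"
  shows "card {T \<in> SSYT \<nu>. tableau_content \<nu> T = m} = gt_count (map (count m) (rev [1..<Suc n])) \<nu>"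
  using assms
proof (induction n arbitrary: \<nu> m)
  case 0
  then have m: "m = {#}" "\<nu> = []" by (metis multiset_nonemptyE not_one_le_zero order_trans, simp)
  have "diagram [] = {}" by (auto simp: diagram_def)
  then have "{T \<in> SSYT []. tableau_content [] T = {#}} = {\<lambda>_. undefined}"
    by (auto simp: SSYT_def filling_def tableau_content_def)
  then show ?case using m by simp
next
  case (Suc n)
  let ?m = "filter_mset (\<lambda>i. i \<noteq> Suc n) m"
  have IH: "card {T \<in> SSYT \<mu>. tableau_content \<mu> T = ?m} = gt_count (map (count m) (rev [1..<Suc n])) \<mu>"
    if "interlacing \<mu> \<nu>" for \<mu>
  proof -
    have "card {T \<in> SSYT \<mu>. tableau_content \<mu> T = ?m} = gt_count (map (count ?m) (rev [1..<Suc n])) \<mu>"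
    proof (rule Suc.IH)
      show "decreasing \<mu>" using interlacing_decreasing[OF that] by blast
      show "length \<mu> = n" using interlacing_length[OF that] Suc.prems(2) by simp
      fix i assume "i \<in># ?m"
      then have "i \<in># m" "i \<noteq> Suc n" by auto
      with Suc.prems(3)[of i] show "1 \<le> i \<and> i \<le> n" by simp
    qed
    also have "map (count ?m) (rev [1..<Suc n]) = map (count m) (rev [1..<Suc n])"
      by (intro map_cong) auto
    finally show ?thesis .
  qed
  have range: "rev [1..<Suc (Suc n)] = Suc n # rev [1..<Suc n]" by simp
  have "card {T \<in> SSYT \<nu>. tableau_content \<nu> T = m} =
    (\<Sum>\<mu> | interlacing \<mu> \<nu> \<and> sum_list \<nu> = sum_list \<mu> + count m (Suc n). card {T \<in> SSYT \<mu>. tableau_content \<mu> T = ?m})"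
    by (rule SSYT_peel) (use Suc.prems in auto)
  also have "\<dots> = gt_count (map (count m) (rev [1..<Suc (Suc n)])) \<nu>"
    unfolding range by (simp add: IH del: upt_Suc)
  finally show ?case .
qed

section \<open>Strips as column operators\<close>

text \<open>
  The operator that describes composition tableaux: in the first column it lengthens the lowest
  empty row.
\<close>

fun col_op_top :: "bool list \<Rightarrow> nat multiset list \<Rightarrow> nat multiset list option" where
  "col_op_top [] Ss = Some Ss"
| "col_op_top (c # cs) [] = None"
| "col_op_top (c # cs) (S # Ss) =
    (let D = (if c then {#Max (set_mset S)#} else {#})
     in if c \<and> S = {#} then None else map_option ((#) (S - D)) (col_op D cs Ss))"

text \<open>
  The shape \<open>v\<close>, as a list of row lengths up to \<open>M\<close>, in the representation on which the operators
  act.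
\<close>

definition levels :: "nat \<Rightarrow> nat list \<Rightarrow> nat multiset list" where
  "levels M v = map (\<lambda>c. mset_set {i. i < length v \<and> v ! i = c}) [0..<Suc M]"

lemma length_levels [simp]: "length (levels M v) = Suc M"
  by (simp add: levels_def)

lemma nth_levels [simp]: "c \<le> M \<Longrightarrow> levels M v ! c = mset_set {i. i < length v \<and> v ! i = c}"
  by (simp add: levels_def nth_append del: upt_Suc)

definition vectors :: "nat \<Rightarrow> nat \<Rightarrow> nat list set" where
  "vectors M n = {v. length v = n \<and> (\<forall>i<n. v ! i \<le> M)}"

text \<open>
  Operators only move rows, and only upwards.
\<close>

lemma col_op_sum:
  "col_op E C Ss = Some Zs \<Longrightarrow> length Zs = length Ss \<and> sum_list Zs = E + sum_list Ss \<and>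
     sum_list (take d Zs) \<subseteq># E + sum_list (take d Ss)"
proof (induction E C Ss arbitrary: Zs d rule: col_op.induct)
  case (2 E S Ss)
  then show ?case by (cases d) (auto simp: ac_simps)
next
  case (4 E c cs S Ss)
  define A where "A = S + E"
  define D where "D = (if c then {#least A#} else {#})"
  from 4(2) obtain Zs' where Z: "\<not> (c \<and> A = {#})" "col_op D cs Ss = Some Zs'" "Zs = (A - D) # Zs'"
    by (auto simp: A_def D_def Let_def split: if_splits)
  have IH: "length Zs' = length Ss" "sum_list Zs' = D + sum_list Ss"
    "\<And>d. sum_list (take d Zs') \<subseteq># D + sum_list (take d Ss)"
    using 4(1)[OF A_def D_def Z(1,2)] by auto
  have sub: "D \<subseteq># A" using Z(1) least_in by (auto simp: D_def)
  then have AD: "A - D + (D + X) = A + X" for X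
    by (metis add.assoc subset_mset.diff_add)
  have "sum_list (take d Zs) \<subseteq># E + sum_list (take d (S # Ss))"
  proof (cases d)
    case (Suc d')
    have "A - D + sum_list (take d' Zs') \<subseteq># A - D + (D + sum_list (take d' Ss))"
      using IH(3) by (rule subset_mset.add_left_mono)
    then have "A - D + sum_list (take d' Zs') \<subseteq># A + sum_list (take d' Ss)" by (simp only: AD)
    moreover have "A + sum_list (take d' Ss) = E + (S + sum_list (take d' Ss))" by (simp add: A_def ac_simps)
    ultimately show ?thesis using Suc Z(3) by (simp only: take_Suc_Cons sum_list.Cons)
  qed simp
  moreover have "sum_list Zs = E + sum_list (S # Ss)"
    using IH(2) AD Z(3) by (simp add: A_def ac_simps)
  ultimately show ?case using IH(1) Z(3) by simp
qed auto

lemma col_op_top_sum: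
  assumes "col_op_top C Ss = Some Zs"
  shows "length Zs = length Ss \<and> sum_list Zs = sum_list Ss \<and>
     sum_list (take d Zs) \<subseteq># sum_list (take d Ss)"
proof (cases C)
  case (Cons c cs)
  then obtain S Ts where S: "Ss = S # Ts" using assms by (cases Ss) auto
  define D where "D = (if c then {#Max (set_mset S)#} else {#})"
  from assms obtain Zs' where Z: "\<not> (c \<and> S = {#})" "col_op D cs Ts = Some Zs'" "Zs = (S - D) # Zs'"
    by (auto simp: Cons S D_def Let_def split: if_splits)
  note a = col_op_sum[OF Z(2)]
  have sub: "D \<subseteq># S" using Z(1) Max_in[of "set_mset S"] by (auto simp: D_def)
  then have SD: "S - D + (D + X) = S + X" for X
    by (metis add.assoc subset_mset.diff_add)
  have "sum_list (take d Zs) \<subseteq># sum_list (take d Ss)"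
  proof (cases d)
    case (Suc d')
    have "S - D + sum_list (take d' Zs') \<subseteq># S - D + (D + sum_list (take d' Ts))"
      using a by (intro subset_mset.add_left_mono) blast
    with Suc Z(3) SD S show ?thesis by (simp only: take_Suc_Cons sum_list.Cons)
  qed simp
  moreover have "sum_list Zs = sum_list Ss" using a SD Z(3) S by (simp only: sum_list.Cons)
  ultimately show ?thesis using a Z(3) S by simp
qed (use assms in simp)

lemma mset_set_disjoint_Un:
  "A = B \<union> C \<Longrightarrow> finite B \<Longrightarrow> finite C \<Longrightarrow> B \<inter> C = {} \<Longrightarrow> mset_set A = mset_set B + mset_set C"
  using mset_set_Union by blast

lemma sum_list_levels: "d \<le> Suc M \<Longrightarrow> sum_list (take d (levels M v)) = mset_set {i. i < length v \<and> v ! i < d}"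
proof (induction d)
  case (Suc d)
  have "mset_set {i. i < length v \<and> v ! i < Suc d} =
     mset_set {i. i < length v \<and> v ! i < d} + mset_set {i. i < length v \<and> v ! i = d}"
    by (rule mset_set_disjoint_Un) auto
  with Suc show ?case by (simp add: take_Suc_conv_app_nth)
qed simp

lemma sum_list_levels_all: "v \<in> vectors M n \<Longrightarrow> sum_list (levels M v) = mset_set {..<n}"
  using sum_list_levels[of "Suc M" M v] by (auto simp: vectors_def intro!: arg_cong[where f = mset_set])

lemma levels_inject: "v \<in> vectors M n \<Longrightarrow> v' \<in> vectors M n \<Longrightarrow> levels M v = levels M v' \<Longrightarrow> v = v'"
proof (rule nth_equalityI)
  fix i assume *: "v \<in> vectors M n" "v' \<in> vectors M n" "levels M v = levels M v'" "i < length v"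
  let ?c = "v ! i"
  have "?c \<le> M" using * by (auto simp: vectors_def)
  then have "mset_set {i. i < length v \<and> v ! i = ?c} = mset_set {i. i < length v' \<and> v' ! i = ?c}"
    using *(3) nth_levels by metis
  then have "{i. i < length v \<and> v ! i = ?c} = {i. i < length v' \<and> v' ! i = ?c}"
    by (subst (asm) mset_set_eq_iff) auto
  from eqset_imp_iff[OF this, of i] *(4) show "v ! i = v' ! i" by simp
qed (auto simp: vectors_def)

text \<open>
  Since operators preserve the multiset of all rows, they lead from shapes to shapes.
\<close>

lemma levels_surj:
  assumes "length X = Suc M" "sum_list X = mset_set {..<n}"
  shows "\<exists>v\<in>vectors M n. X = levels M v"
proof -
  have cnt: "(\<Sum>c<Suc M. count (X ! c) i) = of_bool (i < n)" for i
  proof -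
    have "count (sum_list X) i = (\<Sum>c<length X. count (X ! c) i)"
      by (simp add: sum_list_sum_nth count_sum atLeast0LessThan)
    moreover have "count (sum_list X) i = of_bool (i < n)"
      by (simp add: assms(2) count_mset_set')
    ultimately show ?thesis by (simp only: assms(1))
  qed
  have "\<exists>c\<le>M. count (X ! c) i = 1 \<and> (\<forall>d\<le>M. c \<noteq> d \<longrightarrow> count (X ! d) i = 0)" if "i < n" for i
  proof -
    have "(\<Sum>c<Suc M. count (X ! c) i) = 1" using cnt[of i] that by simp
    then obtain a where "a \<in> {..<Suc M}" "count (X ! a) i = 1"
        "\<forall>b\<in>{..<Suc M}. a \<noteq> b \<longrightarrow> count (X ! b) i = 0"
      unfolding sum_eq_1_iff[OF finite_lessThan] by blast
    then show ?thesis by (intro exI[of _ a]) auto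
  qed
  then obtain f where f: "\<And>i. i < n \<Longrightarrow> f i \<le> M \<and> count (X ! f i) i = 1 \<and> (\<forall>d\<le>M. f i \<noteq> d \<longrightarrow> count (X ! d) i = 0)"
    by metis
  let ?v = "map f [0..<n]"
  have v: "?v \<in> vectors M n" using f by (auto simp: vectors_def)
  have "X = levels M ?v"
  proof (rule nth_equalityI)
    fix c assume c: "c < length X"
    then have c': "c \<le> M" using assms by simp
    show "X ! c = levels M ?v ! c"
    proof (rule multiset_eqI)
      fix i
      show "count (X ! c) i = count (levels M ?v ! c) i"
      proof (cases "i < n")
        case True
        then show ?thesis using f[OF True] c' by (cases "f i = c") (auto simp: count_mset_set')
      next
        case False
        then have "\<forall>a\<in>{..<Suc M}. count (X ! a) i = 0"
          using cnt[of i] by (simp del: sum.lessThan_Suc)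
        then have "count (X ! c) i = 0" using c assms(1) by simp
        with False c' show ?thesis by (simp add: count_mset_set')
      qed
    qed
  qed (simp add: assms)
  with v show ?thesis by blast
qed

text \<open>
  The rows to which a cell in column \<open>c\<close> is added between \<open>z\<close> and \<open>x\<close>.
\<close>

definition growing :: "nat list \<Rightarrow> nat list \<Rightarrow> nat \<Rightarrow> nat set" where
  "growing z x c = {i. i < length x \<and> z ! i < c \<and> c \<le> x ! i}"

text \<open>
  The rows that have length \<open>c\<close> after all columns up to \<open>c\<close> have been processed.
\<close>

definition movable :: "nat list \<Rightarrow> nat list \<Rightarrow> nat \<Rightarrow> nat set" where
  "movable z x c = {i. i < length x \<and> z ! i \<le> c \<and> c \<le> x ! i}"

lemma finite_growing_movable [simp]: "finite (growing z x c)" "finite (movable z x c)"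
  by (auto simp: growing_def movable_def)

text \<open>
  The rule for the new cell in column \<open>c + 1\<close>.
\<close>

definition step_ok :: "nat list \<Rightarrow> nat list \<Rightarrow> bool list \<Rightarrow> nat \<Rightarrow> bool" where
  "step_ok z x C c \<longleftrightarrow> growing z x (Suc c) =
     (if C ! c then {(if c = 0 then Max else Min) (movable z x c)} else {}) \<and> (C ! c \<longrightarrow> movable z x c \<noteq> {})"

lemma movable_split:
  assumes "list_all2 (\<le>) z x"
  shows "mset_set (movable z x c) = mset_set {i. i < length z \<and> z ! i = c} + mset_set (growing z x c)"
    "mset_set (movable z x c) = mset_set {i. i < length x \<and> x ! i = c} + mset_set (growing z x (Suc c))"
proof -
  have *: "length z = length x" "\<And>i. i < length x \<Longrightarrow> z ! i \<le> x ! i"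
    using assms by (auto simp: list_all2_conv_all_nth)
  show "mset_set (movable z x c) = mset_set {i. i < length z \<and> z ! i = c} + mset_set (growing z x c)"
    by (rule mset_set_disjoint_Un) (use * in \<open>auto simp: movable_def growing_def\<close>)
  show "mset_set (movable z x c) = mset_set {i. i < length x \<and> x ! i = c} + mset_set (growing z x (Suc c))"
    by (rule mset_set_disjoint_Un) (use * in \<open>auto simp: movable_def growing_def\<close>)
qed

text \<open>
  The computation of the operator at one level agrees with \<open>x\<close> if and only if the lengthened row
  is the one that grows.
\<close>

lemma growing_step:
  assumes le: "list_all2 (\<le>) z x" and pick: "c0 \<Longrightarrow> movable z x c \<noteq> {} \<Longrightarrow> e \<in> movable z x c"
  defines "A \<equiv> mset_set (movable z x c)" and "D \<equiv> if c0 then {#e#} else {#}"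
  shows "\<not> (c0 \<and> A = {#}) \<Longrightarrow> A - D = mset_set {i. i < length x \<and> x ! i = c} \<longleftrightarrow>
    growing z x (Suc c) = (if c0 then {e} else {})"
proof -
  assume ne: "\<not> (c0 \<and> A = {#})"
  have sub: "D \<subseteq># A"
    using ne pick by (auto simp: A_def D_def mset_set_empty_iff)
  have D: "D = mset_set (if c0 then {e} else {})" by (simp add: D_def)
  have "A - D = mset_set {i. i < length x \<and> x ! i = c} \<longleftrightarrow> D = mset_set (growing z x (Suc c))"
    using movable_split(2)[OF le, of c] sub unfolding A_def
    by (metis add_diff_cancel_left' subset_mset.diff_add add_diff_cancel_right' add.commute)
  also have "\<dots> \<longleftrightarrow> growing z x (Suc c) = (if c0 then {e} else {})"
    unfolding D by (subst mset_set_eq_iff) auto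
  finally show ?thesis .
qed

text \<open>
  Isolates the propositional part of the next two proofs.
\<close>

lemma conj_step: "(\<not> K \<Longrightarrow> P \<longleftrightarrow> N) \<Longrightarrow> (S \<longleftrightarrow> N \<and> \<not> K) \<Longrightarrow> (\<not> K \<and> P \<and> R) \<longleftrightarrow> (S \<and> R)"
  by blast

lemma col_op_levels_iff:
  assumes le: "list_all2 (\<le>) z x" and x: "x \<in> vectors M n" and C: "length C = M"
    and c: "1 \<le> c" "c \<le> M"
  shows "col_op (mset_set (growing z x c)) (drop c C) (drop c (levels M z)) = Some (drop c (levels M x)) \<longleftrightarrow>
     (\<forall>d. c \<le> d \<and> d < M \<longrightarrow> step_ok z x C d)"
  using c(2,1)
proof (induction rule: inc_induct)
  case base
  have "growing z x (Suc M) = {}"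
    using x by (auto simp: growing_def vectors_def not_less_eq_eq)
  then have "mset_set {i. i < length z \<and> z ! i = M} + mset_set (growing z x M) = mset_set {i. i < length x \<and> x ! i = M}"
    using movable_split[OF le, of M] by simp
  moreover have "drop M (levels M v) = [mset_set {i. i < length v \<and> v ! i = M}]" for v
    by (simp add: Cons_nth_drop_Suc[symmetric])
  ultimately show ?case using C by auto
next
  case (step c)
  let ?A = "mset_set (movable z x c)"
  let ?D = "if C ! c then {#least ?A#} else {#}"
  have dl: "drop c (levels M v) = mset_set {i. i < length v \<and> v ! i = c} # drop (Suc c) (levels M v)" for v
    using step.hyps by (simp add: Cons_nth_drop_Suc[symmetric])
  have dC: "drop c C = C ! c # drop (Suc c) C"
    using step.hyps C by (simp add: Cons_nth_drop_Suc[symmetric])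
  have l: "least ?A = Min (movable z x c)" by (simp add: least_def)
  have ok: "step_ok z x C c \<longleftrightarrow> growing z x (Suc c) = (if C ! c then {least ?A} else {}) \<and> \<not> (C ! c \<and> ?A = {#})"
    using step.prems by (simp add: step_ok_def l mset_set_empty_iff)
  have "col_op (mset_set (growing z x c)) (drop c C) (drop c (levels M z)) = Some (drop c (levels M x)) \<longleftrightarrow>
    \<not> (C ! c \<and> ?A = {#}) \<and> ?A - ?D = mset_set {i. i < length x \<and> x ! i = c} \<and>
    col_op ?D (drop (Suc c) C) (drop (Suc c) (levels M z)) = Some (drop (Suc c) (levels M x))"
    unfolding dl dC movable_split(1)[OF le, of c] by (auto simp: Let_def)
  also have "\<dots> \<longleftrightarrow> step_ok z x C c \<and>
    col_op ?D (drop (Suc c) C) (drop (Suc c) (levels M z)) = Some (drop (Suc c) (levels M x))"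
  proof -
    have "?A - ?D = mset_set {i. i < length x \<and> x ! i = c} \<longleftrightarrow>
        growing z x (Suc c) = (if C ! c then {least ?A} else {})" if "\<not> (C ! c \<and> ?A = {#})"
      by (rule growing_step[OF le _ that]) (simp add: l)
    then show ?thesis using ok by (rule conj_step)
  qed
  also have "\<dots> \<longleftrightarrow> step_ok z x C c \<and>
    col_op (mset_set (growing z x (Suc c))) (drop (Suc c) C) (drop (Suc c) (levels M z)) = Some (drop (Suc c) (levels M x))"
    by (rule conj_cong[OF refl]) (simp add: ok)
  also have "\<dots> \<longleftrightarrow> step_ok z x C c \<and> (\<forall>d. Suc c \<le> d \<and> d < M \<longrightarrow> step_ok z x C d)"
    using step.IH by simp
  also have "\<dots> \<longleftrightarrow> (\<forall>d. c \<le> d \<and> d < M \<longrightarrow> step_ok z x C d)"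
    using step.hyps by (metis Suc_leD Suc_leI le_neq_implies_less order_refl)
  finally show ?case .
qed

lemma col_op_top_levels_iff:
  assumes z: "z \<in> vectors M n" and x: "x \<in> vectors M n" and C: "length C = M" and M: "0 < M"
  shows "col_op_top C (levels M z) = Some (levels M x) \<longleftrightarrow> list_all2 (\<le>) z x \<and> (\<forall>d<M. step_ok z x C d)"
proof (cases "list_all2 (\<le>) z x")
  case le: True
  let ?A = "mset_set (movable z x 0)"
  let ?D = "if C ! 0 then {#Max (movable z x 0)#} else {#}"
  have dl: "levels M v = mset_set {i. i < length v \<and> v ! i = 0} # drop 1 (levels M v)" for v
    using Cons_nth_drop_Suc[of 0 "levels M v"] by simp
  have dC: "C = C ! 0 # drop 1 C" using C M Cons_nth_drop_Suc[of 0 C] by simp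
  have A: "mset_set {i. i < length z \<and> z ! i = 0} = ?A"
    using movable_split(1)[OF le, of 0] by (simp add: growing_def)
  have ok: "step_ok z x C 0 \<longleftrightarrow> growing z x (Suc 0) = (if C ! 0 then {Max (movable z x 0)} else {}) \<and> \<not> (C ! 0 \<and> ?A = {#})"
    by (simp add: step_ok_def mset_set_empty_iff)
  have "col_op_top C (levels M z) = Some (levels M x) \<longleftrightarrow>
    \<not> (C ! 0 \<and> ?A = {#}) \<and> ?A - ?D = mset_set {i. i < length x \<and> x ! i = 0} \<and>
    col_op ?D (drop 1 C) (drop 1 (levels M z)) = Some (drop 1 (levels M x))"
    by (subst dC, subst (1 2) dl) (auto simp: Let_def A)
  also have "\<dots> \<longleftrightarrow> step_ok z x C 0 \<and> col_op ?D (drop 1 C) (drop 1 (levels M z)) = Some (drop 1 (levels M x))"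
  proof -
    have "?A - ?D = mset_set {i. i < length x \<and> x ! i = 0} \<longleftrightarrow>
        growing z x (Suc 0) = (if C ! 0 then {Max (movable z x 0)} else {})" if "\<not> (C ! 0 \<and> ?A = {#})"
      by (rule growing_step[OF le _ that]) simp
    then show ?thesis using ok by (rule conj_step)
  qed
  also have "\<dots> \<longleftrightarrow> step_ok z x C 0 \<and> col_op (mset_set (growing z x 1)) (drop 1 C) (drop 1 (levels M z)) = Some (drop 1 (levels M x))"
    by (rule conj_cong[OF refl]) (simp add: ok)
  also have "\<dots> \<longleftrightarrow> step_ok z x C 0 \<and> (\<forall>d. 1 \<le> d \<and> d < M \<longrightarrow> step_ok z x C d)"
    using col_op_levels_iff[OF le x C, of 1] M by simp
  also have "\<dots> \<longleftrightarrow> (\<forall>d<M. step_ok z x C d)"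
    using M by (metis One_nat_def Suc_leI neq0_conv)
  finally show ?thesis using le by simp
next
  case False
  have "col_op_top C (levels M z) \<noteq> Some (levels M x)"
  proof
    assume a: "col_op_top C (levels M z) = Some (levels M x)"
    have "z ! i \<le> x ! i" if "i < n" for i
    proof -
      have d: "Suc (x ! i) \<le> Suc M" using x that by (auto simp: vectors_def)
      have "mset_set {j. j < length x \<and> x ! j < Suc (x ! i)} \<subseteq># mset_set {j. j < length z \<and> z ! j < Suc (x ! i)}"
        using col_op_top_sum[OF a, of "Suc (x ! i)"] by (simp only: sum_list_levels[OF d])
      then have "{j. j < length x \<and> x ! j < Suc (x ! i)} \<subseteq> {j. j < length z \<and> z ! j < Suc (x ! i)}"
        using set_mset_mono by fastforce
      then show ?thesis using that x by (auto simp: vectors_def)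
    qed
    with z x have "list_all2 (\<le>) z x" by (auto simp: list_all2_conv_all_nth vectors_def)
    with False show False by blast
  qed
  with False show ?thesis by blast
qed

lemma ones_eq_sum: "ones C = (\<Sum>c<length C. of_bool (C ! c))"
proof (induction C)
  case (Cons b C)
  have "(\<Sum>c<Suc (length C). of_bool ((b # C) ! c)) = (of_bool b + (\<Sum>c<length C. of_bool (C ! c)) :: nat)"
    by (subst sum.lessThan_Suc_shift) simp
  with Cons show ?case by simp
qed simp

lemma step_ok_ones:
  assumes le: "list_all2 (\<le>) z x" and x: "x \<in> vectors M n" and C: "length C = M" and ok: "\<forall>d<M. step_ok z x C d"
  shows "sum_list x = sum_list z + ones C"
proof -
  have l: "length z = length x" "\<And>i. i < length x \<Longrightarrow> z ! i \<le> x ! i" "\<And>i. i < length x \<Longrightarrow> x ! i \<le> M"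
    using le x by (auto simp: list_all2_conv_all_nth vectors_def)
  have row: "x ! i = z ! i + (\<Sum>c<M. of_bool (z ! i \<le> c \<and> c < x ! i))" if "i < length x" for i
  proof -
    have "(\<Sum>c<M. of_bool (z ! i \<le> c \<and> c < x ! i)) = card ({..<M} \<inter> {c. z ! i \<le> c \<and> c < x ! i})"
      by (simp add: sum_of_bool_eq)
    also have "{..<M} \<inter> {c. z ! i \<le> c \<and> c < x ! i} = {z ! i..<x ! i}"
      using l(3)[OF that] by auto
    finally show ?thesis using l(2)[OF that] by simp
  qed
  have "sum_list x = (\<Sum>i<length x. z ! i + (\<Sum>c<M. of_bool (z ! i \<le> c \<and> c < x ! i)))"
    using row by (simp add: sum_list_sum_nth atLeast0LessThan)
  also have "\<dots> = sum_list z + (\<Sum>c<M. \<Sum>i<length x. of_bool (z ! i \<le> c \<and> c < x ! i))"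
    unfolding sum.distrib by (subst (2) sum.swap) (simp add: sum_list_sum_nth atLeast0LessThan l)
  also have "(\<Sum>c<M. \<Sum>i<length x. of_bool (z ! i \<le> c \<and> c < x ! i)) = (\<Sum>c<M. of_bool (C ! c) :: nat)"
  proof (rule sum.cong[OF refl])
    fix c assume "c \<in> {..<M}"
    then have "card (growing z x (Suc c)) = of_bool (C ! c)" using ok by (simp add: step_ok_def)
    moreover have "{..<length x} \<inter> {i. z ! i \<le> c \<and> c < x ! i} = growing z x (Suc c)"
      by (auto simp: growing_def)
    ultimately show "(\<Sum>i<length x. of_bool (z ! i \<le> c \<and> c < x ! i)) = (of_bool (C ! c) :: nat)"
      by (simp add: sum_of_bool_eq)
  qed
  finally show ?thesis by (simp add: ones_eq_sum C)
qed

lemma singleton_if_all_eq: "(\<And>j. j \<in> S \<Longrightarrow> j = a) \<Longrightarrow> S = (if S \<noteq> {} then {a} else {})"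
  by auto

text \<open>
  For columns beyond the first, the third condition on strips says that no row above the new cell
  could have been lengthened instead; for the first column, the second condition says that no
  empty row remains below the new cell.
\<close>

lemma strip_step_ok:
  assumes s: "strip z x" and x: "x \<in> vectors M n" "zeros_first x"
  defines "C \<equiv> map (\<lambda>c. growing z x (Suc c) \<noteq> {}) [0..<M]"
  shows "\<forall>d<M. step_ok z x C d"
proof (intro allI impI)
  fix d assume d: "d < M"
  have len: "length z = length x" using s strip_length by blast
  have sub: "growing z x (Suc d) \<subseteq> movable z x d" by (auto simp: growing_def movable_def)
  have "j = (if d = 0 then Max else Min) (movable z x d)" if j: "j \<in> growing z x (Suc d)" for j
  proof (cases d)
    case 0
    have "i \<le> j" if i: "i \<in> movable z x d" for i
    proof (rule ccontr)
      assume "\<not> i \<le> j"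
      with j i 0 have ji: "j < i \<and> i < length x \<and> 0 < x ! j" by (auto simp: growing_def movable_def)
      with x(2) have "0 < x ! i" unfolding zeros_first_def by blast
      with ji s have "0 < z ! i" unfolding strip_def by blast
      with i 0 show False by (simp add: movable_def)
    qed
    then have "Max (movable z x d) = j" using j sub by (intro Max_eqI) auto
    with 0 show ?thesis by simp
  next
    case (Suc k)
    have "j \<le> i" if i: "i \<in> movable z x d" for i
    proof (rule ccontr)
      assume "\<not> j \<le> i"
      with j i Suc have "i < j \<and> j < length x \<and> k < x ! i \<and> z ! j \<le> Suc k \<and> Suc k < x ! j"
        by (auto simp: growing_def movable_def)
      then have "Suc k < z ! i" using s unfolding strip_def by blast
      with i Suc show False by (simp add: movable_def)
    qed
    then have "Min (movable z x d) = j" using j sub by (intro Min_eqI) auto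
    with Suc show ?thesis by simp
  qed
  from singleton_if_all_eq[OF this] sub d show "step_ok z x C d"
    unfolding step_ok_def C_def by auto
qed

lemma step_ok_strip:
  assumes le: "list_all2 (\<le>) z x" and x: "x \<in> vectors M n" and z: "zeros_first z" and M: "0 < M"
    and ok: "\<forall>d<M. step_ok z x C d"
  shows "strip z x \<and> zeros_first x"
proof -
  have len: "length z = length x" using le by (rule list_all2_lengthD)
  have lei: "z ! i \<le> x ! i" if "i < length x" for i
    using le that by (auto simp: list_all2_conv_all_nth)
  have single: "j = (if d = 0 then Max else Min) (movable z x d)" if "j \<in> growing z x (Suc d)" "d < M" for j d
  proof -
    have "step_ok z x C d" using ok that by blast
    with that show ?thesis by (auto simp: step_ok_def split: if_splits)
  qed
  have top: "i \<le> j" if "j \<in> growing z x 1" "i \<in> movable z x 0" for i j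
    using single[of j 0] that M Max_ge[OF finite_growing_movable(2), of i z x 0] by simp
  show ?thesis
    unfolding strip_def
  proof (intro conjI allI impI)
    fix i j assume *: "i < j \<and> j < length x \<and> 0 < x ! i \<and> 0 < x ! j"
    show "0 < z ! j"
    proof (rule ccontr)
      assume "\<not> 0 < z ! j"
      moreover from this have "\<not> 0 < z ! i" using z * len unfolding zeros_first_def by metis
      ultimately have "i \<in> growing z x 1" "j \<in> movable z x 0" using * by (auto simp: growing_def movable_def)
      with top * show False by fastforce
    qed
  next
    fix i j k assume *: "i < j \<and> j < length x \<and> k < x ! i \<and> z ! j \<le> Suc k \<and> Suc k < x ! j"
    show "Suc k < z ! i"
    proof (rule ccontr)
      assume "\<not> Suc k < z ! i"
      with * have i: "i \<in> movable z x (Suc k)" and j: "j \<in> growing z x (Suc (Suc k))"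
        by (auto simp: growing_def movable_def)
      have "x ! j \<le> M" using x * by (auto simp: vectors_def)
      with * have "Suc k < M" by linarith
      with single[OF j] have "j = Min (movable z x (Suc k))" by simp
      with Min_le[OF finite_growing_movable(2) i] * show False by simp
    qed
  next
    show "zeros_first x"
      unfolding zeros_first_def
    proof (intro allI impI)
      fix i j assume *: "i < j \<and> j < length x \<and> 0 < x ! i"
      have "0 < z ! j"
      proof (rule ccontr)
        assume "\<not> 0 < z ! j"
        moreover from this have "\<not> 0 < z ! i" using z * len unfolding zeros_first_def by metis
        ultimately have "i \<in> growing z x 1" "j \<in> movable z x 0" using * by (auto simp: growing_def movable_def)
        with top * show False by fastforce
      qed
      with lei[of j] * show "0 < x ! j" by simp
    qed
  qed (rule le)
qed

text \<open>
  A strip is given by its set of columns, and each set of columns that can act gives a strip.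
\<close>

lemma card_col_op_top:
  assumes z: "z \<in> vectors M n" "zeros_first z" and x: "x \<in> vectors M n" "zeros_first x" and M: "0 < M"
  shows "card {C. length C = M \<and> ones C = k \<and> col_op_top C (levels M z) = Some (levels M x)} =
    of_bool (strip z x \<and> sum_list x = sum_list z + k)"
proof (cases "strip z x \<and> sum_list x = sum_list z + k")
  case True
  define C where "C = map (\<lambda>c. growing z x (Suc c) \<noteq> {}) [0..<M]"
  have le: "list_all2 (\<le>) z x" using True by (simp add: strip_def)
  have len: "length C = M" by (simp add: C_def)
  have ok: "\<forall>d<M. step_ok z x C d"
    unfolding C_def using strip_step_ok True x by blast
  have "C' = C" if "length C' = M" "col_op_top C' (levels M z) = Some (levels M x)" for C'
  proof (rule nth_equalityI)
    fix c assume c: "c < length C'"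
    have "step_ok z x C' c" using that c col_op_top_levels_iff[OF z(1) x(1) that(1) M] by blast
    moreover have "step_ok z x C c" using ok c that(1) by blast
    ultimately show "C' ! c = C ! c" by (auto simp: step_ok_def split: if_splits)
  qed (simp add: that len)
  moreover have "col_op_top C (levels M z) = Some (levels M x)"
    using col_op_top_levels_iff[OF z(1) x(1) len M] ok le by blast
  moreover have "ones C = k" using step_ok_ones[OF le x(1) len ok] True by simp
  ultimately have "{C. length C = M \<and> ones C = k \<and> col_op_top C (levels M z) = Some (levels M x)} = {C}"
    using len by blast
  with True show ?thesis by simp
next
  case False
  have "\<not> (length C = M \<and> ones C = k \<and> col_op_top C (levels M z) = Some (levels M x))" for C
  proof
    assume *: "length C = M \<and> ones C = k \<and> col_op_top C (levels M z) = Some (levels M x)"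
    then have "list_all2 (\<le>) z x" "\<forall>d<M. step_ok z x C d"
      using col_op_top_levels_iff[OF z(1) x(1) _ M] by blast+
    with step_ok_strip[OF _ x(1) z(2) M] step_ok_ones[OF _ x(1)] * False show False by blast
  qed
  then have "{C. length C = M \<and> ones C = k \<and> col_op_top C (levels M z) = Some (levels M x)} = {}" by blast
  with False show ?thesis by (simp only: card.empty of_bool_def if_False)
qed

fun col_ops_top :: "bool list list \<Rightarrow> nat multiset list \<Rightarrow> nat multiset list option" where
  "col_ops_top [] X = Some X"
| "col_ops_top (C # Cs) X = Option.bind (col_ops_top Cs X) (col_op_top C)"

lemma col_ops_top_levels:
  assumes y: "y \<in> vectors M n" "zeros_first y" and M: "0 < M"
  shows "of_height M Cs \<Longrightarrow> col_ops_top Cs (levels M y) = Some Z \<Longrightarrow> \<exists>z\<in>vectors M n. zeros_first z \<and> Z = levels M z"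
proof (induction Cs arbitrary: Z)
  case (Cons C Cs)
  then obtain Y where Y: "col_ops_top Cs (levels M y) = Some Y" "col_op_top C Y = Some Z"
    by (auto simp: bind_eq_Some_conv)
  obtain z where z: "z \<in> vectors M n" "zeros_first z" "Y = levels M z" using Cons.IH Y(1) Cons.prems(1) by auto
  have "length Z = Suc M" "sum_list Z = mset_set {..<n}"
    using col_op_top_sum[OF Y(2)] z(3) sum_list_levels_all[OF z(1)] by auto
  then obtain x where x: "x \<in> vectors M n" "Z = levels M x" using levels_surj by blast
  have "list_all2 (\<le>) z x \<and> (\<forall>d<M. step_ok z x C d)"
    using col_op_top_levels_iff[OF z(1) x(1) _ M] Y(2) z(3) x(2) Cons.prems(1) by auto
  with step_ok_strip[OF _ x(1) z(2) M] x show ?case by blast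
qed (use y in auto)

lemma finite_vectors: "finite (vectors M n)"
proof (rule finite_subset)
  show "vectors M n \<subseteq> {v. set v \<subseteq> {..M} \<and> length v = n}"
    by (auto simp: vectors_def in_set_conv_nth)
qed (rule finite_lists_length_eq, simp)

lemma below_vectors: "z \<in> below x \<Longrightarrow> x \<in> vectors M n \<Longrightarrow> z \<in> vectors M n"
  by (auto simp: vectors_def list_all2_conv_all_nth intro: order_trans)

text \<open>
  The head of the list of column sets acts last, in accordance with the order of the sizes in
  \<open>chain_count\<close>.
\<close>

lemma chain_count_col_ops_top:
  assumes y: "y \<in> vectors M n" "zeros_first y" and M: "0 < M"
  shows "x \<in> vectors M n \<Longrightarrow> zeros_first x \<Longrightarrow>
   chain_count y ks x = card {Cs. of_height M Cs \<and> map ones Cs = ks \<and> col_ops_top Cs (levels M y) = Some (levels M x)}"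
proof (induction ks arbitrary: x)
  case Nil
  have "{Cs. of_height M Cs \<and> map ones Cs = [] \<and> col_ops_top Cs (levels M y) = Some (levels M x)} = (if x = y then {[]} else {})"
    using levels_inject[OF y(1) Nil(1)] by auto
  then show ?case by simp
next
  case (Cons k ks)
  let ?V = "{z \<in> vectors M n. zeros_first z}"
  let ?A = "\<lambda>z. {C. length C = M \<and> ones C = k \<and> col_op_top C (levels M z) = Some (levels M x)}"
  let ?B = "\<lambda>z. {Cs. of_height M Cs \<and> map ones Cs = ks \<and> col_ops_top Cs (levels M y) = Some (levels M z)}"
  let ?L = "{Cs. of_height M Cs \<and> map ones Cs = k # ks \<and> col_ops_top Cs (levels M y) = Some (levels M x)}"
  let ?g = "\<lambda>(C, Cs). C # Cs"
  have finA: "finite (?A z)" for z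
    using finite_lists_length_eq[of "UNIV :: bool set" M] by (rule rev_finite_subset) auto
  have finB: "finite (?B z)" for z
    by (rule finite_subset[OF _ finite_of_height[of M "length ks" "\<lambda>_. True"]]) auto
  have finV: "finite ?V" using finite_vectors by simp
  have "?L = (\<Union>z\<in>?V. ?g ` (?A z \<times> ?B z))"
  proof (intro equalityI subsetI)
    fix Ds assume "Ds \<in> ?L"
    then obtain C Cs where D: "Ds = C # Cs" "length C = M" "of_height M Cs" "ones C = k" "map ones Cs = ks"
      "Option.bind (col_ops_top Cs (levels M y)) (col_op_top C) = Some (levels M x)"
      by (auto simp: map_eq_Cons_conv)
    then obtain Z where Z: "col_ops_top Cs (levels M y) = Some Z" "col_op_top C Z = Some (levels M x)"
      by (auto simp: bind_eq_Some_conv)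
    obtain z where z: "z \<in> ?V" "Z = levels M z" using col_ops_top_levels[OF y M D(3) Z(1)] by blast
    with D Z show "Ds \<in> (\<Union>z\<in>?V. ?g ` (?A z \<times> ?B z))" by (auto simp: image_iff)
  qed auto
  moreover have "disjoint_family_on (\<lambda>z. ?g ` (?A z \<times> ?B z)) ?V"
    unfolding disjoint_family_on_def using levels_inject[of _ M n] by fastforce
  ultimately have "card ?L = (\<Sum>z\<in>?V. card (?g ` (?A z \<times> ?B z)))"
    using finV finA finB by (simp only:) (rule card_UN_disjoint', auto)
  also have "\<dots> = (\<Sum>z\<in>?V. card (?A z) * card (?B z))"
    by (intro sum.cong refl) (subst card_image, auto simp: inj_on_def card_cartesian_product)
  also have "\<dots> = (\<Sum>z\<in>?V. of_bool (strip z x \<and> sum_list x = sum_list z + k) * chain_count y ks z)"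
  proof (intro sum.cong refl)
    fix z assume "z \<in> ?V"
    then have z: "z \<in> vectors M n" "zeros_first z" by auto
    show "card (?A z) * card (?B z) = of_bool (strip z x \<and> sum_list x = sum_list z + k) * chain_count y ks z"
      by (simp only: card_col_op_top[OF z Cons.prems M] Cons.IH[OF z])
  qed
  also have "\<dots> = (\<Sum>z\<in>{z. strip z x \<and> sum_list x = sum_list z + k}. chain_count y ks z)"
  proof (rule sum.mono_neutral_cong_right[OF finV])
    show "{z. strip z x \<and> sum_list x = sum_list z + k} \<subseteq> ?V"
      using strip_below below_vectors strip_zeros_first Cons.prems by blast
  qed auto
  finally show ?case by simp
qed

section \<open>Uniform shapes\<close>

text \<open>
  Two levels are similar if they agree except for the names of the rows above row \<open>r\<close>, of which
  they contain the same number.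
\<close>

definition similar :: "nat \<Rightarrow> nat multiset \<Rightarrow> nat multiset \<Rightarrow> bool" where
  "similar r S S' \<longleftrightarrow> filter_mset (\<lambda>i. r \<le> i) S = filter_mset (\<lambda>i. r \<le> i) S' \<and> size S = size S'"

lemma similar_refl: "similar r S S"
  by (simp add: similar_def)

lemma similar_sym: "similar r S S' \<Longrightarrow> similar r S' S"
  by (simp add: similar_def)

lemma similar_add: "similar r S S' \<Longrightarrow> similar r E E' \<Longrightarrow> similar r (S + E) (S' + E')"
  by (simp add: similar_def)

lemma similar_remove_low:
  assumes "similar r A A'" "a \<in># A" "a < r" "a' \<in># A'" "a' < r"
  shows "similar r {#a#} {#a'#}" "similar r (A - {#a#}) (A' - {#a'#})"
  using assms by (auto simp: similar_def filter_diff_mset size_Diff_singleton)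

lemma similar_all_high:
  assumes "similar r A A'" "\<forall>a\<in>#A. r \<le> a"
  shows "A' = A"
proof -
  have A: "filter_mset (\<lambda>i. r \<le> i) A = A" using assms(2) by (simp add: filter_mset_eq_conv)
  have "A \<subseteq># A'" using assms(1) A multiset_filter_subset unfolding similar_def by metis
  moreover have "size A' = size A" using assms(1) by (simp add: similar_def)
  ultimately show ?thesis by (metis less_irrefl mset_subset_size subset_mset.le_imp_less_or_eq)
qed

text \<open>
  If one of the levels contains a row above \<open>r\<close>, then so does the other, and both least elements
  are such rows. Otherwise the levels are equal.
\<close>

lemma similar_least:
  assumes "similar r A A'" "A \<noteq> {#}"
  shows "similar r {#least A#} {#least A'#} \<and> similar r (A - {#least A#}) (A' - {#least A'#})"
proof (cases "\<forall>a\<in>#A. r \<le> a")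
  case True
  with similar_all_high[OF assms(1)] similar_refl show ?thesis by metis
next
  case False
  then obtain a where a: "a \<in># A" "a < r" by (auto simp: not_le)
  have "\<not> (\<forall>a\<in>#A'. r \<le> a)"
  proof
    assume "\<forall>a\<in>#A'. r \<le> a"
    moreover from this have "A = A'" by (rule similar_all_high[OF similar_sym[OF assms(1)]])
    ultimately show False using a by auto
  qed
  then obtain a' where a': "a' \<in># A'" "a' < r" by (auto simp: not_le)
  have "least A < r" "least A' < r" using a a' least_le by (meson order_le_less_trans)+
  moreover have "least A \<in># A" "least A' \<in># A'" using a(1) a'(1) by (auto intro!: least_in)
  ultimately show ?thesis using similar_remove_low[OF assms(1)] by blast
qed

lemma similar_empty: "similar r A A' \<Longrightarrow> A = {#} \<longleftrightarrow> A' = {#}"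
  by (metis similar_def size_eq_0_iff_empty)

lemma col_op_similar:
  "list_all2 (similar r) Ss Ss' \<Longrightarrow> similar r E E' \<Longrightarrow>
    rel_option (list_all2 (similar r)) (col_op E C Ss) (col_op E' C Ss')"
proof (induction C arbitrary: E E' Ss Ss')
  case Nil
  then show ?case by (cases Ss; cases Ss') (auto intro: similar_add)
next
  case (Cons c C)
  show ?case
  proof (cases Ss)
    case Nil
    with Cons show ?thesis by simp
  next
    case S: (Cons S Ts)
    then obtain S' Ts' where S': "Ss' = S' # Ts'" "similar r S S'" "list_all2 (similar r) Ts Ts'"
      using Cons.prems by (auto simp: list_all2_Cons1)
    let ?A = "S + E" and ?A' = "S' + E'"
    have A: "similar r ?A ?A'" using S' Cons.prems similar_add by blast
    show ?thesis
    proof (cases c)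
      case True
      show ?thesis
      proof (cases "?A = {#}")
        case True
        moreover from this have "?A' = {#}" using similar_empty[OF A] by blast
        ultimately show ?thesis using \<open>c\<close> S S' by simp
      next
        case False
        then have ne: "?A' \<noteq> {#}" using similar_empty[OF A] by blast
        have "rel_option (list_all2 (similar r)) (col_op {#least ?A#} C Ts) (col_op {#least ?A'#} C Ts')"
          using Cons.IH[OF S'(3)] similar_least[OF A False] by blast
        then have "rel_option (list_all2 (similar r)) (map_option ((#) (?A - {#least ?A#})) (col_op {#least ?A#} C Ts))
            (map_option ((#) (?A' - {#least ?A'#})) (col_op {#least ?A'#} C Ts'))"
          using similar_least[OF A False] by (auto simp: option.rel_map elim!: option.rel_mono_strong)
        with False ne \<open>c\<close> S S' show ?thesis by (auto simp: Let_def)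
      qed
    next
      case False
      have "rel_option (list_all2 (similar r)) (col_op {#} C Ts) (col_op {#} C Ts')"
        using Cons.IH[OF S'(3) similar_refl] .
      then have "rel_option (list_all2 (similar r)) (map_option ((#) ?A) (col_op {#} C Ts)) (map_option ((#) ?A') (col_op {#} C Ts'))"
        using A by (auto simp: option.rel_map elim!: option.rel_mono_strong)
      with False S S' show ?thesis by (simp add: Let_def)
    qed
  qed
qed

text \<open>
  The empty rows are all above \<open>r\<close>, so the highest and the lowest of them are similar.
\<close>

definition similar_states :: "nat \<Rightarrow> nat multiset list \<Rightarrow> nat multiset list \<Rightarrow> bool" where
  "similar_states r Ss Ss' \<longleftrightarrow> list_all2 (similar r) Ss Ss' \<and> Ss \<noteq> [] \<and>
     (\<forall>i\<in>#hd Ss. i < r) \<and> (\<forall>i\<in>#hd Ss'. i < r)"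

lemma col_op_top_similar:
  assumes "similar_states r Ss Ss'" "C \<noteq> []"
  shows "rel_option (similar_states r) (col_op_top C Ss) (col_op {#} C Ss')"
proof -
  obtain c cs where C: "C = c # cs" using assms(2) by (cases C) auto
  obtain S Ts S' Ts' where S: "Ss = S # Ts" "Ss' = S' # Ts'" "similar r S S'" "list_all2 (similar r) Ts Ts'"
    and low: "\<forall>i\<in>#S. i < r" "\<forall>i\<in>#S'. i < r"
    using assms(1) by (auto simp: similar_states_def neq_Nil_conv list_all2_Cons1)
  have main: "rel_option (similar_states r) (map_option ((#) (S - D)) (col_op D cs Ts)) (map_option ((#) (S' - D')) (col_op D' cs Ts'))"
    if "similar r D D'" "similar r (S - D) (S' - D')" for D D'
    using col_op_similar[OF S(4) that(1), of cs] that(2) low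
    by (auto simp: option.rel_map similar_states_def dest: in_diffD elim!: option.rel_mono_strong)
  show ?thesis
  proof (cases "c \<and> S \<noteq> {#}")
    case True
    then have S': "S' \<noteq> {#}" using similar_empty[OF S(3)] by blast
    have "Max (set_mset S) \<in># S" using True by (intro Max_in) auto
    moreover have "least S' \<in># S'" using S' by (rule least_in)
    ultimately have "similar r {#Max (set_mset S)#} {#least S'#}" "similar r (S - {#Max (set_mset S)#}) (S' - {#least S'#})"
      using similar_remove_low[OF S(3)] low by blast+
    from main[OF this] True S' show ?thesis by (simp add: C S Let_def)
  next
    case False
    then show ?thesis using main[of "{#}" "{#}"] similar_empty[OF S(3)] S(3) similar_refl by (auto simp: C S Let_def)
  qed
qed

lemma col_ops_top_similar:
  assumes "similar_states r X X'" "0 < M"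
  shows "of_height M Cs \<Longrightarrow> rel_option (similar_states r) (col_ops_top Cs X) (col_ops Cs X')"
proof (induction Cs)
  case (Cons C Cs)
  then have IH: "rel_option (similar_states r) (col_ops_top Cs X) (col_ops Cs X')" and C: "C \<noteq> []"
    using assms(2) by auto
  from IH show ?case
    by (cases rule: option.rel_cases) (auto intro!: col_op_top_similar[OF _ C])
qed (use assms in simp)

lemma col_ops_sum:
  "col_ops Cs X = Some Z \<Longrightarrow> length Z = length X \<and> sum_list Z = sum_list X"
proof (induction Cs arbitrary: Z)
  case (Cons C Cs)
  then show ?case using col_op_sum by (fastforce simp: bind_eq_Some_conv)
qed simp

lemma col_ops_top_sum:
  "col_ops_top Cs X = Some Z \<Longrightarrow> length Z = length X \<and> sum_list Z = sum_list X"
proof (induction Cs arbitrary: Z)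
  case (Cons C Cs)
  then show ?case using col_op_top_sum by (fastforce simp: bind_eq_Some_conv)
qed simp

text \<open>
  Uniformity enters here: if the rows above \<open>r\<close> have equal lengths, then their names do not
  matter.
\<close>

lemma similar_levels_unique:
  assumes x: "x \<in> vectors M n" and v: "v \<in> vectors M n" and const: "\<And>i. i < r \<Longrightarrow> x ! i = a"
    and r: "r \<le> n" and similar: "list_all2 (similar r) (levels M x) (levels M v)"
  shows "v = x"
proof (rule nth_equalityI)
  show "length v = length x" using x v by (simp add: vectors_def)
  fix i assume "i < length v"
  then have i: "i < n" using v by (simp add: vectors_def)
  have s: "similar r (levels M x ! c) (levels M v ! c)" if "c \<le> M" for c
    using similar that by (simp add: list_all2_conv_all_nth)
  show "v ! i = x ! i"
  proof (cases "r \<le> i")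
    case True
    let ?c = "x ! i"
    have c: "?c \<le> M" using x i by (simp add: vectors_def)
    have "i \<in># filter_mset (\<lambda>i. r \<le> i) (levels M x ! ?c)" using c True i x by (simp add: vectors_def)
    then have "i \<in># filter_mset (\<lambda>i. r \<le> i) (levels M v ! ?c)" using s[OF c] by (simp only: similar_def)
    then show ?thesis using c by simp
  next
    case False
    let ?c = "v ! i"
    have c: "?c \<le> M" using v i by (simp add: vectors_def)
    have iv: "i \<in># levels M v ! ?c" using c i v by (simp add: vectors_def)
    have "?c = a"
    proof (rule ccontr)
      assume ne: "?c \<noteq> a"
      have "\<forall>j\<in>#levels M x ! ?c. r \<le> j"
      proof
        fix j assume "j \<in># levels M x ! ?c"
        then have "x ! j = ?c" using c by simp
        with const[of j] ne show "r \<le> j" by (cases "j < r") auto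
      qed
      then have "levels M v ! ?c = levels M x ! ?c" by (rule similar_all_high[OF s[OF c]])
      with iv have "i \<in># levels M x ! ?c" by simp
      then have "x ! i = ?c" using c by simp
      with const[of i] False ne show False by simp
    qed
    with const[of i] False show ?thesis by simp
  qed
qed

lemma col_ops_top_iff_col_ops:
  assumes x: "x \<in> vectors M n" and y: "y \<in> vectors M n" and M: "0 < M" and r: "r \<le> n"
    and const: "\<And>i. i < r \<Longrightarrow> x ! i = a" and zeros: "\<And>i. i < n \<Longrightarrow> y ! i = 0 \<Longrightarrow> i < r"
    and w: "of_height M Cs"
  shows "col_ops_top Cs (levels M y) = Some (levels M x) \<longleftrightarrow> col_ops Cs (levels M y) = Some (levels M x)"
proof -
  have "hd (levels M y) = mset_set {i. i < length y \<and> y ! i = 0}"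
    using nth_levels[of 0 M y] by (simp add: hd_conv_nth levels_def)
  then have "similar_states r (levels M y) (levels M y)"
    using zeros y by (auto simp: similar_states_def similar_refl list.rel_refl vectors_def levels_def)
  from col_ops_top_similar[OF this M w]
  have rel: "rel_option (similar_states r) (col_ops_top Cs (levels M y)) (col_ops Cs (levels M y))" .
  note sy = sum_list_levels_all[OF y]
  show ?thesis
  proof
    assume t: "col_ops_top Cs (levels M y) = Some (levels M x)"
    with rel obtain Z where Z: "col_ops Cs (levels M y) = Some Z" "similar_states r (levels M x) Z"
      by (auto simp: option_rel_Some1)
    obtain v where v: "v \<in> vectors M n" "Z = levels M v"
      using levels_surj[of Z M n] col_ops_sum[OF Z(1)] sy by auto
    then have "v = x"
      using similar_levels_unique[OF x v(1) const r] Z(2) by (auto simp: similar_states_def)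
    with Z v show "col_ops Cs (levels M y) = Some (levels M x)" by simp
  next
    assume t: "col_ops Cs (levels M y) = Some (levels M x)"
    with rel obtain Z where Z: "col_ops_top Cs (levels M y) = Some Z" "similar_states r Z (levels M x)"
      by (auto simp: option_rel_Some2)
    obtain v where v: "v \<in> vectors M n" "Z = levels M v"
      using levels_surj[of Z M n] col_ops_top_sum[OF Z(1)] sy by auto
    have "list_all2 (similar r) (levels M v) (levels M x)" using Z(2) v(2) by (simp add: similar_states_def)
    then have "list_all2 (similar r) (levels M x) (levels M v)"
      unfolding list_all2_conv_all_nth using similar_sym by metis
    then have "v = x" using similar_levels_unique[OF x v(1) const r] by blast
    with Z v show "col_ops_top Cs (levels M y) = Some (levels M x)" by simp
  qed
qed

section \<open>Symmetry of Schur functions\<close>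

lemma schur_0: "0 \<in># m \<Longrightarrow> schur \<nu> m = 0"
proof -
  assume "0 \<in># m"
  then have "tableau_content \<nu> T \<noteq> m" if "T \<in> SSYT \<nu>" for T
    using that by (force simp: SSYT_def filling_def tableau_content_def diagram_finite PiE_iff)
  then have "{T \<in> SSYT \<nu>. tableau_content \<nu> T = m} = {}" by blast
  then show ?thesis by (simp only: schur_def card.empty of_nat_0)
qed

lemma schur_size: "schur \<nu> m \<noteq> 0 \<Longrightarrow> size m = sum_list \<nu>"
proof -
  assume "schur \<nu> m \<noteq> 0"
  then have "{T \<in> SSYT \<nu>. tableau_content \<nu> T = m} \<noteq> {}"
    unfolding schur_def by (metis card.empty of_nat_0)
  then show ?thesis using content_size by auto
qed

text \<open>
  Empty rows below a partition do not change its tableaux; they bring the number of rows to the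
  number \<open>N\<close> of variables.
\<close>

lemma schur_gt_count:
  assumes \<nu>: "int_partition \<nu>" "length \<nu> \<le> N" and m: "\<And>i. i \<in># m \<Longrightarrow> 1 \<le> i \<and> i \<le> N"
  shows "schur \<nu> m = of_nat (gt_count (map (count m) [1..<Suc N]) (\<nu> @ replicate (N - length \<nu>) 0))"
proof -
  let ?\<nu> = "\<nu> @ replicate (N - length \<nu>) 0"
  have "diagram ?\<nu> = diagram \<nu>" by (auto simp: diagram_def nth_append split: if_splits)
  then have "{T \<in> SSYT \<nu>. tableau_content \<nu> T = m} = {T \<in> SSYT ?\<nu>. tableau_content ?\<nu> T = m}"
    unfolding SSYT_def filling_def tableau_content_def by simp
  then have "schur \<nu> m = of_nat (card {T \<in> SSYT ?\<nu>. tableau_content ?\<nu> T = m})"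
    by (simp add: schur_def)
  also have "card {T \<in> SSYT ?\<nu>. tableau_content ?\<nu> T = m} = gt_count (map (count m) (rev [1..<Suc N])) ?\<nu>"
  proof (rule card_SSYT)
    show "decreasing ?\<nu>" using \<nu>(1) by (auto simp: decreasing_def int_partition_def sorted_wrt_append)
        (simp add: sorted_wrt_iff_nth_less)
    show "length ?\<nu> = N" using \<nu>(2) by simp
  qed (use m in auto)
  also have "gt_count (map (count m) (rev [1..<Suc N])) = gt_count (map (count m) [1..<Suc N])"
    by (rule gt_count_mset) (simp only: mset_map mset_rev)
  finally show ?thesis .
qed

text \<open>
  A permutation of the variables permutes the exponents over any sufficiently large range, and the
  number of Gelfand-Tsetlin patterns does not depend on their order.
\<close>

lemma schur_permute:
  assumes \<nu>: "int_partition \<nu>" and \<pi>: "\<pi> permutes {0<..}"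
  shows "schur \<nu> (image_mset \<pi> m) = schur \<nu> m"
proof (cases "0 \<in># m")
  case True
  have "\<pi> 0 = 0" using \<pi> by (simp add: permutes_def)
  with True have "0 \<in># image_mset \<pi> m" by (metis image_eqI set_image_mset)
  with True show ?thesis by (simp only: schur_0)
next
  case False
  let ?m = "image_mset \<pi> m"
  have inj: "inj \<pi>" using \<pi> permutes_inj by blast
  have \<pi>0: "0 < \<pi> i" if "0 < i" for i using permutes_in_image[OF \<pi>, of i] that by simp
  define N where "N = length \<nu> + Max (insert 0 (set_mset m \<union> set_mset ?m))"
  have "i \<le> N" if "i \<in># m \<or> i \<in># ?m" for i
  proof -
    have "i \<le> Max (insert 0 (set_mset m \<union> set_mset ?m))" using that by (intro Max_ge) auto
    then show ?thesis by (simp add: N_def)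
  qed
  moreover have pos: "0 < i" if "i \<in># m" for i using False that by (metis neq0_conv)
  moreover have "0 < i" if "i \<in># ?m" for i using that pos \<pi>0 by auto
  ultimately have b: "1 \<le> i \<and> i \<le> N" if "i \<in># m \<or> i \<in># ?m" for i
    using that by (metis One_nat_def Suc_leI)
  \<comment> \<open>the exponents of the variables that occur, and zeros\<close>
  have split: "mset (map (count k) [1..<Suc N]) =
      image_mset (count k) (mset_set (set_mset k)) + replicate_mset (N - card (set_mset k)) 0"
    if k: "k = m \<or> k = ?m" for k
  proof -
    let ?R = "{1..N} - set_mset k"
    have sub: "set_mset k \<subseteq> {1..N}" using b k by auto
    have "mset [1..<Suc N] = mset_set {1..N}" by (metis atLeastLessThanSuc_atLeastAtMost mset_upt)
    also have "\<dots> = mset_set (set_mset k) + mset_set ?R"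
      using sub by (intro mset_set_disjoint_Un) auto
    finally have "mset (map (count k) [1..<Suc N]) =
       image_mset (count k) (mset_set (set_mset k)) + image_mset (count k) (mset_set ?R)"
      by (simp only: mset_map image_mset_union)
    also have "image_mset (count k) (mset_set ?R) = image_mset (\<lambda>_. 0) (mset_set ?R)"
      by (intro image_mset_cong) (simp add: not_in_iff)
    also have "\<dots> = replicate_mset (N - card (set_mset k)) 0"
      using sub by (simp add: image_mset_const_eq card_Diff_subset)
    finally show ?thesis .
  qed
  have cnt: "count ?m (\<pi> i) = count m i" for i
    by (induction m) (auto dest: injD[OF inj])
  have inj': "inj_on \<pi> (set_mset m)" using inj by (rule inj_on_subset) simp
  have "image_mset (count ?m) (mset_set (set_mset ?m)) = image_mset (count ?m) (image_mset \<pi> (mset_set (set_mset m)))"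
    using inj' by (simp add: image_mset_mset_set)
  also have "\<dots> = image_mset (count m) (mset_set (set_mset m))"
    by (simp add: multiset.map_comp comp_def cnt)
  finally have "mset (map (count ?m) [1..<Suc N]) = mset (map (count m) [1..<Suc N])"
    using split[of ?m] split[of m] card_image[OF inj'] by simp
  then have "gt_count (map (count ?m) [1..<Suc N]) = gt_count (map (count m) [1..<Suc N])"
    by (rule gt_count_mset)
  moreover have "length \<nu> \<le> N" by (simp add: N_def)
  ultimately show ?thesis
    using schur_gt_count[OF \<nu>, of N m] schur_gt_count[OF \<nu>, of N ?m] b by simp
qed

section \<open>Schur positivity\<close>

lemma col_op_falses: "length X = Suc M \<Longrightarrow> col_op {#} (replicate M False) X = Some X"
proof (induction M arbitrary: X)
  case 0
  then show ?case by (cases X) auto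
next
  case (Suc M)
  then show ?case by (cases X) auto
qed

lemma col_ops_append: "col_ops (A @ B) X = Option.bind (col_ops B X) (col_ops A)"
  by (induction A) (simp, cases "col_ops B X", auto)

lemma col_ops_falses: "length X = Suc M \<Longrightarrow> col_ops (replicate k (replicate M False)) X = Some X"
  by (induction k) (simp_all add: col_op_falses)

lemma col_tableau_append1: "col_tableau (A @ B) \<Longrightarrow> col_tableau A"
proof (induction A rule: col_tableau.induct)
  case (1 p q P)
  then show ?case by simp
qed auto

lemma col_tableau_append_falses:
  "col_tableau P \<Longrightarrow> of_height M P \<Longrightarrow> col_tableau (P @ replicate k (replicate M False))"
proof (induction P rule: col_tableau.induct)
  case (1 p q P)
  then show ?case by simp
next
  case "2_1"
  show ?case
  proof (induction k)
    case (Suc k)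
    have "dominates 0 (replicate M False) (replicate M False)" by (rule subcol_dominates) (simp add: list.rel_refl)
    with Suc show ?case by (cases k) auto
  qed simp
next
  case ("2_2" p)
  have t: "col_tableau (replicate k (replicate M False))"
  proof (induction k)
    case (Suc k)
    have "dominates 0 (replicate M False) (replicate M False)" by (rule subcol_dominates) (simp add: list.rel_refl)
    with Suc show ?case by (cases k) auto
  qed simp
  have "dominates 0 p (replicate M False)"
    by (rule subcol_dominates) (use "2_2" in \<open>simp add: list_all2_conv_all_nth\<close>)
  with t show ?case by (cases k) auto
qed

lemma ones_eq_0: "ones p = 0 \<longleftrightarrow> p = replicate (length p) False"
  by (induction p) auto

lemma col_tableau_decreasing: "col_tableau P \<Longrightarrow> decreasing (map ones P)"
proof -
  have "col_tableau P \<Longrightarrow> sorted_wrt (\<ge>) (map ones P)"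
  proof (induction P rule: col_tableau.induct)
    case (1 p q P)
    then have "ones q \<le> ones p" using dominates_ones by fastforce
    with 1 show ?case by fastforce
  qed auto
  then show "col_tableau P \<Longrightarrow> decreasing (map ones P)" by (simp add: decreasing_def)
qed

lemma decreasing_filter:
  "decreasing \<nu> \<Longrightarrow> \<nu> = filter ((<) 0) \<nu> @ replicate (length \<nu> - length (filter ((<) 0) \<nu>)) 0"
proof (induction \<nu>)
  case (Cons a \<nu>)
  show ?case
  proof (cases "a = 0")
    case True
    with Cons.prems have "\<nu> = replicate (length \<nu>) 0"
      by (auto simp: decreasing_def replicate_length_same[symmetric] intro: replicate_eqI)
    moreover from this have "filter ((<) 0) \<nu> = []" by (metis filter_replicate less_irrefl)
    ultimately show ?thesis using True by simp
  next
    case False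
    with Cons show ?thesis by (simp add: decreasing_def)
  qed
qed simp

definition col_tabs :: "nat \<Rightarrow> nat multiset list \<Rightarrow> nat multiset list \<Rightarrow> nat list \<Rightarrow> bool list list set" where
  "col_tabs M X Y \<nu> = {P. of_height M P \<and> col_tableau P \<and> map ones P = \<nu> \<and> col_ops P X = Some Y}"

text \<open>
  Empty columns act trivially and fit to the right of any tableau. This makes the number of
  tableaux independent of the number of variables.
\<close>

lemma card_col_tabs_pad:
  assumes "length X = Suc M"
  shows "card (col_tabs M X Y (\<nu> @ replicate k 0)) = card (col_tabs M X Y \<nu>)"
proof -
  let ?Z = "replicate k (replicate M False)"
  have o: "ones (replicate M False) = 0" by (simp add: ones_eq_0)
  have "col_tabs M X Y (\<nu> @ replicate k 0) = (\<lambda>P. P @ ?Z) ` col_tabs M X Y \<nu>"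
  proof (intro equalityI subsetI)
    fix Q assume Q: "Q \<in> col_tabs M X Y (\<nu> @ replicate k 0)"
    then have m: "map ones Q = \<nu> @ replicate k 0" and w: "of_height M Q" and t: "col_tableau Q" and a: "col_ops Q X = Some Y"
      by (auto simp: col_tabs_def)
    obtain P R where QPR: "Q = P @ R" "map ones P = \<nu>" "map ones R = replicate k 0"
      using m by (auto simp: map_eq_append_conv)
    have "R = ?Z"
    proof (rule replicate_eqI)
      show "length R = k" using QPR(3) by (metis length_map length_replicate)
      fix p assume p: "p \<in> set R"
      then have "ones p = 0" using QPR(3) by (metis image_eqI in_set_replicate list.set_map)
      moreover have "length p = M" using p w QPR(1) by auto
      ultimately show "p = replicate M False" using ones_eq_0 by metis
    qed
    moreover have "col_ops P X = Some Y"
      using a col_ops_falses[OF assms, of k] \<open>R = ?Z\<close> by (simp add: QPR(1) col_ops_append)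
    ultimately show "Q \<in> (\<lambda>P. P @ ?Z) ` col_tabs M X Y \<nu>"
      using QPR w t col_tableau_append1 by (auto simp: col_tabs_def)
  next
    fix Q assume "Q \<in> (\<lambda>P. P @ ?Z) ` col_tabs M X Y \<nu>"
    then show "Q \<in> col_tabs M X Y (\<nu> @ replicate k 0)"
      using col_ops_falses[OF assms, of k] col_tableau_append_falses
      by (auto simp: col_tabs_def col_ops_append o map_replicate_const)
  qed
  then show ?thesis by (simp add: card_image inj_on_def)
qed

text \<open>
  Groups the tableaux by their column lengths, with the empty columns dropped.
\<close>

lemma sum_tabs_by_shape:
  assumes X: "length X = Suc M" and d: "d \<le> length ks" "sum_list ks = d"
  shows "(\<Sum>P | of_height M P \<and> length P = length ks \<and> col_tableau P \<and> col_ops P X = Some Y. gt_count ks (map ones P)) =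
    (\<Sum>\<nu> | int_partition \<nu> \<and> sum_list \<nu> = d.
       card (col_tabs M X Y \<nu>) * gt_count ks (\<nu> @ replicate (length ks - length \<nu>) 0))"
proof -
  let ?N = "length ks"
  let ?V = "{\<nu>. int_partition \<nu> \<and> sum_list \<nu> = d}"
  let ?T = "{P. of_height M P \<and> length P = ?N \<and> col_tableau P \<and> col_ops P X = Some Y}"
  let ?T' = "{P. of_height M P \<and> length P = ?N \<and> col_tableau P \<and> col_ops P X = Some Y \<and> sum_list (map ones P) = d}"
  let ?sh = "\<lambda>P. filter ((<) 0) (map ones P)"
  have finT: "finite ?T" "finite ?T'" by (rule finite_of_height)+
  have finV: "finite ?V"
    by (rule finite_subset[OF _ finite_compositions[of d]]) (auto simp: int_partition_def)
  have pos: "sum_list (filter ((<) 0) xs) = sum_list xs" for xs :: "nat list"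
    by (induction xs) auto
  have shV: "?sh P \<in> ?V" if "P \<in> ?T'" for P
  proof -
    have "sorted_wrt (\<ge>) (?sh P)" using col_tableau_decreasing that by (auto simp: decreasing_def intro: sorted_wrt_filter)
    then show ?thesis using that pos by (auto simp: int_partition_def composition_def)
  qed
  have group: "{P \<in> ?T'. ?sh P = \<nu>} = col_tabs M X Y (\<nu> @ replicate (?N - length \<nu>) 0)" if "\<nu> \<in> ?V" for \<nu>
  proof (intro equalityI subsetI)
    fix P assume P: "P \<in> {P \<in> ?T'. ?sh P = \<nu>}"
    then have "map ones P = \<nu> @ replicate (?N - length \<nu>) 0"
      using decreasing_filter[OF col_tableau_decreasing, of P] by auto
    with P show "P \<in> col_tabs M X Y (\<nu> @ replicate (?N - length \<nu>) 0)" by (auto simp: col_tabs_def)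
  next
    fix P assume P: "P \<in> col_tabs M X Y (\<nu> @ replicate (?N - length \<nu>) 0)"
    then have m: "map ones P = \<nu> @ replicate (?N - length \<nu>) 0" by (simp add: col_tabs_def)
    have "length \<nu> \<le> ?N" using that length_composition_le[of \<nu>] d by (auto simp: int_partition_def)
    then have "length P = ?N" using m by (metis length_map length_append length_replicate le_add_diff_inverse)
    moreover have "filter ((<) 0) \<nu> = \<nu>" using that by (auto simp: int_partition_def composition_def filter_id_conv)
    ultimately show "P \<in> {P \<in> ?T'. ?sh P = \<nu>}"
      using P that by (simp add: col_tabs_def m sum_list_replicate)
  qed
  have "(\<Sum>P\<in>?T. gt_count ks (map ones P)) = (\<Sum>P\<in>?T'. gt_count ks (map ones P))"
    by (rule sum.mono_neutral_right[OF finT(1)]) (use gt_count_sum d in auto)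
  also have "\<dots> = (\<Sum>\<nu>\<in>?V. \<Sum>P\<in>{P \<in> ?T'. ?sh P = \<nu>}. gt_count ks (map ones P))"
    by (rule sum.group[OF finT(2) finV, symmetric]) (use shV in blast)
  also have "\<dots> = (\<Sum>\<nu>\<in>?V. card (col_tabs M X Y \<nu>) * gt_count ks (\<nu> @ replicate (?N - length \<nu>) 0))"
  proof (rule sum.cong[OF refl])
    fix \<nu> assume \<nu>: "\<nu> \<in> ?V"
    let ?\<nu> = "\<nu> @ replicate (?N - length \<nu>) 0"
    have "(\<Sum>P\<in>{P \<in> ?T'. ?sh P = \<nu>}. gt_count ks (map ones P)) = (\<Sum>P\<in>col_tabs M X Y ?\<nu>. gt_count ks ?\<nu>)"
      unfolding group[OF \<nu>] by (rule sum.cong) (auto simp: col_tabs_def)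
    also have "\<dots> = card (col_tabs M X Y \<nu>) * gt_count ks ?\<nu>"
      by (simp add: card_col_tabs_pad[OF X])
    finally show "(\<Sum>P\<in>{P \<in> ?T'. ?sh P = \<nu>}. gt_count ks (map ones P)) = card (col_tabs M X Y \<nu>) * gt_count ks ?\<nu>" .
  qed
  finally show ?thesis .
qed

theorem corollary5p2:
  fixes \<beta> \<gamma> :: "nat list"
  assumes "uniform_skew_shape \<gamma> \<beta>"
  shows "skew_qschur \<gamma> \<beta> \<in> Sym \<and>
    (\<exists>c :: nat list \<Rightarrow> nat.
       finite {\<nu>. c \<nu> \<noteq> 0} \<and> (\<forall>\<nu>. c \<nu> \<noteq> 0 \<longrightarrow> int_partition \<nu>) \<and>
       skew_qschur \<gamma> \<beta> = (\<lambda>m. \<Sum>\<nu> | c \<nu> \<noteq> 0. of_nat (c \<nu>) * schur \<nu> m))"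
proof -
  have \<gamma>: "composition \<gamma>" and \<beta>: "composition \<beta>" and len: "length \<beta> \<le> length \<gamma>"
    and unif: "\<And>i j. i < j \<Longrightarrow> j < length \<gamma> - length \<beta> \<Longrightarrow> \<gamma> ! i = \<gamma> ! j"
    using assms by (auto simp: uniform_skew_shape_def skew_shape_def)
  define n where "n = length \<gamma>"
  \<comment> \<open>a bound on all row lengths, made positive so that there is a first column\<close>
  define M where "M = Suc (sum_list \<gamma> + sum_list \<beta>)"
  define y where "y = pad n \<beta>"
  define d where "d = sum_list \<gamma> - sum_list \<beta>"
  let ?X = "levels M y" and ?Y = "levels M \<gamma>" and ?r = "n - length \<beta>"
  have M: "0 < M" by (simp add: M_def)
  have x_vec: "\<gamma> \<in> vectors M n"
    using elem_le_sum_list[of _ \<gamma>] by (fastforce simp: vectors_def n_def M_def)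
  have sum_y: "sum_list y = sum_list \<beta>" by (simp add: y_def pad_def sum_list_replicate)
  have y_vec: "y \<in> vectors M n"
  proof -
    have "length y = n" using len by (simp add: y_def pad_def n_def)
    moreover have "y ! i \<le> M" if "i < length y" for i
      using elem_le_sum_list[OF that] sum_y by (simp add: M_def)
    ultimately show ?thesis by (simp add: vectors_def)
  qed
  have zf: "zeros_first \<gamma>" "zeros_first y"
    using zeros_first_pad[OF \<gamma>, of 0] zeros_first_pad[OF \<beta>, of n] by (simp_all add: pad_def y_def)
  \<comment> \<open>the top \<open>?r\<close> rows are those without cells of \<open>\<beta>\<close>; uniformity makes them equally long in \<open>\<gamma>\<close>\<close>
  have const: "\<gamma> ! i = \<gamma> ! 0" if "i < ?r" for i
    using unif[of 0 i] that by (cases i) (auto simp: n_def)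
  \<comment> \<open>the empty rows on top of \<open>\<beta>\<close> are the rows above \<open>?r\<close>\<close>
  have zeros: "i < ?r" if "i < n" "y ! i = 0" for i
  proof (rule ccontr)
    assume "\<not> i < ?r"
    then have "y ! i = \<beta> ! (i - ?r)" and "i - ?r < length \<beta>"
      using that(1) len by (auto simp: y_def pad_def nth_append n_def)
    with \<beta> that(2) show False by (metis composition_def less_irrefl nth_mem)
  qed
  have count: "chain_count y ks \<gamma> =
      (\<Sum>P | of_height M P \<and> length P = length ks \<and> col_tableau P \<and> col_ops P ?X = Some ?Y. gt_count ks (map ones P))" for ks
  proof -
    have "chain_count y ks \<gamma> = card {Cs. of_height M Cs \<and> map ones Cs = ks \<and> col_ops_top Cs ?X = Some ?Y}"
      by (rule chain_count_col_ops_top[OF y_vec zf(2) M x_vec zf(1)])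
    also have "{Cs. of_height M Cs \<and> map ones Cs = ks \<and> col_ops_top Cs ?X = Some ?Y} =
        {Cs. of_height M Cs \<and> map ones Cs = ks \<and> col_ops Cs ?X = Some ?Y}"
      using col_ops_top_iff_col_ops[OF x_vec y_vec M diff_le_self const zeros] by blast
    also have "card \<dots> = (\<Sum>P | of_height M P \<and> length P = length ks \<and> col_tableau P \<and> col_ops P ?X = Some ?Y. gt_count ks (map ones P))"
      by (rule card_col_ops)
    finally show ?thesis .
  qed
  let ?V = "{\<nu>. int_partition \<nu> \<and> sum_list \<nu> = d}"
  \<comment> \<open>the column lengths of a tableau form the conjugate of its shape\<close>
  define c where "c \<nu> = (if \<nu> \<in> ?V then card (col_tabs M ?X ?Y \<nu>) else 0)" for \<nu>
  have finV: "finite ?V"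
    by (rule finite_subset[OF _ finite_compositions[of d]]) (auto simp: int_partition_def)
  have sub: "{\<nu>. c \<nu> \<noteq> 0} \<subseteq> ?V" by (auto simp: c_def)
  have fin: "finite {\<nu>. c \<nu> \<noteq> 0}" using finite_subset[OF sub finV] .
  have part: "\<forall>\<nu>. c \<nu> \<noteq> 0 \<longrightarrow> int_partition \<nu>" using sub by blast
  have series: "skew_qschur \<gamma> \<beta> m = (if 0 \<in># m then 0 else of_nat (chain_count y (mults m) \<gamma>))" for m
    using skew_qschur_eq[OF \<gamma>] \<beta> len by (simp add: skew_series_def y_def n_def)
  have expand: "skew_qschur \<gamma> \<beta> m = (\<Sum>\<nu> | c \<nu> \<noteq> 0. of_nat (c \<nu>) * schur \<nu> m)" for m
  proof (cases "0 \<notin># m \<and> size m = d")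
    case True
    \<comment> \<open>at least \<open>d\<close>, so that each partition of \<open>d\<close> has at most \<open>N\<close> parts\<close>
    define N where "N = d + Max (insert 0 (set_mset m))"
    let ?ks = "map (count m) [1..<Suc N]"
    have le: "1 \<le> i \<and> i \<le> N" if "i \<in># m" for i
    proof -
      have "i \<le> Max (insert 0 (set_mset m))" using that by (intro Max_ge) auto
      moreover have "i \<noteq> 0" using True that by metis
      ultimately show ?thesis by (simp add: N_def)
    qed
    have range: "1 \<le> i \<and> i < 1 + N" if "i \<in># m" for i using le[OF that] by simp
    have cks: "chain_count y ?ks \<gamma> = chain_count y (mults m) \<gamma>"
      using chain_count_mults[OF range] by simp
    have "filter (\<lambda>k. k \<noteq> 0) ?ks = mults m" using mults_filter[OF range] by simp
    moreover have "sum_list (filter (\<lambda>k. k \<noteq> 0) xs) = sum_list xs" for xs :: "nat list"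
      by (induction xs) auto
    ultimately have sks: "sum_list ?ks = d" using sum_list_mults[of m] True by metis
    have lks: "length ?ks = N" by simp
    have dN: "d \<le> length ?ks" by (simp only: lks) (simp add: N_def)
    have "chain_count y (mults m) \<gamma> =
       (\<Sum>P | of_height M P \<and> length P = length ?ks \<and> col_tableau P \<and> col_ops P ?X = Some ?Y. gt_count ?ks (map ones P))"
      unfolding cks[symmetric] by (rule count)
    also have "\<dots> = (\<Sum>\<nu>\<in>?V. card (col_tabs M ?X ?Y \<nu>) * gt_count ?ks (\<nu> @ replicate (length ?ks - length \<nu>) 0))"
      by (rule sum_tabs_by_shape[OF length_levels dN sks])
    finally have "chain_count y (mults m) \<gamma> =
       (\<Sum>\<nu>\<in>?V. card (col_tabs M ?X ?Y \<nu>) * gt_count ?ks (\<nu> @ replicate (N - length \<nu>) 0))"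
      by (simp only: lks)
    then have "skew_qschur \<gamma> \<beta> m =
       (\<Sum>\<nu>\<in>?V. of_nat (card (col_tabs M ?X ?Y \<nu>)) * of_nat (gt_count ?ks (\<nu> @ replicate (N - length \<nu>) 0)))"
      using True by (simp only: series if_False of_nat_sum of_nat_mult)
    also have "\<dots> = (\<Sum>\<nu>\<in>?V. of_nat (c \<nu>) * schur \<nu> m)"
    proof (rule sum.cong[OF refl])
      fix \<nu> assume \<nu>: "\<nu> \<in> ?V"
      then have "length \<nu> \<le> N"
        using length_composition_le[of \<nu>] by (auto simp: int_partition_def N_def)
      with \<nu> le show "of_nat (card (col_tabs M ?X ?Y \<nu>)) * of_nat (gt_count ?ks (\<nu> @ replicate (N - length \<nu>) 0)) =
          of_nat (c \<nu>) * schur \<nu> m"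
        by (simp only: c_def if_True) (simp only: schur_gt_count mem_Collect_eq)
    qed
    also have "\<dots> = (\<Sum>\<nu> | c \<nu> \<noteq> 0. of_nat (c \<nu>) * schur \<nu> m)"
      by (rule sum.mono_neutral_right[OF finV sub]) auto
    finally show ?thesis .
  next
    case False
    have "skew_qschur \<gamma> \<beta> m = 0"
    proof (rule ccontr)
      assume "skew_qschur \<gamma> \<beta> m \<noteq> 0"
      then have "0 \<notin># m" "chain_count y (mults m) \<gamma> \<noteq> 0" by (auto simp: series split: if_splits)
      with chain_count_sum[of y "mults m" \<gamma>] False show False
        by (simp add: sum_list_mults sum_y d_def)
    qed
    moreover have "schur \<nu> m = 0" if "c \<nu> \<noteq> 0" for \<nu>
    proof (rule ccontr)
      assume "schur \<nu> m \<noteq> 0"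
      then have "0 \<notin># m" "size m = sum_list \<nu>" using schur_0 schur_size by blast+
      with sub that False show False by auto
    qed
    ultimately show ?thesis by simp
  qed
  have "bounded_degree (skew_qschur \<gamma> \<beta>)"
    using skew_series_QSym[of \<gamma> \<beta>] by (simp add: skew_qschur_eq[OF \<gamma>] QSym_def)
  moreover have "skew_qschur \<gamma> \<beta> (image_mset \<pi> m) = skew_qschur \<gamma> \<beta> m" if "\<pi> permutes {0<..}" for \<pi> m
    unfolding expand using schur_permute[OF _ that] part by (intro sum.cong refl) simp
  ultimately have "skew_qschur \<gamma> \<beta> \<in> Sym" by (simp add: Sym_def)
  with fin part expand show ?thesis by blast
qed

end
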